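(* Let $T$ be a complete first-order theory (working in a sufficiently saturated model). The following are equivalent. (i) $T$ is NCTP. (ii) For any parameter $b$, any cardinal $\kappa>2^{|T|+|b|+\aleph_0}$ with $\mathrm{cf}(\kappa)=\kappa$, and any strongly indiscernible tree $(a_\eta)_{\eta\in\omega^{<\kappa}}$, there exist $b'$ and $i<\kappa$ such that * $b'\equiv_{a_{0^i{}^\frown(1)}} b$, and * $(a_{0^i{}^\frown(1)^\frown 0^j})_{j<\kappa}$ is order indiscernible over $b'$.
   Context: Notation: $\omega^{<\kappa}=\bigcup_{\alpha<\kappa}\omega^\alpha$ is the set of functions from ordinals $\alpha<\kappa$ to $\omega$; $\eta\unlhd\nu$ means $\eta\subseteq\nu$ (initial segment); $\eta\perp\nu$ means neither is an initial segment of the other; $\eta\wedge\nu$ is the longest common initial segment; $\eta<_{lex}\nu$ means $\eta\lhd\nu$, or $\eta\perp\nu$ and $\eta(l(\eta\wedge\nu))<\nu(l(\eta\wedge\nu))$, where $l(\eta)$ is the domain of $\eta$; $\eta^\frown\nu$ is concatenation; $0^i$ is the constant-$0$ sequence of length $i$ and $(1)$ is the sequence of length $1$ with value $1$. A tree $(a_\eta)_{\eta\in\omega^{<\kappa}}$ is strongly indiscernible if it is indiscernible with respect to the language $\{\unlhd,<_{lex},\wedge\}$ on the index set: whenever two finite tuples of indices have the same quantifier-free type in $(\omega^{<\kappa};\unlhd,<_{lex},\wedge)$, the corresponding tuples $(a_\eta)$ have the same type. A subset $X\subseteq\omega^{<\omega}$ is a descending comb if it is an antichain (pairwise $\perp$)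 with an enumeration $\{\eta_i\}$ such that $\eta_{i+1}<_{lex}\eta_i$ and $\bigwedge_{i\le j}\eta_j\lhd\bigwedge_{i+1\le j}\eta_j$ for all $i$. $T$ has CTP if there exist a formula $\varphi(x,y)$, a tree $(a_\eta)_{\eta\in\omega^{<\omega}}$ and $k<\omega$ such that $\{\varphi(x,a_\eta)\}_{\eta\in X}$ is consistent for every descending comb $X$, and $\{\varphi(x,a_{\eta|_n})\}_{n<\omega}$ is $k$-inconsistent for every branch $\eta\in\omega^\omega$. $T$ is NCTP if it does not have CTP. *)

theory Defs
  imports Main
begin

unbundle cardinal_syntax

section \<open>First-order languages, structures and satisfaction\<close>

record ('f, 'r) lang =
  fsyms :: "'f set"
  rsyms :: "'r set"
  farity :: "'f \<Rightarrow> nat"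
  rarity :: "'r \<Rightarrow> nat"

datatype 'f tm = Var nat | Fn 'f "'f tm list"

datatype ('f, 'r) fm =
    Eq "'f tm" "'f tm"
  | Rel 'r "'f tm list"
  | Neg "('f, 'r) fm"
  | Conj "('f, 'r) fm" "('f, 'r) fm"
  | Ex nat "('f, 'r) fm"

fun wf_tm :: "('f, 'r) lang \<Rightarrow> 'f tm \<Rightarrow> bool" where
  "wf_tm L (Var v) \<longleftrightarrow> True"
| "wf_tm L (Fn f ts) \<longleftrightarrow> f \<in> fsyms L \<and> length ts = farity L f \<and> (\<forall>t \<in> set ts. wf_tm L t)"

fun wf_fm :: "('f, 'r) lang \<Rightarrow> ('f, 'r) fm \<Rightarrow> bool" where
  "wf_fm L (Eq s t) \<longleftrightarrow> wf_tm L s \<and> wf_tm L t"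
| "wf_fm L (Rel R ts) \<longleftrightarrow> R \<in> rsyms L \<and> length ts = rarity L R \<and> (\<forall>t \<in> set ts. wf_tm L t)"
| "wf_fm L (Neg \<phi>) \<longleftrightarrow> wf_fm L \<phi>"
| "wf_fm L (Conj \<phi> \<psi>) \<longleftrightarrow> wf_fm L \<phi> \<and> wf_fm L \<psi>"
| "wf_fm L (Ex v \<phi>) \<longleftrightarrow> wf_fm L \<phi>"

fun fv_tm :: "'f tm \<Rightarrow> nat set" where
  "fv_tm (Var v) = {v}"
| "fv_tm (Fn f ts) = (\<Union>t \<in> set ts. fv_tm t)"

fun fv :: "('f, 'r) fm \<Rightarrow> nat set" where
  "fv (Eq s t) = fv_tm s \<union> fv_tm t"
| "fv (Rel R ts) = (\<Union>t \<in> set ts. fv_tm t)"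
| "fv (Neg \<phi>) = fv \<phi>"
| "fv (Conj \<phi> \<psi>) = fv \<phi> \<union> fv \<psi>"
| "fv (Ex v \<phi>) = fv \<phi> - {v}"

fun qfree :: "('f, 'r) fm \<Rightarrow> bool" where
  "qfree (Eq s t) \<longleftrightarrow> True"
| "qfree (Rel R ts) \<longleftrightarrow> True"
| "qfree (Neg \<phi>) \<longleftrightarrow> qfree \<phi>"
| "qfree (Conj \<phi> \<psi>) \<longleftrightarrow> qfree \<phi> \<and> qfree \<psi>"
| "qfree (Ex v \<phi>) \<longleftrightarrow> False"

definition fms :: "('f, 'r) lang \<Rightarrow> nat \<Rightarrow> ('f, 'r) fm set" where
  "fms L n = {\<phi>. wf_fm L \<phi> \<and> fv \<phi> \<subseteq> {..<n}}"

text \<open>The universe of a structure is the whole type \<^typ>\<open>'a\<close>.\<close>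

record ('f, 'r, 'a) struct =
  fint :: "'f \<Rightarrow> 'a list \<Rightarrow> 'a"
  rint :: "'r \<Rightarrow> 'a list \<Rightarrow> bool"

fun val :: "('f, 'r, 'a) struct \<Rightarrow> (nat \<Rightarrow> 'a) \<Rightarrow> 'f tm \<Rightarrow> 'a" where
  "val M e (Var v) = e v"
| "val M e (Fn f ts) = fint M f (map (val M e) ts)"

fun sat :: "('f, 'r, 'a) struct \<Rightarrow> (nat \<Rightarrow> 'a) \<Rightarrow> ('f, 'r) fm \<Rightarrow> bool" where
  "sat M e (Eq s t) \<longleftrightarrow> val M e s = val M e t"
| "sat M e (Rel R ts) \<longleftrightarrow> rint M R (map (val M e) ts)"
| "sat M e (Neg \<phi>) \<longleftrightarrow> \<not> sat M e \<phi>"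
| "sat M e (Conj \<phi> \<psi>) \<longleftrightarrow> sat M e \<phi> \<and> sat M e \<psi>"
| "sat M e (Ex v \<phi>) \<longleftrightarrow> (\<exists>x. sat M (e(v := x)) \<phi>)"

text \<open>A tuple \<open>xs\<close> interprets the variables \<open>0, \<dots>, length xs - 1\<close>; only formulas in these
  variables are ever evaluated at it, so the value of \<open>(!) xs\<close> beyond the length is irrelevant.\<close>

abbreviation sat_at :: "('f, 'r, 'a) struct \<Rightarrow> 'a list \<Rightarrow> ('f, 'r) fm \<Rightarrow> bool" where
  "sat_at M xs \<phi> \<equiv> sat M (\<lambda>v. xs ! v) \<phi>"

definition models :: "('f, 'r, 'a) struct \<Rightarrow> ('f, 'r) fm set \<Rightarrow> bool" where
  "models M T \<longleftrightarrow> (\<forall>\<phi> \<in> T. \<forall>e. sat M e \<phi>)"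

text \<open>Theories are identified with their sets of consequences, so a complete theory decides every
  sentence by membership. In particular \<open>|T|\<close> is the number of \<open>L\<close>-formulas. Consistency is not
  included: it will follow from a model of \<open>T\<close> being given.\<close>

definition complete_theory :: "('f, 'r) lang \<Rightarrow> ('f, 'r) fm set \<Rightarrow> bool" where
  "complete_theory L T \<longleftrightarrow> T \<subseteq> fms L 0 \<and> (\<forall>\<phi> \<in> fms L 0. \<phi> \<in> T \<or> Neg \<phi> \<in> T)"


section \<open>Types, consistency and saturation\<close>

definition same_type :: "('f, 'r) lang \<Rightarrow> ('f, 'r, 'a) struct \<Rightarrow> 'a list \<Rightarrow> 'a list \<Rightarrow> bool" where
  "same_type L M xs ys \<longleftrightarrow> length xs = length ys \<and>
     (\<forall>\<phi> \<in> fms L (length xs). sat_at M xs \<phi> \<longleftrightarrow> sat_at M ys \<phi>)"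

definition same_qf_type :: "('f, 'r) lang \<Rightarrow> ('f, 'r, 'a) struct \<Rightarrow> 'a list \<Rightarrow> 'a list \<Rightarrow> bool" where
  "same_qf_type L M xs ys \<longleftrightarrow> length xs = length ys \<and>
     (\<forall>\<phi> \<in> fms L (length xs). qfree \<phi> \<longrightarrow> (sat_at M xs \<phi> \<longleftrightarrow> sat_at M ys \<phi>))"

definition same_type_over ::
  "('f, 'r) lang \<Rightarrow> ('f, 'r, 'a) struct \<Rightarrow> 'a set \<Rightarrow> 'a list \<Rightarrow> 'a list \<Rightarrow> bool" where
  "same_type_over L M A xs ys \<longleftrightarrow> (\<forall>cs. set cs \<subseteq> A \<longrightarrow> same_type L M (xs @ cs) (ys @ cs))"

definition same_type_over_inf ::
  "('f, 'r) lang \<Rightarrow> ('f, 'r, 'a) struct \<Rightarrow> 'a set \<Rightarrow> 'i set \<Rightarrow> ('i \<Rightarrow> 'a) \<Rightarrow> ('i \<Rightarrow> 'a) \<Rightarrow> bool" where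
  "same_type_over_inf L M A I b b' \<longleftrightarrow>
     (\<forall>is. set is \<subseteq> I \<longrightarrow> same_type_over L M A (map b is) (map b' is))"

text \<open>A pair \<open>(\<phi>, cs)\<close> stands for the formula \<open>\<phi>(x, cs)\<close> with parameters \<open>cs\<close> from \<open>M\<close>, where
  \<open>x\<close> is an \<open>m\<close>-tuple of variables and comes first. A set of such formulas is consistent (with the
  elementary diagram of \<open>M\<close>) iff it is finitely satisfiable in \<open>M\<close>.\<close>

definition realizes ::
  "('f, 'r, 'a) struct \<Rightarrow> 'a list \<Rightarrow> (('f, 'r) fm \<times> 'a list) set \<Rightarrow> bool" where
  "realizes M xs p \<longleftrightarrow> (\<forall>(\<phi>, cs) \<in> p. sat_at M (xs @ cs) \<phi>)"

definition consistent ::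
  "('f, 'r, 'a) struct \<Rightarrow> nat \<Rightarrow> (('f, 'r) fm \<times> 'a list) set \<Rightarrow> bool" where
  "consistent M m p \<longleftrightarrow>
     (\<forall>q. q \<subseteq> p \<and> finite q \<longrightarrow> (\<exists>xs. length xs = m \<and> realizes M xs q))"

text \<open>This is a notion for indexed families, not for sets: equal formulas at different indices count
  separately.\<close>

definition k_inconsistent ::
  "('f, 'r, 'a) struct \<Rightarrow> nat \<Rightarrow> nat \<Rightarrow> ('j \<Rightarrow> ('f, 'r) fm \<times> 'a list) \<Rightarrow> bool" where
  "k_inconsistent M m k F \<longleftrightarrow>
     (\<forall>N. finite N \<and> card N = k \<longrightarrow> \<not> consistent M m (F ` N))"

definition saturated :: "('f, 'r) lang \<Rightarrow> ('f, 'r, 'a) struct \<Rightarrow> 'k rel \<Rightarrow> bool" where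
  "saturated L M \<mu> \<longleftrightarrow>
     (\<forall>A p. |A| <o \<mu> \<and>
        p \<subseteq> {(\<phi>, cs). set cs \<subseteq> A \<and> \<phi> \<in> fms L (1 + length cs)} \<and> consistent M 1 p \<longrightarrow>
        (\<exists>x. realizes M [x] p))"

definition indiscernible_over ::
  "('f, 'r) lang \<Rightarrow> ('f, 'r, 'a) struct \<Rightarrow> 'a set \<Rightarrow> 'k rel \<Rightarrow> ('k \<Rightarrow> 'a list) \<Rightarrow> bool" where
  "indiscernible_over L M A r c \<longleftrightarrow>
     (\<forall>js js'. set js \<subseteq> Field r \<and> set js' \<subseteq> Field r \<and> length js = length js' \<and>
        sorted_wrt (\<lambda>i j. i \<noteq> j \<and> (i, j) \<in> r) js \<and> sorted_wrt (\<lambda>i j. i \<noteq> j \<and> (i, j) \<in> r) js' \<longrightarrow>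
        same_type_over L M A (concat (map c js)) (concat (map c js')))"


section \<open>The tree of sequences of natural numbers of length less than \<open>\<kappa>\<close>\<close>

text \<open>A cardinal \<open>\<kappa>\<close> is a well-order as in the library. The ordinals \<open>\<alpha> < \<kappa>\<close> are the elements of
  \<^term>\<open>Field \<kappa>\<close>, the set of ordinals below \<open>\<alpha>\<close> being \<^term>\<open>underS \<kappa> \<alpha>\<close>. A sequence of length \<open>\<alpha>\<close>
  is a partial function with that domain. For \<open>\<kappa> = \<omega>\<close> one takes \<^term>\<open>natLeq\<close>.\<close>

type_synonym 'k node = "'k \<rightharpoonup> nat"

definition tree :: "'k rel \<Rightarrow> 'k node set" where
  "tree \<kappa> = {\<eta>. \<exists>\<alpha> \<in> Field \<kappa>. dom \<eta> = underS \<kappa> \<alpha>}"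

definition len :: "'k rel \<Rightarrow> 'k node \<Rightarrow> 'k" where
  "len \<kappa> \<eta> = (THE \<alpha>. \<alpha> \<in> Field \<kappa> \<and> dom \<eta> = underS \<kappa> \<alpha>)"

abbreviation initseg :: "'k node \<Rightarrow> 'k node \<Rightarrow> bool" (infix \<open>\<unlhd>\<close> 50) where
  "\<eta> \<unlhd> \<nu> \<equiv> \<eta> \<subseteq>\<^sub>m \<nu>"

definition strict_initseg :: "'k node \<Rightarrow> 'k node \<Rightarrow> bool" (infix \<open>\<lhd>\<close> 50) where
  "\<eta> \<lhd> \<nu> \<longleftrightarrow> \<eta> \<unlhd> \<nu> \<and> \<eta> \<noteq> \<nu>"

definition incomparable :: "'k node \<Rightarrow> 'k node \<Rightarrow> bool" (infix \<open>\<bottom>\<close> 50) where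
  "\<eta> \<bottom> \<nu> \<longleftrightarrow> \<not> \<eta> \<unlhd> \<nu> \<and> \<not> \<nu> \<unlhd> \<eta>"

definition Meet :: "'k rel \<Rightarrow> 'k node set \<Rightarrow> 'k node" where
  "Meet \<kappa> S = (THE \<mu>. \<mu> \<in> tree \<kappa> \<and> (\<forall>\<eta> \<in> S. \<mu> \<unlhd> \<eta>) \<and>
                 (\<forall>\<mu>' \<in> tree \<kappa>. (\<forall>\<eta> \<in> S. \<mu>' \<unlhd> \<eta>) \<longrightarrow> \<mu>' \<unlhd> \<mu>))"

abbreviation meet :: "'k rel \<Rightarrow> 'k node \<Rightarrow> 'k node \<Rightarrow> 'k node" where
  "meet \<kappa> \<eta> \<nu> \<equiv> Meet \<kappa> {\<eta>, \<nu>}"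

definition lex_less :: "'k rel \<Rightarrow> 'k node \<Rightarrow> 'k node \<Rightarrow> bool" where
  "lex_less \<kappa> \<eta> \<nu> \<longleftrightarrow> \<eta> \<lhd> \<nu> \<or>
     (\<eta> \<bottom> \<nu> \<and> the (\<eta> (len \<kappa> (meet \<kappa> \<eta> \<nu>))) < the (\<nu> (len \<kappa> (meet \<kappa> \<eta> \<nu>))))"

text \<open>Concatenation: at a position \<open>z\<close> beyond \<open>\<eta>\<close>, the value is that of \<open>\<nu>\<close> at the ordinal \<open>y\<close> such
  that \<open>l(\<eta>) + y = z\<close>, i.e. at the order type of the set of positions from \<open>l(\<eta>)\<close> up to \<open>z\<close>.\<close>

definition node_append :: "'k rel \<Rightarrow> 'k node \<Rightarrow> 'k node \<Rightarrow> 'k node" where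
  "node_append \<kappa> \<eta> \<nu> = (\<lambda>z.
     if z \<in> dom \<eta> then \<eta> z
     else if z \<in> Field \<kappa> then
       \<nu> (THE y. y \<in> Field \<kappa> \<and> Restr \<kappa> (underS \<kappa> z - dom \<eta>) =o Restr \<kappa> (underS \<kappa> y))
     else None)"

definition zeros :: "'k rel \<Rightarrow> 'k \<Rightarrow> 'k node" where
  "zeros \<kappa> \<alpha> = (\<lambda>z. if z \<in> underS \<kappa> \<alpha> then Some 0 else None)"

definition single_one :: "'k rel \<Rightarrow> 'k node" where
  "single_one \<kappa> = (\<lambda>z. if z \<in> Field \<kappa> \<and> underS \<kappa> z = {} then Some 1 else None)"


section \<open>Strong indiscernibility\<close>

datatype tree_fun = MeetF
datatype tree_rel = InitSegR | LexR

definition tree_lang :: "(tree_fun, tree_rel) lang" where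
  "tree_lang = \<lparr> fsyms = UNIV, rsyms = UNIV, farity = (\<lambda>_. 2), rarity = (\<lambda>_. 2) \<rparr>"

text \<open>Only quantifier-free formulas are evaluated in this structure, and only at elements of
  \<^term>\<open>tree \<kappa>\<close>, which is closed under meets. Hence the additional elements of the type play no role.\<close>

definition tree_struct :: "'k rel \<Rightarrow> (tree_fun, tree_rel, 'k node) struct" where
  "tree_struct \<kappa> = \<lparr>
     fint = (\<lambda>_ xs. meet \<kappa> (xs ! 0) (xs ! 1)),
     rint = (\<lambda>R xs. case R of InitSegR \<Rightarrow> xs ! 0 \<unlhd> xs ! 1 | LexR \<Rightarrow> lex_less \<kappa> (xs ! 0) (xs ! 1)) \<rparr>"

definition strongly_indiscernible ::
  "('f, 'r) lang \<Rightarrow> ('f, 'r, 'a) struct \<Rightarrow> 'k rel \<Rightarrow> ('k node \<Rightarrow> 'a list) \<Rightarrow> bool" where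
  "strongly_indiscernible L M \<kappa> a \<longleftrightarrow>
     (\<exists>n. \<forall>\<eta> \<in> tree \<kappa>. length (a \<eta>) = n) \<and>
     (\<forall>\<eta>s \<nu>s. set \<eta>s \<subseteq> tree \<kappa> \<and> set \<nu>s \<subseteq> tree \<kappa> \<and>
        same_qf_type tree_lang (tree_struct \<kappa>) \<eta>s \<nu>s \<longrightarrow>
        same_type L M (concat (map a \<eta>s)) (concat (map a \<nu>s)))"


section \<open>Descending combs and CTP\<close>

text \<open>Combs may be finite or infinite. Their enumerations have order type at most \<open>\<omega>\<close>, because the
  meets form a strictly increasing sequence of nodes of finite length.\<close>

definition descending_comb :: "nat node set \<Rightarrow> bool" where
  "descending_comb X \<longleftrightarrow>
     X \<subseteq> tree natLeq \<and> (\<forall>\<eta> \<in> X. \<forall>\<nu> \<in> X. \<eta> \<noteq> \<nu> \<longrightarrow> \<eta> \<bottom> \<nu>) \<and>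
     (\<exists>J e. (J = UNIV \<or> (\<exists>n. J = {..<n})) \<and> bij_betw e J X \<and>
        (\<forall>i. Suc i \<in> J \<longrightarrow>
           lex_less natLeq (e (Suc i)) (e i) \<and>
           Meet natLeq (e ` {j \<in> J. i \<le> j}) \<lhd> Meet natLeq (e ` {j \<in> J. Suc i \<le> j})))"

definition branch_restrict :: "(nat \<Rightarrow> nat) \<Rightarrow> nat \<Rightarrow> nat node" where
  "branch_restrict \<eta> n = (\<lambda>i. if i < n then Some (\<eta> i) else None)"

text \<open>CTP of \<open>Th(M)\<close>, with the tree taken in the sufficiently saturated ambient model \<open>M\<close>.\<close>

definition CTP :: "('f, 'r) lang \<Rightarrow> ('f, 'r, 'a) struct \<Rightarrow> bool" where
  "CTP L M \<longleftrightarrow>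
     (\<exists>m n \<phi> a k. \<phi> \<in> fms L (m + n) \<and> (\<forall>\<eta> \<in> tree natLeq. length (a \<eta>) = n) \<and>
        (\<forall>X. descending_comb X \<longrightarrow> consistent M m {(\<phi>, a \<eta>) | \<eta>. \<eta> \<in> X}) \<and>
        (\<forall>\<eta>. k_inconsistent M m k (\<lambda>i::nat. (\<phi>, a (branch_restrict \<eta> i)))))"

abbreviation NCTP :: "('f, 'r) lang \<Rightarrow> ('f, 'r, 'a) struct \<Rightarrow> bool" where
  "NCTP L M \<equiv> \<not> CTP L M"

end

theory Submission
  imports Defs "HOL-Library.Ramsey" "HOL-Library.Countable"
begin

text \<open>The nodes \<open>0\<^sup>i(1)\<close> form a descending comb, and the nodes \<open>0\<^sup>i(1)0\<^sup>j\<close> for fixed \<open>i\<close> form a chain.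

  Given NCTP, \<open>\<kappa>\<close> is so large that infinitely many \<open>0\<^sup>i(1)\<close> have the same type \<open>p(x, y)\<close> together with \<open>b\<close>.
  By strong indiscernibility, \<open>p\<close> is consistent along every descending comb of the copy of
  \<open>\<omega>\<^bsup><\<omega>\<^esup>\<close> in the tree. Hence it is consistent along every chain, as otherwise some formula of \<open>p\<close> would
  witness CTP. A realization along the chain through \<open>0\<^sup>i(1)\<close> is made indiscernible by
  Ramsey's theorem and compactness.

  Conversely, a witness of CTP is turned into a strongly indiscernible tree of height \<open>\<kappa> = (2\<^bsup>|T|\<^esup>)\<^sup>+\<close>,
  to which (ii) is applied with \<open>b\<close> a realization of \<open>\<phi>\<close> at all \<open>0\<^sup>i(1)\<close>. This contradicts inconsistency
  along the chain through \<open>0\<^sup>i(1)\<close>. By saturation, the tree exists once a finite set of nodes with its meets can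
  be embedded into \<open>\<omega>\<^bsup><\<omega>\<^esup>\<close> such that the colour of a tuple depends only on its quantifier-free type.
  For this, the entries of all sequences in the image are chosen increasing with the
  lexicographic order of the nodes, and so are the lengths of the sequences. The quantifier-free type of a
  tuple and its lengths then determine the order pattern of its entries, and two applications
  of Ramsey's theorem, first to the entries and then to the lengths, suffice.\<close>

section \<open>Definable conditions on assignments\<close>

text \<open>Conditions on tuples are treated as predicates on assignments of variables of any type
  (\<open>definable\<close>). A construction with infinitely many unknowns is thus one application
  of saturation, and a tuple may be replaced by one of the same type as long as only such predicates
  are asked of it. Any two chains of N nodes, and any two combs of N teeth with their spines, have
  the same table of meets and lexicographic comparisons; hence a single inconsistent chain of N
  nodes already gives N-inconsistency on every branch. The tree over \<kappa> = (2^|T|)^+ has at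
  most 2^(2^|T|) nodes, because initial segments of \<kappa> have at most 2^|T| elements; this
  explains the double exponential below \<mu>. The obstacle in the tree theorem is that the colour
  may depend only on the tuple and not on the finite set around it, whereas the word coding a node
  depends on the nodes of that set below it. The remedy is to show that the order pattern of the
  entries is unchanged when the set shrinks to a meet-closed subset containing the tuple.\<close>

lemma finite_fv_tm: "finite (fv_tm t)"
  by (induction t) auto

lemma finite_fv: "finite (fv \<phi>)"
  by (induction \<phi>) (auto simp: finite_fv_tm)

lemma val_cong: "(\<And>v. v \<in> fv_tm t \<Longrightarrow> e v = e' v) \<Longrightarrow> val M e t = val M e' t"
proof (induction t)
  case (Fn f ts)
  have "val M e t = val M e' t" if "t \<in> set ts" for t
    by (rule Fn.IH[OF that]) (use that Fn.prems in auto)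
  then show ?case by (simp cong: map_cong)
qed simp

lemma sat_cong: "(\<And>v. v \<in> fv \<phi> \<Longrightarrow> e v = e' v) \<Longrightarrow> sat M e \<phi> \<longleftrightarrow> sat M e' \<phi>"
proof (induction \<phi> arbitrary: e e')
  case (Eq s t)
  have "val M e s = val M e' s" "val M e t = val M e' t"
    by (rule val_cong, use Eq in simp)+
  then show ?case by simp
next
  case (Rel R ts)
  have "val M e t = val M e' t" if "t \<in> set ts" for t
    by (rule val_cong) (use that Rel.prems in auto)
  then show ?case by (simp cong: map_cong)
next
  case (Neg \<phi>)
  have "sat M e \<phi> \<longleftrightarrow> sat M e' \<phi>" by (rule Neg.IH) (use Neg.prems in simp)
  then show ?case by simp
next
  case (Conj \<phi> \<psi>)
  have "sat M e \<phi> \<longleftrightarrow> sat M e' \<phi>" by (rule Conj.IH(1)) (use Conj.prems in simp)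
  moreover have "sat M e \<psi> \<longleftrightarrow> sat M e' \<psi>" by (rule Conj.IH(2)) (use Conj.prems in simp)
  ultimately show ?case by simp
next
  case (Ex v \<phi>)
  have "sat M (e(v := x)) \<phi> \<longleftrightarrow> sat M (e'(v := x)) \<phi>" for x
    by (rule Ex.IH) (use Ex.prems in auto)
  then show ?case by simp
qed

section \<open>Renaming and substitution of variables\<close>

primrec rename_tm :: "(nat \<Rightarrow> nat) \<Rightarrow> 'f tm \<Rightarrow> 'f tm" where
  "rename_tm g (Var v) = Var (g v)"
| "rename_tm g (Fn f ts) = Fn f (map (rename_tm g) ts)"

text \<open>Bound variables are renamed along with the free ones, so an injective \<open>g\<close>
  cannot cause capture and no fresh names have to be chosen.\<close>

primrec rename :: "(nat \<Rightarrow> nat) \<Rightarrow> ('f, 'r) fm \<Rightarrow> ('f, 'r) fm" where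
  "rename g (Eq s t) = Eq (rename_tm g s) (rename_tm g t)"
| "rename g (Rel R ts) = Rel R (map (rename_tm g) ts)"
| "rename g (Neg \<phi>) = Neg (rename g \<phi>)"
| "rename g (Conj \<phi> \<psi>) = Conj (rename g \<phi>) (rename g \<psi>)"
| "rename g (Ex v \<phi>) = Ex (g v) (rename g \<phi>)"

lemma wf_rename_tm: "wf_tm L t \<Longrightarrow> wf_tm L (rename_tm g t)"
  by (induction t) auto

lemma wf_rename: "wf_fm L \<phi> \<Longrightarrow> wf_fm L (rename g \<phi>)"
  by (induction \<phi>) (auto simp: wf_rename_tm)

lemma fv_rename_tm: "fv_tm (rename_tm g t) = g ` fv_tm t"
  by (induction t) auto

lemma fv_rename: "inj g \<Longrightarrow> fv (rename g \<phi>) = g ` fv \<phi>"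
  by (induction \<phi>) (auto simp: fv_rename_tm image_Un image_set_diff)

lemma val_rename_tm: "val M e (rename_tm g t) = val M (e \<circ> g) t"
  by (induction t) (simp_all cong: map_cong)

lemma sat_rename: "inj g \<Longrightarrow> sat M e (rename g \<phi>) \<longleftrightarrow> sat M (e \<circ> g) \<phi>"
proof (induction \<phi> arbitrary: e)
  case (Rel R ts)
  then show ?case by (simp add: val_rename_tm o_def cong: map_cong)
next
  case (Ex v \<phi>)
  have eq: "e(g v := x) \<circ> g = (e \<circ> g)(v := x)" for x
    using Ex.prems by (auto simp: fun_eq_iff inj_eq)
  have "sat M (e(g v := x)) (rename g \<phi>) \<longleftrightarrow> sat M ((e \<circ> g)(v := x)) \<phi>" for x
    by (simp only: Ex.IH[OF Ex.prems] eq)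
  then show ?case by (simp only: rename.simps sat.simps)
qed (simp_all add: val_rename_tm)

text \<open>Substituting \<open>y\<close> for \<open>x\<close> is expressed by \<open>\<exists>x. x = y \<and> \<phi>\<close>; renaming all variables of
  the formula beforehand avoids capture.\<close>

lemma substitution_aux:
  assumes "finite W" "wf_fm L \<phi>" "\<forall>w \<in> W. f w \<notin> W"
  shows "\<exists>\<phi>'. wf_fm L \<phi>' \<and> fv \<phi>' \<subseteq> (fv \<phi> - W) \<union> f ` W \<and>
    (\<forall>e. sat M e \<phi>' \<longleftrightarrow> sat M (\<lambda>v. if v \<in> W then e (f v) else e v) \<phi>)"
  using assms(1,3)
proof (induction W)
  case empty
  then show ?case using assms(2) by auto
next
  case (insert w W)
  have "\<forall>w' \<in> W. f w' \<notin> W" using insert.prems by blast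
  from insert.IH[OF this] obtain \<phi>' where \<phi>': "wf_fm L \<phi>'" "fv \<phi>' \<subseteq> (fv \<phi> - W) \<union> f ` W"
    and sat: "\<forall>e. sat M e \<phi>' \<longleftrightarrow> sat M (\<lambda>v. if v \<in> W then e (f v) else e v) \<phi>"
    by (elim exE conjE)
  have fw: "f w \<noteq> w" "\<And>v. v \<in> W \<Longrightarrow> f v \<noteq> w" using insert.prems by auto
  let ?\<psi> = "Ex w (Conj (Eq (Var w) (Var (f w))) \<phi>')"
  have "sat M e ?\<psi> \<longleftrightarrow> sat M (\<lambda>v. if v \<in> insert w W then e (f v) else e v) \<phi>" for e
  proof -
    have "sat M e ?\<psi> \<longleftrightarrow> sat M (e(w := e (f w))) \<phi>'" using fw by auto
    also have "\<dots> \<longleftrightarrow> sat M (\<lambda>v. if v \<in> insert w W then e (f v) else e v) \<phi>"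
      unfolding sat[THEN spec] by (rule sat_cong) (use fw insert.hyps in auto)
    finally show ?thesis .
  qed
  moreover have "wf_fm L ?\<psi>" using \<phi>'(1) by simp
  moreover have "fv ?\<psi> \<subseteq> (fv \<phi> - insert w W) \<union> f ` insert w W" using \<phi>'(2) fw by auto
  ultimately show ?case by blast
qed

lemma substitution:
  assumes "wf_fm L \<phi>"
  shows "\<exists>\<phi>'. wf_fm L \<phi>' \<and> fv \<phi>' \<subseteq> f ` fv \<phi> \<and> (\<forall>e. sat M e \<phi>' \<longleftrightarrow> sat M (e \<circ> f) \<phi>)"
proof -
  \<comment> \<open>Shifting by a strict bound of the targets places the old variables at or above
    \<open>K\<close> and the new ones below it; \<open>f\<close> itself may identify
    variables.\<close>
  obtain K where K: "\<And>v. v \<in> fv \<phi> \<Longrightarrow> f v < K"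
    by (metis finite_fv finite_imageI finite_nat_set_iff_bounded imageI)
  let ?g = "\<lambda>v. v + K"
  have g: "inj ?g" by auto
  have "\<exists>\<phi>'. wf_fm L \<phi>' \<and>
    fv \<phi>' \<subseteq> (fv (rename ?g \<phi>) - ?g ` fv \<phi>) \<union> (\<lambda>v. f (v - K)) ` ?g ` fv \<phi> \<and>
    (\<forall>e. sat M e \<phi>' \<longleftrightarrow>
      sat M (\<lambda>v. if v \<in> ?g ` fv \<phi> then e (f (v - K)) else e v) (rename ?g \<phi>))"
    by (rule substitution_aux) (use K finite_fv wf_rename assms in \<open>fastforce+\<close>)
  then obtain \<phi>' where \<phi>': "wf_fm L \<phi>'"
    "fv \<phi>' \<subseteq> (fv (rename ?g \<phi>) - ?g ` fv \<phi>) \<union> (\<lambda>v. f (v - K)) ` ?g ` fv \<phi>"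
    "\<And>e. sat M e \<phi>' \<longleftrightarrow>
      sat M (\<lambda>v. if v \<in> ?g ` fv \<phi> then e (f (v - K)) else e v) (rename ?g \<phi>)"
    by blast
  have "fv \<phi>' \<subseteq> f ` fv \<phi>" using \<phi>'(2) by (auto simp: fv_rename[OF g])
  moreover have "sat M e \<phi>' \<longleftrightarrow> sat M (e \<circ> f) \<phi>" for e
    unfolding \<phi>'(3) sat_rename[OF g] by (rule sat_cong) auto
  ultimately show ?thesis using \<phi>'(1) by blast
qed

text \<open>Variables may come from any type, in particular from uncountable index sets;
  \<open>\<sigma>\<close> attaches such names, possibly with repetitions, to the finitely many free
  variables of a formula. A predicate on assignments spares the bookkeeping of positions in
  tuples.\<close>

definition definable ::
  "('f, 'r) lang \<Rightarrow> ('f, 'r, 'a) struct \<Rightarrow> 'v set \<Rightarrow> (('v \<Rightarrow> 'a) \<Rightarrow> bool) \<Rightarrow> bool" where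
  "definable L M V R \<longleftrightarrow>
     (\<exists>\<phi> \<sigma>. wf_fm L \<phi> \<and> \<sigma> ` fv \<phi> \<subseteq> V \<and> (\<forall>e. R e \<longleftrightarrow> sat M (\<lambda>n. e (\<sigma> n)) \<phi>))"

lemma definable_mono: "definable L M V R \<Longrightarrow> V \<subseteq> V' \<Longrightarrow> definable L M V' R"
  unfolding definable_def by (meson subset_trans)

lemma definable_finite_support:
  assumes "definable L M V R"
  obtains V' where "finite V'" "V' \<subseteq> V" "definable L M V' R"
  using assms unfolding definable_def by (metis finite_fv finite_imageI subset_refl)

lemma definable_equiv:
  assumes "definable L M V R" "\<And>e. R' e \<longleftrightarrow> R e"
  shows "definable L M V R'"
proof -
  have "R' = R" by (rule ext) (rule assms(2))
  then show ?thesis by (rule ssubst) (rule assms(1))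
qed

lemma definable_cong:
  assumes "definable L M V R" "\<And>v. v \<in> V \<Longrightarrow> e v = e' v"
  shows "R e \<longleftrightarrow> R e'"
proof -
  obtain \<phi> \<sigma> where *: "\<sigma> ` fv \<phi> \<subseteq> V" "\<And>e. R e \<longleftrightarrow> sat M (\<lambda>n. e (\<sigma> n)) \<phi>"
    using assms(1) unfolding definable_def by blast
  show ?thesis unfolding * by (rule sat_cong) (use * assms(2) in auto)
qed

lemma definable_neg:
  assumes "definable L M V R" shows "definable L M V (\<lambda>e. \<not> R e)"
proof -
  obtain \<phi> \<sigma> where *: "wf_fm L \<phi>" "\<sigma> ` fv \<phi> \<subseteq> V" "\<And>e. R e \<longleftrightarrow> sat M (\<lambda>n. e (\<sigma> n)) \<phi>"
    using assms unfolding definable_def by blast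
  then show ?thesis unfolding definable_def by (intro exI[of _ "Neg \<phi>"] exI[of _ \<sigma>]) auto
qed

text \<open>The two formulas are moved to the even and the odd variables, so that their naming maps
  can be merged into one.\<close>

lemma definable_conj:
  assumes "definable L M V R" "definable L M V R'"
  shows "definable L M V (\<lambda>e. R e \<and> R' e)"
proof -
  obtain \<phi> \<sigma> where 1: "wf_fm L \<phi>" "\<sigma> ` fv \<phi> \<subseteq> V" "\<And>e. R e \<longleftrightarrow> sat M (\<lambda>n. e (\<sigma> n)) \<phi>"
    using assms(1) unfolding definable_def by blast
  obtain \<phi>' \<sigma>' where 2: "wf_fm L \<phi>'" "\<sigma>' ` fv \<phi>' \<subseteq> V" "\<And>e. R' e \<longleftrightarrow> sat M (\<lambda>n. e (\<sigma>' n)) \<phi>'"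
    using assms(2) unfolding definable_def by blast
  let ?g = "\<lambda>v::nat. 2 * v" and ?g' = "\<lambda>v::nat. Suc (2 * v)"
  let ?\<tau> = "\<lambda>n. if even n then \<sigma> (n div 2) else \<sigma>' (n div 2)"
  have g: "inj ?g" "inj ?g'" by (auto simp: inj_def)
  have "wf_fm L (Conj (rename ?g \<phi>) (rename ?g' \<phi>'))" using 1 2 by (simp add: wf_rename)
  moreover have "?\<tau> ` fv (Conj (rename ?g \<phi>) (rename ?g' \<phi>')) \<subseteq> V"
    using 1 2 by (auto simp: fv_rename[OF g(1)] fv_rename[OF g(2)])
  moreover have "R e \<and> R' e \<longleftrightarrow> sat M (\<lambda>n. e (?\<tau> n)) (Conj (rename ?g \<phi>) (rename ?g' \<phi>'))" for e
    by (simp add: sat_rename[OF g(1)] sat_rename[OF g(2)] o_def 1 2)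
  ultimately show ?thesis unfolding definable_def by blast
qed

lemma definable_true: "definable L M V (\<lambda>e. True)"
  unfolding definable_def
  by (rule exI[of _ "Ex 0 (Eq (Var 0) (Var 0))"], rule exI) auto

lemma definable_ball:
  "finite I \<Longrightarrow> (\<And>i. i \<in> I \<Longrightarrow> definable L M V (R i)) \<Longrightarrow> definable L M V (\<lambda>e. \<forall>i \<in> I. R i e)"
  by (induction I rule: finite_induct) (auto intro: definable_true definable_conj)

lemma definable_imp:
  "definable L M V R \<Longrightarrow> definable L M V R' \<Longrightarrow> definable L M V (\<lambda>e. R e \<longrightarrow> R' e)"
  using definable_neg[OF definable_conj[OF _ definable_neg], of L M V R R'] by simp

lemma definable_iff:
  assumes "definable L M V R" "definable L M V R'"
  shows "definable L M V (\<lambda>e. R e \<longleftrightarrow> R' e)"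
proof -
  have "(\<lambda>e. R e \<longleftrightarrow> R' e) = (\<lambda>e. (R e \<longrightarrow> R' e) \<and> (R' e \<longrightarrow> R e))" by auto
  then show ?thesis using assms by (auto intro!: definable_conj definable_imp)
qed

text \<open>Several variables of the formula may carry the name \<open>v\<close>; they are
  identified with one fresh \<open>w\<close>, which is then quantified.\<close>

lemma definable_ex:
  assumes "definable L M V R"
  shows "definable L M (V - {v}) (\<lambda>e. \<exists>x. R (e(v := x)))"
proof -
  obtain \<phi> \<sigma> where *: "wf_fm L \<phi>" "\<sigma> ` fv \<phi> \<subseteq> V" "\<And>e. R e \<longleftrightarrow> sat M (\<lambda>n. e (\<sigma> n)) \<phi>"
    using assms unfolding definable_def by blast
  obtain w where w: "w \<notin> fv \<phi>" by (metis finite_fv ex_new_if_finite infinite_UNIV_nat)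
  let ?f = "\<lambda>n. if \<sigma> n = v then w else n"
  obtain \<phi>' where \<phi>': "wf_fm L \<phi>'" "fv \<phi>' \<subseteq> ?f ` fv \<phi>" "\<And>e. sat M e \<phi>' \<longleftrightarrow> sat M (e \<circ> ?f) \<phi>"
    using substitution[OF *(1), of ?f M] by blast
  have "\<sigma> ` fv (Ex w \<phi>') \<subseteq> V - {v}"
    using \<phi>'(2) *(2) by (auto split: if_splits)
  moreover have "(\<exists>x. R (e(v := x))) \<longleftrightarrow> sat M (\<lambda>n. e (\<sigma> n)) (Ex w \<phi>')" for e
  proof -
    have "R (e(v := x)) \<longleftrightarrow> sat M ((\<lambda>n. e (\<sigma> n))(w := x)) \<phi>'" for x
      unfolding * \<phi>' by (rule sat_cong) (use w in auto)
    then show ?thesis by simp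
  qed
  moreover have "wf_fm L (Ex w \<phi>')" using \<phi>' by simp
  ultimately show ?thesis unfolding definable_def by blast
qed

lemma definable_exs:
  assumes "definable L M V R" "finite W"
  shows "definable L M (V - W) (\<lambda>e. \<exists>e'. (\<forall>v. v \<notin> W \<longrightarrow> e' v = e v) \<and> R e')"
  using assms(2)
proof (induction W)
  case empty
  have eq: "(\<exists>e'. (\<forall>v. v \<notin> {} \<longrightarrow> e' v = e v) \<and> R e') \<longleftrightarrow> R e" for e
  proof
    assume "\<exists>e'. (\<forall>v. v \<notin> {} \<longrightarrow> e' v = e v) \<and> R e'"
    then obtain e' where e': "\<And>v. e' v = e v" "R e'" by blast
    from e'(1) have "e' = e" by (rule ext)
    with e'(2) show "R e" by simp
  next
    assume "R e"
    then show "\<exists>e'. (\<forall>v. v \<notin> {} \<longrightarrow> e' v = e v) \<and> R e'" by (intro exI[of _ e]) simp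
  qed
  show ?case unfolding Diff_empty by (rule definable_equiv[OF assms(1)]) (rule eq)
next
  case (insert w W)
  have eq: "(\<exists>e'. (\<forall>v. v \<notin> insert w W \<longrightarrow> e' v = e v) \<and> R e') \<longleftrightarrow>
    (\<exists>x. \<exists>e'. (\<forall>v. v \<notin> W \<longrightarrow> e' v = (e(w := x)) v) \<and> R e')" (is "?l \<longleftrightarrow> ?r") for e
  proof
    assume ?l
    then obtain e' where "\<forall>v. v \<notin> insert w W \<longrightarrow> e' v = e v" "R e'" by blast
    then show ?r by (intro exI[of _ "e' w"] exI[of _ e']) auto
  next
    assume ?r
    then obtain x e' where "\<forall>v. v \<notin> W \<longrightarrow> e' v = (e(w := x)) v" "R e'" by blast
    then show ?l by (intro exI[of _ e']) auto
  qed
  show ?case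
    by (subst Diff_insert, rule definable_equiv[OF definable_ex[OF insert.IH]], rule eq)
qed

text \<open>The complement of \<open>V0\<close> may be infinite, but \<open>R\<close> depends on
  finitely many variables only, so a finite block of quantifiers is enough.\<close>

lemma definable_project:
  assumes "definable L M V R"
  shows "definable L M (V \<inter> V0) (\<lambda>e. \<exists>e'. (\<forall>v \<in> V0. e' v = e v) \<and> R e')"
proof -
  obtain V' where V': "finite V'" "V' \<subseteq> V" "definable L M V' R"
    using assms by (rule definable_finite_support)
  have "(\<exists>e'. (\<forall>v \<in> V0. e' v = e v) \<and> R e') \<longleftrightarrow>
    (\<exists>e'. (\<forall>v. v \<notin> V' - V0 \<longrightarrow> e' v = e v) \<and> R e')" (is "?l \<longleftrightarrow> ?r") for e
  proof
    assume ?l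
    then obtain e' where e': "\<forall>v \<in> V0. e' v = e v" "R e'" by blast
    have "R (\<lambda>v. if v \<in> V' - V0 then e' v else e v)"
      using e'(2) by (subst definable_cong[OF V'(3), of _ e']) (use e'(1) in auto)
    then show ?r by (intro exI[of _ "\<lambda>v. if v \<in> V' - V0 then e' v else e v"]) auto
  next
    assume ?r
    then show ?l by blast
  qed
  then show ?thesis
    using definable_exs[OF V'(3), of "V' - V0"] V' by (simp) (erule definable_mono, auto)
qed

lemma definable_sat_at:
  assumes "\<phi> \<in> fms L (length vs)" "set vs \<subseteq> V"
  shows "definable L M V (\<lambda>e. sat_at M (map e vs) \<phi>)"
proof -
  have "(!) vs ` fv \<phi> \<subseteq> V" using assms unfolding fms_def by force
  moreover have "sat_at M (map e vs) \<phi> \<longleftrightarrow> sat M (\<lambda>n. e (vs ! n)) \<phi>" for e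
    by (rule sat_cong) (use assms in \<open>auto simp: fms_def\<close>)
  ultimately show ?thesis using assms unfolding definable_def fms_def by blast
qed

text \<open>The way back to formulas: each free variable is replaced by a position of its name in
  \<open>vs\<close>, and substitution allows two variables to get the same position.\<close>

lemma definable_imp_sat_at:
  assumes "definable L M V R" "V \<subseteq> set vs"
  obtains \<phi> where "\<phi> \<in> fms L (length vs)" "\<And>e. R e \<longleftrightarrow> sat_at M (map e vs) \<phi>"
proof -
  obtain \<phi> \<sigma> where *: "wf_fm L \<phi>" "\<sigma> ` fv \<phi> \<subseteq> V" "\<And>e. R e \<longleftrightarrow> sat M (\<lambda>n. e (\<sigma> n)) \<phi>"
    using assms unfolding definable_def by blast
  have "\<forall>n. \<exists>i. n \<in> fv \<phi> \<longrightarrow> i < length vs \<and> vs ! i = \<sigma> n"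
    using * assms(2) by (metis image_subset_iff in_set_conv_nth subsetD)
  then obtain f where f: "\<And>n. n \<in> fv \<phi> \<Longrightarrow> f n < length vs \<and> vs ! f n = \<sigma> n" by metis
  obtain \<phi>' where \<phi>': "wf_fm L \<phi>'" "fv \<phi>' \<subseteq> f ` fv \<phi>" "\<And>e. sat M e \<phi>' \<longleftrightarrow> sat M (e \<circ> f) \<phi>"
    using substitution[OF *(1), of f M] by blast
  show thesis
  proof (rule that)
    show "\<phi>' \<in> fms L (length vs)" using \<phi>' f unfolding fms_def by auto
    show "R e \<longleftrightarrow> sat_at M (map e vs) \<phi>'" for e
      unfolding * \<phi>' by (rule sat_cong) (use f in auto)
  qed
qed

lemma same_type_definable:
  assumes "same_type L M (map e vs) (map e' vs)" "definable L M (set vs) R"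
  shows "R e \<longleftrightarrow> R e'"
proof -
  obtain \<phi> where "\<phi> \<in> fms L (length vs)" "\<And>e. R e \<longleftrightarrow> sat_at M (map e vs) \<phi>"
    by (rule definable_imp_sat_at[OF assms(2) subset_refl]) blast
  then show ?thesis using assms(1) unfolding same_type_def by auto
qed

text \<open>The form in which indiscernibility is mostly used: a solution over one tuple yields a
  solution over any tuple of the same type, the other variables being projected away.\<close>

lemma same_type_definable_ex:
  assumes "same_type L M (map e vs) (map e' vs)" "definable L M V R"
  shows "(\<exists>e1. (\<forall>v \<in> set vs. e1 v = e v) \<and> R e1) \<longleftrightarrow> (\<exists>e1. (\<forall>v \<in> set vs. e1 v = e' v) \<and> R e1)"
  by (rule same_type_definable[OF assms(1)],
    rule definable_mono[OF definable_project[OF assms(2)]]) simp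

section \<open>Saturation in many variables\<close>

text \<open>Zorn's lemma gives a maximal partial assignment \<open>g\<close> on \<open>V\<close>
  that is compatible with every finite part of \<open>P\<close> and extends the prescribed values on
  \<open>J\<close>. It is total: the values chosen so far are fewer than \<mu> parameters, so
  saturation in one variable supplies a value for any variable that is missing.\<close>

lemma saturated_realizes:
  fixes \<mu> :: "'k rel" and V :: "'v set" and P :: "(('v \<Rightarrow> 'a) \<Rightarrow> bool) set"
  assumes sat: "saturated L M \<mu>" and small: "|V| <o \<mu>"
    and def: "\<And>R. R \<in> P \<Longrightarrow> definable L M V R"
    and fin: "\<And>Q. finite Q \<Longrightarrow> Q \<subseteq> P \<Longrightarrow> \<exists>e. (\<forall>v \<in> J. e v = e0 v) \<and> (\<forall>R \<in> Q. R e)"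
  obtains e where "\<And>v. v \<in> J \<Longrightarrow> e v = e0 v" "\<And>R. R \<in> P \<Longrightarrow> R e"
proof -
  define ext :: "('v \<rightharpoonup> 'a) \<Rightarrow> ('v \<Rightarrow> 'a) \<Rightarrow> bool"
    where "ext g e \<longleftrightarrow> (\<forall>v \<in> dom g. g v = Some (e v))" for g e
  define FS where "FS g \<longleftrightarrow> (\<forall>Q. finite Q \<and> Q \<subseteq> P \<longrightarrow> (\<exists>e. ext g e \<and> (\<forall>R \<in> Q. R e)))" for g
  define G where "G = {g. FS g \<and> dom g \<subseteq> V}"
  define g0 where "g0 = (\<lambda>v. if v \<in> J \<inter> V then Some (e0 v) else None)"
  define \<A> where "\<A> = {Map.graph g | g. g \<in> G \<and> g0 \<subseteq>\<^sub>m g}"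
  have graph_sub: "Map.graph g \<subseteq> Map.graph h \<longleftrightarrow> g \<subseteq>\<^sub>m h" for g h :: "'v \<rightharpoonup> 'a"
    by (auto simp: Map.graph_def map_le_def dom_def)
  have "FS g0"
    unfolding FS_def ext_def g0_def
  proof (intro allI impI)
    fix Q assume "finite Q \<and> Q \<subseteq> P"
    then obtain e where "\<forall>v \<in> J. e v = e0 v" "\<forall>R \<in> Q. R e" using fin[of Q] by auto
    then show "\<exists>e. (\<forall>v \<in> dom (\<lambda>v. if v \<in> J \<inter> V then Some (e0 v) else None).
      (if v \<in> J \<inter> V then Some (e0 v) else None) = Some (e v)) \<and> (\<forall>R \<in> Q. R e)"
      by (intro exI[of _ e]) (auto split: if_splits)
  qed
  then have g0: "g0 \<in> G" unfolding G_def g0_def by (auto split: if_splits)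
  have "\<exists>U \<in> \<A>. \<forall>X \<in> C. X \<subseteq> U" if C: "C \<in> chains \<A>" for C
  proof (cases "C = {}")
    case True
    then show ?thesis using g0 unfolding \<A>_def by auto
  next
    case False
    have CA: "C \<subseteq> \<A>" and ch: "\<And>X Y. X \<in> C \<Longrightarrow> Y \<in> C \<Longrightarrow> X \<subseteq> Y \<or> Y \<subseteq> X"
      using C unfolding chains_def chain_subset_def by auto
    define D where "D = {g. g \<in> G \<and> g0 \<subseteq>\<^sub>m g \<and> Map.graph g \<in> C}"
    have CD: "C = Map.graph ` D" using CA unfolding D_def \<A>_def by auto
    have chD: "g \<subseteq>\<^sub>m h \<or> h \<subseteq>\<^sub>m g" if "g \<in> D" "h \<in> D" for g h
    proof -
      have "Map.graph g \<in> C" "Map.graph h \<in> C" using that unfolding D_def by auto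
      from ch[OF this] show ?thesis unfolding graph_sub .
    qed
    define u where "u = (\<lambda>v. if \<exists>g \<in> D. v \<in> dom g then (SOME g. g \<in> D \<and> v \<in> dom g) v else None)"
    have uD: "g \<subseteq>\<^sub>m u" if g: "g \<in> D" for g
    proof -
      have "g v = u v" if v: "v \<in> dom g" for v
      proof -
        define h where "h = (SOME g. g \<in> D \<and> v \<in> dom g)"
        have "\<exists>g. g \<in> D \<and> v \<in> dom g" using g v by blast
        then have h: "h \<in> D" "v \<in> dom h" unfolding h_def by (metis (mono_tags, lifting) someI_ex)+
        have "u v = h v" using g v unfolding u_def h_def by auto
        moreover have "g v = h v" using chD[OF g h(1)] h(2) v unfolding map_le_def by metis
        ultimately show ?thesis by simp
      qed
      then show ?thesis unfolding map_le_def by blast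
    qed
    have domu: "\<exists>g \<in> D. v \<in> dom g" if "v \<in> dom u" for v
      using that unfolding u_def by (auto split: if_splits)
    have cover: "\<exists>g \<in> D. F \<subseteq> dom g" if "finite F" "F \<subseteq> dom u" for F
      using that
    proof (induction F)
      case empty
      then show ?case using False CD by auto
    next
      case (insert v F)
      then obtain g h where "g \<in> D" "F \<subseteq> dom g" "h \<in> D" "v \<in> dom h" using domu by blast
      moreover have "dom g \<subseteq> dom h \<or> dom h \<subseteq> dom g"
        using chD[of g h] calculation map_le_implies_dom_le by blast
      ultimately show ?case by blast
    qed
    \<comment> \<open>Finite support makes the union work: the finitely many variables of
      \<open>Q\<close> in \<open>dom u\<close> already lie in the domain of a single member of the
      chain.\<close>
    have "FS u"
      unfolding FS_def
    proof (intro allI impI, elim conjE)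
      fix Q assume Q: "finite Q" "Q \<subseteq> P"
      have "definable L M V (\<lambda>e. \<forall>R \<in> Q. R e)" using Q def by (intro definable_ball) auto
      then obtain V' where V': "finite V'" "definable L M V' (\<lambda>e. \<forall>R \<in> Q. R e)"
        by (rule definable_finite_support)
      obtain g where g: "g \<in> D" "V' \<inter> dom u \<subseteq> dom g" using cover[of "V' \<inter> dom u"] V' by auto
      then have "FS g" unfolding D_def G_def by simp
      then obtain e where e: "ext g e" "\<forall>R \<in> Q. R e" using Q unfolding FS_def by blast
      let ?e = "\<lambda>v. if v \<in> dom u then the (u v) else e v"
      have "e v = ?e v" if "v \<in> V'" for v
      proof (cases "v \<in> dom u")
        case True
        then have "v \<in> dom g" using g that by blast
        then have "u v = g v" "g v = Some (e v)"
          using uD[OF g(1)] e(1) unfolding ext_def map_le_def by auto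
        then show ?thesis by simp
      qed simp
      then have "\<forall>R \<in> Q. R ?e" using definable_cong[OF V'(2), of e ?e] e(2) by blast
      moreover have "ext u ?e" unfolding ext_def by auto
      ultimately show "\<exists>e. ext u e \<and> (\<forall>R \<in> Q. R e)" by blast
    qed
    moreover have "dom u \<subseteq> V" using domu unfolding D_def G_def by blast
    moreover have "g0 \<subseteq>\<^sub>m u"
    proof -
      obtain g where "g \<in> D" using False CD by auto
      then show ?thesis using uD[of g] map_le_trans unfolding D_def by blast
    qed
    ultimately have "Map.graph u \<in> \<A>" unfolding \<A>_def G_def by blast
    moreover have "\<forall>X \<in> C. X \<subseteq> Map.graph u" unfolding CD using uD graph_sub by blast
    ultimately show ?thesis by blast
  qed
  then obtain m where m: "m \<in> \<A>" "\<And>X. X \<in> \<A> \<Longrightarrow> m \<subseteq> X \<Longrightarrow> X = m"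
    using Zorn_Lemma2[of \<A>] by metis
  then obtain g where g: "m = Map.graph g" "FS g" "dom g \<subseteq> V" "g0 \<subseteq>\<^sub>m g"
    unfolding \<A>_def G_def by blast
  have "dom g = V"
  proof (rule ccontr)
    assume "dom g \<noteq> V"
    then obtain v where v: "v \<in> V" "v \<notin> dom g" using g by blast
    define A where "A = (\<lambda>v. the (g v)) ` dom g"
    have "|A| \<le>o |V|"
      unfolding A_def using g(3) card_of_image card_of_mono1 ordLeq_transitive by meson
    then have A: "|A| <o \<mu>" using small ordLeq_ordLess_trans by blast
    \<comment> \<open>\<open>p\<close> collects what finitely many conditions of \<open>P\<close>
      imply about the value at \<open>v\<close>, with values of \<open>g\<close> as parameters. It
      is consistent because \<open>g\<close> is compatible with the finite parts of
      \<open>P\<close>.\<close>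
    define p where "p = {(\<chi>, cs). set cs \<subseteq> A \<and> \<chi> \<in> fms L (1 + length cs) \<and>
      (\<exists>Q. finite Q \<and> Q \<subseteq> P \<and> (\<forall>e. ext g e \<and> (\<forall>R \<in> Q. R e) \<longrightarrow> sat_at M ([e v] @ cs) \<chi>))}"
    have "\<exists>Q. finite Q \<and> Q \<subseteq> P \<and>
      (\<forall>e. ext g e \<and> (\<forall>R \<in> Q. R e) \<longrightarrow> (\<forall>(\<chi>, cs) \<in> q. sat_at M ([e v] @ cs) \<chi>))"
      if "finite q" "q \<subseteq> p" for q
      using that
    proof (induction q)
      case (insert c q)
      then obtain Q where Q: "finite Q" "Q \<subseteq> P"
        "\<forall>e. ext g e \<and> (\<forall>R \<in> Q. R e) \<longrightarrow> (\<forall>(\<chi>, cs) \<in> q. sat_at M ([e v] @ cs) \<chi>)"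
        by auto
      obtain \<chi> cs where c: "c = (\<chi>, cs)" by force
      then obtain Q' where Q': "finite Q'" "Q' \<subseteq> P"
        "\<forall>e. ext g e \<and> (\<forall>R \<in> Q'. R e) \<longrightarrow> sat_at M ([e v] @ cs) \<chi>"
        using insert.prems unfolding p_def by blast
      show ?case
      proof (intro exI[of _ "Q \<union> Q'"] conjI allI impI)
        fix e assume "ext g e \<and> (\<forall>R \<in> Q \<union> Q'. R e)"
        then have "\<forall>(\<chi>, cs) \<in> q. sat_at M ([e v] @ cs) \<chi>" "sat_at M ([e v] @ cs) \<chi>"
          using Q(3) Q'(3) by (metis UnI1, metis UnI2)
        then show "\<forall>(\<chi>, cs) \<in> insert c q. sat_at M ([e v] @ cs) \<chi>" unfolding c by simp
      qed (use Q Q' in auto)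
    qed auto
    note cons = this
    have "consistent M 1 p"
      unfolding consistent_def realizes_def
    proof (intro allI impI, elim conjE)
      fix q assume "q \<subseteq> p" "finite q"
      then obtain Q where Q: "finite Q" "Q \<subseteq> P"
        "\<And>e. ext g e \<and> (\<forall>R \<in> Q. R e) \<Longrightarrow> (\<forall>(\<chi>, cs) \<in> q. sat_at M ([e v] @ cs) \<chi>)"
        using cons[of q] by blast
      then obtain e where "ext g e \<and> (\<forall>R \<in> Q. R e)" using g(2) unfolding FS_def by blast
      from Q(3)[OF this] show "\<exists>xs. length xs = 1 \<and> (\<forall>(\<phi>, cs) \<in> q. sat_at M (xs @ cs) \<phi>)"
        by (intro exI[of _ "[e v]"]) simp
    qed
    moreover have "p \<subseteq> {(\<phi>, cs). set cs \<subseteq> A \<and> \<phi> \<in> fms L (1 + length cs)}"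
      unfolding p_def by auto
    ultimately obtain x where x: "realizes M [x] p" using sat A unfolding saturated_def by blast
    have "FS (g(v \<mapsto> x))"
      unfolding FS_def
    proof (intro allI impI, elim conjE)
      fix Q assume Q: "finite Q" "Q \<subseteq> P"
      \<comment> \<open>That \<open>Q\<close> has a solution with given values at \<open>v\<close>
        and on \<open>dom g\<close> is itself a formula in \<open>v\<close> and finitely many values
        of \<open>g\<close>. Being implied by \<open>Q\<close>, it belongs to \<open>p\<close> and
        holds at \<open>x\<close>.\<close>
      let ?R = "\<lambda>e. \<exists>e'. (\<forall>w \<in> insert v (dom g). e' w = e w) \<and> (\<forall>R \<in> Q. R e')"
      have "definable L M V (\<lambda>e. \<forall>R \<in> Q. R e)" using Q def by (intro definable_ball) auto
      from definable_project[OF this, of "insert v (dom g)"]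
      obtain V' where V': "finite V'" "V' \<subseteq> insert v (dom g)" "definable L M V' ?R"
        by (rule definable_finite_support) auto
      obtain ws where ws: "set ws = V' - {v}" using V' finite_list by blast
      obtain \<chi> where \<chi>: "\<chi> \<in> fms L (length (v # ws))" "\<And>e. ?R e \<longleftrightarrow> sat_at M (map e (v # ws)) \<chi>"
        by (rule definable_imp_sat_at[OF V'(3), of "v # ws"]) (use ws in auto)
      define cs where "cs = map (\<lambda>w. the (g w)) ws"
      have eq: "map e ws = cs" if "ext g e" for e
        using that ws V'(2) unfolding cs_def ext_def by force
      have "(\<chi>, cs) \<in> p"
      proof -
        have "set cs \<subseteq> A" using ws V'(2) unfolding cs_def A_def by auto
        moreover have "\<chi> \<in> fms L (1 + length cs)" using \<chi>(1) unfolding cs_def by simp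
        moreover have "sat_at M ([e v] @ cs) \<chi>" if "ext g e \<and> (\<forall>R \<in> Q. R e)" for e
          using \<chi>(2)[of e] eq[of e] that by auto
        ultimately show ?thesis using Q unfolding p_def by auto
      qed
      then have 1: "sat_at M (x # cs) \<chi>" using x unfolding realizes_def by auto
      obtain e1 where e1: "ext g e1" using g(2) unfolding FS_def by blast
      then have "ext g (e1(v := x))" using v unfolding ext_def by auto
      then have "map (e1(v := x)) ws = cs" by (rule eq)
      then have "?R (e1(v := x))" unfolding \<chi>(2) using 1 by (simp only: list.map fun_upd_same)
      then obtain e' where "\<forall>w \<in> insert v (dom g). e' w = (e1(v := x)) w" "\<forall>R \<in> Q. R e'" by blast
      then have "ext (g(v \<mapsto> x)) e' \<and> (\<forall>R \<in> Q. R e')"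
        using e1 v unfolding ext_def by auto
      then show "\<exists>e. ext (g(v \<mapsto> x)) e \<and> (\<forall>R \<in> Q. R e)" by blast
    qed
    moreover have "g \<subseteq>\<^sub>m g(v \<mapsto> x)" using v unfolding map_le_def by auto
    ultimately have "g(v \<mapsto> x) \<in> G" "g0 \<subseteq>\<^sub>m g(v \<mapsto> x)" "m \<subseteq> Map.graph (g(v \<mapsto> x))"
      using g v map_le_trans[OF g(4)] unfolding G_def graph_sub by auto
    then have "Map.graph (g(v \<mapsto> x)) = m" using m(2) unfolding \<A>_def by blast
    then have "Map.graph (g(v \<mapsto> x)) \<subseteq> Map.graph g" using g by simp
    then have "g(v \<mapsto> x) \<subseteq>\<^sub>m g" unfolding graph_sub .
    from map_le_implies_dom_le[OF this] show False using v by simp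
  qed
  obtain e1 where e1: "ext g e1" using g(2) unfolding FS_def by blast
  \<comment> \<open>No condition of \<open>P\<close> looks outside \<open>V\<close>; taking the
    values of \<open>e0\<close> there is right for the variables of \<open>J\<close> outside
    \<open>V\<close>.\<close>
  define e where "e = (\<lambda>v. if v \<in> V then e1 v else e0 v)"
  show thesis
  proof (rule that[of e])
    fix v assume v: "v \<in> J"
    show "e v = e0 v"
    proof (cases "v \<in> V")
      case True
      then have "v \<in> dom g0" "g0 v = Some (e0 v)" using v unfolding g0_def by auto
      then have "g v = Some (e0 v)" using g(4) unfolding map_le_def by simp
      then show ?thesis using e1 True \<open>dom g = V\<close> unfolding ext_def e_def by auto
    qed (simp add: e_def)
  next
    fix R assume R: "R \<in> P"
    obtain e' where e': "ext g e'" "R e'" using g(2)[unfolded FS_def, rule_format, of "{R}"] R by auto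
    have "e v = e' v" if "v \<in> V" for v
      using that e1 e' \<open>dom g = V\<close> unfolding e_def ext_def by force
    then show "R e" using definable_cong[OF def[OF R], of e e'] e' by blast
  qed
qed

section \<open>Trees of sequences\<close>

locale infinite_cardinal =
  fixes \<kappa> :: "'k rel"
  assumes card: "Card_order \<kappa>" and inf: "infinite (Field \<kappa>)"
begin

lemma wo: "Well_order \<kappa>"
  using card unfolding card_order_on_def by blast

lemma below_iff: "x \<in> underS \<kappa> y \<longleftrightarrow> x \<noteq> y \<and> (x, y) \<in> \<kappa>"
  by (auto simp: underS_def)

lemma below_Field: "x \<in> underS \<kappa> y \<Longrightarrow> x \<in> Field \<kappa> \<and> y \<in> Field \<kappa>"
  by (auto simp: underS_def Field_def)

lemma below_trans: "x \<in> underS \<kappa> y \<Longrightarrow> y \<in> underS \<kappa> z \<Longrightarrow> x \<in> underS \<kappa> z"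
  using wo_rel.ANTISYM[of \<kappa>] wo_rel.TRANS[of \<kappa>] wo
  unfolding below_iff wo_rel_def by (metis antisymD transD)

lemma below_asym: "x \<in> underS \<kappa> y \<Longrightarrow> y \<notin> underS \<kappa> x"
  using below_trans[of x y x] below_iff by blast

lemma below_total: "x \<in> Field \<kappa> \<Longrightarrow> y \<in> Field \<kappa> \<Longrightarrow> x = y \<or> x \<in> underS \<kappa> y \<or> y \<in> underS \<kappa> x"
  using wo_rel.TOTALS[of \<kappa>] wo unfolding below_iff wo_rel_def by blast

lemma ex_minimal:
  assumes "A \<subseteq> Field \<kappa>" "A \<noteq> {}"
  obtains m where "m \<in> A" "\<And>x. x \<in> A \<Longrightarrow> x \<notin> underS \<kappa> m"
proof -
  have "wf (\<kappa> - Id)" using wo unfolding well_order_on_def by blast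
  from wfE_min'[OF this assms(2)] obtain m where "m \<in> A" "\<And>y. (y, m) \<in> \<kappa> - Id \<Longrightarrow> y \<notin> A" by blast
  then show thesis by (intro that[of m]) (auto simp: below_iff)
qed

lemma down_closed_eq_underS:
  assumes "D \<subseteq> Field \<kappa>" "D \<noteq> Field \<kappa>" "\<And>x y. x \<in> underS \<kappa> y \<Longrightarrow> y \<in> D \<Longrightarrow> x \<in> D"
  obtains \<alpha> where "\<alpha> \<in> Field \<kappa>" "D = underS \<kappa> \<alpha>"
proof -
  have "Field \<kappa> - D \<subseteq> Field \<kappa>" "Field \<kappa> - D \<noteq> {}" using assms by auto
  then obtain m where m: "m \<in> Field \<kappa> - D" "\<And>x. x \<in> Field \<kappa> - D \<Longrightarrow> x \<notin> underS \<kappa> m"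
    using ex_minimal by metis
  have "D = underS \<kappa> m"
  proof
    show "D \<subseteq> underS \<kappa> m"
    proof
      fix x assume "x \<in> D"
      then show "x \<in> underS \<kappa> m" using m(1) assms(1,3) below_total[of x m] by blast
    qed
    show "underS \<kappa> m \<subseteq> D" using m(2) below_Field by blast
  qed
  then show thesis using m that by blast
qed

text \<open>An infinite cardinal has no last element, so the downward closed set of all elements up
  to \<alpha> is proper and hence of the form \<open>underS\<close>.\<close>

lemma successor:
  assumes "\<alpha> \<in> Field \<kappa>"
  obtains \<beta> where "\<beta> \<in> Field \<kappa>" "underS \<kappa> \<beta> = insert \<alpha> (underS \<kappa> \<alpha>)"
proof -
  obtain b where b: "b \<in> Field \<kappa>" "\<alpha> \<in> underS \<kappa> b"
    using infinite_Card_order_limit[OF card inf assms] below_iff by blast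
  have "insert \<alpha> (underS \<kappa> \<alpha>) \<noteq> Field \<kappa>"
    using b(1) below_asym[OF b(2)] b(2) below_iff[of b b] by (metis b(2) below_iff insertE)
  moreover have "insert \<alpha> (underS \<kappa> \<alpha>) \<subseteq> Field \<kappa>" using assms below_Field by blast
  moreover have "x \<in> insert \<alpha> (underS \<kappa> \<alpha>)" if "x \<in> underS \<kappa> y" "y \<in> insert \<alpha> (underS \<kappa> \<alpha>)" for x y
    using that below_trans by blast
  ultimately show thesis using down_closed_eq_underS[of "insert \<alpha> (underS \<kappa> \<alpha>)"] that by metis
qed

lemma underS_inj:
  assumes "\<alpha> \<in> Field \<kappa>" "\<beta> \<in> Field \<kappa>" "underS \<kappa> \<alpha> = underS \<kappa> \<beta>"
  shows "\<alpha> = \<beta>"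
  using below_total[OF assms(1,2)] assms(3) below_iff by blast

section \<open>Nodes and their meets\<close>

lemma treeD:
  assumes "\<eta> \<in> tree \<kappa>"
  shows "dom \<eta> \<subseteq> Field \<kappa>" "\<And>x y. x \<in> underS \<kappa> y \<Longrightarrow> y \<in> dom \<eta> \<Longrightarrow> x \<in> dom \<eta>"
proof -
  obtain \<alpha> where \<alpha>: "\<alpha> \<in> Field \<kappa>" "dom \<eta> = underS \<kappa> \<alpha>" using assms unfolding tree_def by blast
  show "dom \<eta> \<subseteq> Field \<kappa>" using \<alpha> below_Field by blast
  show "\<And>x y. x \<in> underS \<kappa> y \<Longrightarrow> y \<in> dom \<eta> \<Longrightarrow> x \<in> dom \<eta>" using \<alpha> below_trans by blast
qed

lemma tree_down_closed:
  assumes "\<eta> \<in> tree \<kappa>" "D \<subseteq> dom \<eta>" "\<And>x y. x \<in> underS \<kappa> y \<Longrightarrow> y \<in> D \<Longrightarrow> x \<in> D" "dom \<mu> = D"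
  shows "\<mu> \<in> tree \<kappa>"
proof -
  obtain \<alpha> where \<alpha>: "\<alpha> \<in> Field \<kappa>" "dom \<eta> = underS \<kappa> \<alpha>" using assms unfolding tree_def by blast
  have "\<alpha> \<notin> D" using \<alpha> assms below_iff by blast
  then have "D \<noteq> Field \<kappa>" using \<alpha> by blast
  moreover have "D \<subseteq> Field \<kappa>" using \<alpha> assms(2) below_Field by blast
  moreover have "x \<in> D" if "x \<in> underS \<kappa> y" "y \<in> D" for x y using that by (rule assms(3))
  ultimately obtain \<beta> where "\<beta> \<in> Field \<kappa>" "D = underS \<kappa> \<beta>"
    using down_closed_eq_underS[of D] by metis
  then show ?thesis using assms(4) unfolding tree_def by blast
qed

lemma len_eq:
  assumes "\<alpha> \<in> Field \<kappa>" "dom \<eta> = underS \<kappa> \<alpha>"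
  shows "len \<kappa> \<eta> = \<alpha>"
  unfolding len_def using assms underS_inj by (intro the_equality) auto

lemma Meet_eqI:
  assumes "\<mu> \<in> tree \<kappa>" "\<And>\<eta>. \<eta> \<in> S \<Longrightarrow> \<mu> \<unlhd> \<eta>"
    and "\<And>\<mu>'. \<mu>' \<in> tree \<kappa> \<Longrightarrow> (\<And>\<eta>. \<eta> \<in> S \<Longrightarrow> \<mu>' \<unlhd> \<eta>) \<Longrightarrow> \<mu>' \<unlhd> \<mu>"
  shows "Meet \<kappa> S = \<mu>"
  unfolding Meet_def using assms by (intro the_equality) (auto intro: map_le_antisym)

text \<open>Infinite families are included because descending combs refer to the meets of their
  tails.\<close>

lemma Meet_properties:
  assumes "S \<noteq> {}" "S \<subseteq> tree \<kappa>"
  shows "Meet \<kappa> S \<in> tree \<kappa>" "\<And>\<eta>. \<eta> \<in> S \<Longrightarrow> Meet \<kappa> S \<unlhd> \<eta>"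
    "\<And>\<mu>. \<mu> \<in> tree \<kappa> \<Longrightarrow> (\<And>\<eta>. \<eta> \<in> S \<Longrightarrow> \<mu> \<unlhd> \<eta>) \<Longrightarrow> \<mu> \<unlhd> Meet \<kappa> S"
proof -
  obtain \<eta>0 where \<eta>0: "\<eta>0 \<in> S" using assms by blast
  \<comment> \<open>The positions up to and including which all members of \<open>S\<close> agree
    with \<open>\<eta>0\<close>. This set is downward closed inside the domain of a node, so the
    restriction to it is again a node.\<close>
  define D where "D = {z \<in> dom \<eta>0. \<forall>\<eta> \<in> S. \<forall>y. y = z \<or> y \<in> underS \<kappa> z \<longrightarrow> \<eta> y = \<eta>0 y}"
  define \<mu> where "\<mu> = \<eta>0 |` D"
  have \<eta>0t: "\<eta>0 \<in> tree \<kappa>" using \<eta>0 assms by blast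
  have dom: "dom \<mu> = D" unfolding \<mu>_def D_def by auto
  have down: "x \<in> D" if "x \<in> underS \<kappa> y" "y \<in> D" for x y
    using that treeD(2)[OF \<eta>0t that(1)] below_trans[OF _ that(1)] unfolding D_def by auto
  have D0: "D \<subseteq> dom \<eta>0" unfolding D_def by auto
  have 1: "\<mu> \<in> tree \<kappa>" by (rule tree_down_closed[OF \<eta>0t D0 down dom])
  have 2: "\<mu> \<unlhd> \<eta>" if "\<eta> \<in> S" for \<eta>
    unfolding map_le_def dom using that by (auto simp: \<mu>_def D_def)
  have 3: "\<mu>' \<unlhd> \<mu>" if t: "\<mu>' \<in> tree \<kappa>" and le: "\<And>\<eta>. \<eta> \<in> S \<Longrightarrow> \<mu>' \<unlhd> \<eta>" for \<mu>'
  proof -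
    have eq: "\<mu>' y = \<eta> y" if "y \<in> dom \<mu>'" "\<eta> \<in> S" for y \<eta>
      using le[OF that(2)] that(1) unfolding map_le_def by blast
    have "z \<in> D" if z: "z \<in> dom \<mu>'" for z
    proof -
      have "z \<in> dom \<eta>0" using eq[OF z \<eta>0] z by (auto simp: dom_def)
      moreover have "\<eta> y = \<eta>0 y" if "\<eta> \<in> S" "y = z \<or> y \<in> underS \<kappa> z" for \<eta> y
      proof -
        have "y \<in> dom \<mu>'" using that(2) z treeD(2)[OF t, of y z] by auto
        from eq[OF this that(1)] eq[OF this \<eta>0] show ?thesis by (rule trans[OF sym])
      qed
      ultimately show ?thesis unfolding D_def by blast
    qed
    then show ?thesis using eq[OF _ \<eta>0] unfolding map_le_def \<mu>_def by simp
  qed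
  have "Meet \<kappa> S = \<mu>" using 1 2 3 by (rule Meet_eqI)
  then show "Meet \<kappa> S \<in> tree \<kappa>" "\<And>\<eta>. \<eta> \<in> S \<Longrightarrow> Meet \<kappa> S \<unlhd> \<eta>"
    "\<And>\<mu>. \<mu> \<in> tree \<kappa> \<Longrightarrow> (\<And>\<eta>. \<eta> \<in> S \<Longrightarrow> \<mu> \<unlhd> \<eta>) \<Longrightarrow> \<mu> \<unlhd> Meet \<kappa> S"
    using 1 2 3 by auto
qed

lemma meet_tree: "\<eta> \<in> tree \<kappa> \<Longrightarrow> \<nu> \<in> tree \<kappa> \<Longrightarrow> meet \<kappa> \<eta> \<nu> \<in> tree \<kappa>"
  by (rule Meet_properties(1)) auto

lemma meet_le1: "\<eta> \<in> tree \<kappa> \<Longrightarrow> \<nu> \<in> tree \<kappa> \<Longrightarrow> meet \<kappa> \<eta> \<nu> \<unlhd> \<eta>"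
  by (rule Meet_properties(2)) auto

lemma meet_le2: "\<eta> \<in> tree \<kappa> \<Longrightarrow> \<nu> \<in> tree \<kappa> \<Longrightarrow> meet \<kappa> \<eta> \<nu> \<unlhd> \<nu>"
  by (rule Meet_properties(2)) auto

lemma meet_greatest:
  "\<eta> \<in> tree \<kappa> \<Longrightarrow> \<nu> \<in> tree \<kappa> \<Longrightarrow> \<mu> \<in> tree \<kappa> \<Longrightarrow> \<mu> \<unlhd> \<eta> \<Longrightarrow> \<mu> \<unlhd> \<nu> \<Longrightarrow> \<mu> \<unlhd> meet \<kappa> \<eta> \<nu>"
  by (rule Meet_properties(3)) auto

lemma meet_commute: "meet \<kappa> \<eta> \<nu> = meet \<kappa> \<nu> \<eta>"
  by (simp add: insert_commute)

lemma meet_absorb: "\<eta> \<in> tree \<kappa> \<Longrightarrow> \<nu> \<in> tree \<kappa> \<Longrightarrow> \<eta> \<unlhd> \<nu> \<Longrightarrow> meet \<kappa> \<eta> \<nu> = \<eta>"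
  by (rule Meet_eqI) auto

lemma initseg_iff_meet:
  "\<eta> \<in> tree \<kappa> \<Longrightarrow> \<nu> \<in> tree \<kappa> \<Longrightarrow> \<eta> \<unlhd> \<nu> \<longleftrightarrow> meet \<kappa> \<eta> \<nu> = \<eta>"
  using meet_absorb meet_le2 by metis

lemma initseg_comparable:
  assumes "\<eta> \<in> tree \<kappa>" "\<nu> \<in> tree \<kappa>" "\<eta> \<unlhd> \<mu>" "\<nu> \<unlhd> \<mu>"
  shows "\<eta> \<unlhd> \<nu> \<or> \<nu> \<unlhd> \<eta>"
proof -
  obtain \<alpha> \<beta> where *: "\<alpha> \<in> Field \<kappa>" "dom \<eta> = underS \<kappa> \<alpha>" "\<beta> \<in> Field \<kappa>" "dom \<nu> = underS \<kappa> \<beta>"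
    using assms unfolding tree_def by blast
  then have "dom \<eta> \<subseteq> dom \<nu> \<or> dom \<nu> \<subseteq> dom \<eta>" using below_total[of \<alpha> \<beta>] below_trans by blast
  then show ?thesis
  proof
    assume "dom \<eta> \<subseteq> dom \<nu>"
    then have "\<eta> \<unlhd> \<nu>" using assms(3,4) unfolding map_le_def by (metis subsetD)
    then show ?thesis ..
  next
    assume "dom \<nu> \<subseteq> dom \<eta>"
    then have "\<nu> \<unlhd> \<eta>" using assms(3,4) unfolding map_le_def by (metis subsetD)
    then show ?thesis ..
  qed
qed

text \<open>Both \<open>meet \<kappa> a b\<close> and \<open>meet \<kappa> a x\<close> are initial
  segments of \<open>a\<close>, hence comparable, and the smaller one is the meet of all three
  nodes.\<close>

lemma meet_meet:
  assumes "a \<in> tree \<kappa>" "b \<in> tree \<kappa>" "x \<in> tree \<kappa>"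
  shows "meet \<kappa> (meet \<kappa> a b) x = meet \<kappa> a b \<or> meet \<kappa> (meet \<kappa> a b) x = meet \<kappa> a x"
proof -
  note t = meet_tree[OF assms(1,2)] meet_tree[OF assms(1,3)]
  consider "meet \<kappa> a b \<unlhd> meet \<kappa> a x" | "meet \<kappa> a x \<unlhd> meet \<kappa> a b"
    using initseg_comparable[OF t meet_le1[OF assms(1,2)] meet_le1[OF assms(1,3)]] by blast
  then show ?thesis
  proof cases
    case 1
    then have "meet \<kappa> a b \<unlhd> x" using meet_le2[OF assms(1,3)] map_le_trans by blast
    then show ?thesis using meet_absorb[OF t(1) assms(3)] by blast
  next
    case 2
    have "meet \<kappa> (meet \<kappa> a b) x = meet \<kappa> a x"
    proof (rule Meet_eqI)
      fix \<mu>' assume \<mu>': "\<mu>' \<in> tree \<kappa>" "\<And>\<eta>. \<eta> \<in> {meet \<kappa> a b, x} \<Longrightarrow> \<mu>' \<unlhd> \<eta>"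
      then have "\<mu>' \<unlhd> a" using meet_le1[OF assms(1,2)] map_le_trans by blast
      then show "\<mu>' \<unlhd> meet \<kappa> a x" using \<mu>' meet_greatest[OF assms(1,3)] by blast
    qed (use t 2 meet_le2[OF assms(1,3)] in auto)
    then show ?thesis by blast
  qed
qed

text \<open>A meet of four nodes collapses to a meet of two by \<open>meet_meet\<close>. In
  particular, the closure of a finite set under meets is finite.\<close>

lemma meets_closed:
  assumes "S \<subseteq> tree \<kappa>" "x \<in> (\<lambda>(a, b). meet \<kappa> a b) ` (S \<times> S)" "y \<in> (\<lambda>(a, b). meet \<kappa> a b) ` (S \<times> S)"
  shows "meet \<kappa> x y \<in> (\<lambda>(a, b). meet \<kappa> a b) ` (S \<times> S)"
proof -
  let ?P = "(\<lambda>(a, b). meet \<kappa> a b) ` (S \<times> S)"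
  have P: "meet \<kappa> a b \<in> ?P" if "a \<in> S" "b \<in> S" for a b using that by force
  obtain a b c d where *: "a \<in> S" "b \<in> S" "c \<in> S" "d \<in> S" "x = meet \<kappa> a b" "y = meet \<kappa> c d"
    using assms(2,3) by auto
  then have t: "a \<in> tree \<kappa>" "b \<in> tree \<kappa>" "c \<in> tree \<kappa>" "d \<in> tree \<kappa>" using assms(1) by auto
  have "meet \<kappa> a y \<in> ?P"
    using meet_meet[OF t(3,4,1)] P * meet_commute[of a y] by metis
  then show ?thesis
    using meet_meet[OF t(1,2) meet_tree[OF t(3,4)]] P * by metis
qed

text \<open>The first position at which two sequences differ; the shorter one may be undefined there.\<close>

definition split_at :: "'k node \<Rightarrow> 'k node \<Rightarrow> 'k \<Rightarrow> bool" where
  "split_at \<eta> \<nu> \<delta> \<longleftrightarrow> \<delta> \<in> Field \<kappa> \<and> (\<forall>z \<in> underS \<kappa> \<delta>. \<eta> z = \<nu> z) \<and> \<eta> \<delta> \<noteq> \<nu> \<delta>"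

lemma ex_split:
  assumes "\<eta> \<in> tree \<kappa>" "\<nu> \<in> tree \<kappa>" "\<eta> \<noteq> \<nu>"
  obtains \<delta> where "split_at \<eta> \<nu> \<delta>"
proof -
  let ?A = "{z \<in> Field \<kappa>. \<eta> z \<noteq> \<nu> z}"
  obtain z where z: "\<eta> z \<noteq> \<nu> z" using assms(3) by blast
  then have "z \<in> dom \<eta> \<or> z \<in> dom \<nu>" by (cases "\<eta> z") auto
  then have "z \<in> Field \<kappa>" using treeD(1)[OF assms(1)] treeD(1)[OF assms(2)] by blast
  then have "?A \<noteq> {}" "?A \<subseteq> Field \<kappa>" using z by auto
  then obtain m where "m \<in> ?A" "\<And>x. x \<in> ?A \<Longrightarrow> x \<notin> underS \<kappa> m" using ex_minimal[of ?A] by auto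
  then show thesis using below_Field by (intro that[of m]) (auto simp: split_at_def)
qed

lemma split_sym: "split_at \<eta> \<nu> \<delta> \<Longrightarrow> split_at \<nu> \<eta> \<delta>"
  unfolding split_at_def by auto

lemma split_initseg:
  assumes "\<eta> \<in> tree \<kappa>" "split_at \<eta> \<nu> \<delta>"
  shows "\<eta> \<unlhd> \<nu> \<longleftrightarrow> \<eta> \<delta> = None"
proof
  assume "\<eta> \<unlhd> \<nu>"
  then show "\<eta> \<delta> = None" using assms(2) unfolding split_at_def map_le_def by blast
next
  assume n: "\<eta> \<delta> = None"
  have "z \<in> underS \<kappa> \<delta>" if "z \<in> dom \<eta>" for z
    using below_total[of z \<delta>] treeD[OF assms(1)] that n assms(2) unfolding split_at_def by blast
  then show "\<eta> \<unlhd> \<nu>" using assms(2) unfolding split_at_def map_le_def by blast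
qed

lemma split_underS:
  assumes "\<eta> \<in> tree \<kappa>" "\<nu> \<in> tree \<kappa>" "split_at \<eta> \<nu> \<delta>"
  shows "underS \<kappa> \<delta> \<subseteq> dom \<eta>"
proof
  fix z assume z: "z \<in> underS \<kappa> \<delta>"
  have "\<delta> \<in> dom \<eta> \<or> \<delta> \<in> dom \<nu>" using assms(3) unfolding split_at_def by (cases "\<eta> \<delta>") auto
  then have "z \<in> dom \<eta> \<or> z \<in> dom \<nu>"
    using treeD(2)[OF assms(1) z] treeD(2)[OF assms(2) z] by blast
  moreover have "\<eta> z = \<nu> z" using z assms(3) unfolding split_at_def by blast
  ultimately show "z \<in> dom \<eta>" by (auto simp: dom_def)
qed

lemma split_meet:
  assumes "\<eta> \<in> tree \<kappa>" "\<nu> \<in> tree \<kappa>" "split_at \<eta> \<nu> \<delta>"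
  shows "meet \<kappa> \<eta> \<nu> = \<eta> |` underS \<kappa> \<delta>" "dom (meet \<kappa> \<eta> \<nu>) = underS \<kappa> \<delta>" "len \<kappa> (meet \<kappa> \<eta> \<nu>) = \<delta>"
proof -
  let ?\<mu> = "\<eta> |` underS \<kappa> \<delta>"
  have \<delta>: "\<delta> \<in> Field \<kappa>" using assms(3) unfolding split_at_def by blast
  have dom: "dom ?\<mu> = underS \<kappa> \<delta>" using split_underS[OF assms] by auto
  show eq: "meet \<kappa> \<eta> \<nu> = ?\<mu>"
  proof (rule Meet_eqI)
    show "?\<mu> \<in> tree \<kappa>" using \<delta> dom unfolding tree_def by blast
    show "?\<mu> \<unlhd> x" if "x \<in> {\<eta>, \<nu>}" for x
      using that assms(3) unfolding map_le_def dom split_at_def by auto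
    fix \<mu>' assume \<mu>': "\<mu>' \<in> tree \<kappa>" "\<And>x. x \<in> {\<eta>, \<nu>} \<Longrightarrow> \<mu>' \<unlhd> x"
    have "\<mu>' \<unlhd> \<eta>" "\<mu>' \<unlhd> \<nu>" using \<mu>'(2) by auto
    then have "\<delta> \<notin> dom \<mu>'" using assms(3) unfolding split_at_def map_le_def by metis
    then have "dom \<mu>' \<subseteq> underS \<kappa> \<delta>" using treeD[OF \<mu>'(1)] below_total[OF _ \<delta>] by blast
    then show "\<mu>' \<unlhd> ?\<mu>" using \<open>\<mu>' \<unlhd> \<eta>\<close> unfolding map_le_def by auto
  qed
  show "dom (meet \<kappa> \<eta> \<nu>) = underS \<kappa> \<delta>" unfolding eq by (rule dom)
  then show "len \<kappa> (meet \<kappa> \<eta> \<nu>) = \<delta>" using len_eq[OF \<delta>] by blast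
qed

text \<open>\<open>None\<close> lies below every \<open>Some\<close>: where two nodes split, a
  proper initial segment is undefined, so both clauses of the lexicographic order become one
  comparison.\<close>

definition option_less :: "nat option \<Rightarrow> nat option \<Rightarrow> bool" where
  "option_less x y \<longleftrightarrow> (case y of None \<Rightarrow> False | Some b \<Rightarrow> (case x of None \<Rightarrow> True | Some a \<Rightarrow> a < b))"

lemma split_lex:
  assumes "\<eta> \<in> tree \<kappa>" "\<nu> \<in> tree \<kappa>" "split_at \<eta> \<nu> \<delta>"
  shows "lex_less \<kappa> \<eta> \<nu> \<longleftrightarrow> option_less (\<eta> \<delta>) (\<nu> \<delta>)"
  using split_initseg[OF assms(1,3)] split_initseg[OF assms(2) split_sym[OF assms(3)]]
    split_meet(3)[OF assms] assms(3)
  unfolding lex_less_def strict_initseg_def incomparable_def option_less_def split_at_def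
  by (auto split: option.splits)

lemma lex_irrefl: "\<not> lex_less \<kappa> \<eta> \<eta>"
  unfolding lex_less_def strict_initseg_def incomparable_def by auto

lemma lex_asym:
  assumes "\<eta> \<in> tree \<kappa>" "\<nu> \<in> tree \<kappa>" "lex_less \<kappa> \<eta> \<nu>"
  shows "\<not> lex_less \<kappa> \<nu> \<eta>"
proof -
  obtain \<delta> where \<delta>: "split_at \<eta> \<nu> \<delta>" using ex_split assms lex_irrefl by metis
  show ?thesis using assms(3)
    unfolding split_lex[OF assms(1,2) \<delta>] split_lex[OF assms(2,1) split_sym[OF \<delta>]] option_less_def
    by (auto split: option.splits)
qed

lemma lex_total:
  assumes "\<eta> \<in> tree \<kappa>" "\<nu> \<in> tree \<kappa>" "\<eta> \<noteq> \<nu>"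
  shows "lex_less \<kappa> \<eta> \<nu> \<or> lex_less \<kappa> \<nu> \<eta>"
proof -
  obtain \<delta> where \<delta>: "split_at \<eta> \<nu> \<delta>" using ex_split assms by metis
  then have "\<eta> \<delta> \<noteq> \<nu> \<delta>" unfolding split_at_def by blast
  then show ?thesis
    unfolding split_lex[OF assms(1,2) \<delta>] split_lex[OF assms(2,1) split_sym[OF \<delta>]] option_less_def
    by (auto split: option.splits)
qed

lemma lex_strict_initseg: "\<eta> \<lhd> \<nu> \<Longrightarrow> lex_less \<kappa> \<eta> \<nu>"
  unfolding lex_less_def by blast

lemma lex_trans:
  assumes "a \<in> tree \<kappa>" "b \<in> tree \<kappa>" "c \<in> tree \<kappa>" "lex_less \<kappa> a b" "lex_less \<kappa> b c"
  shows "lex_less \<kappa> a c"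
proof -
  obtain \<delta> where \<delta>: "split_at a b \<delta>" using ex_split assms(1,2,4) lex_irrefl by metis
  obtain \<epsilon> where \<epsilon>: "split_at b c \<epsilon>" using ex_split assms(2,3,5) lex_irrefl by metis
  have l: "option_less (a \<delta>) (b \<delta>)" "option_less (b \<epsilon>) (c \<epsilon>)"
    using assms(4,5) split_lex[OF assms(1,2) \<delta>] split_lex[OF assms(2,3) \<epsilon>] by auto
  consider "\<delta> = \<epsilon>" | "\<delta> \<in> underS \<kappa> \<epsilon>" | "\<epsilon> \<in> underS \<kappa> \<delta>"
    using below_total \<delta> \<epsilon> unfolding split_at_def by blast
  then show ?thesis
  proof cases
    case 1
    have o: "option_less (a \<delta>) (c \<delta>)" "a \<delta> \<noteq> c \<delta>"
      using l 1 unfolding option_less_def by (auto split: option.splits)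
    then have "split_at a c \<delta>" using \<delta> \<epsilon> 1 unfolding split_at_def by metis
    then show ?thesis using split_lex[OF assms(1,3)] o by blast
  next
    case 2
    then have "c \<delta> = b \<delta>" "\<And>z. z \<in> underS \<kappa> \<delta> \<Longrightarrow> c z = b z"
      using \<epsilon> 2 below_trans[OF _ 2] unfolding split_at_def by auto
    then have "split_at a c \<delta>" "option_less (a \<delta>) (c \<delta>)" using \<delta> l unfolding split_at_def by auto
    then show ?thesis using split_lex[OF assms(1,3)] by blast
  next
    case 3
    then have "a \<epsilon> = b \<epsilon>" "\<And>z. z \<in> underS \<kappa> \<epsilon> \<Longrightarrow> a z = b z"
      using \<delta> 3 below_trans[OF _ 3] unfolding split_at_def by auto
    then have "split_at a c \<epsilon>" "option_less (a \<epsilon>) (c \<epsilon>)" using \<epsilon> l unfolding split_at_def by auto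
    then show ?thesis using split_lex[OF assms(1,3)] by blast
  qed
qed

text \<open>The node \<open>a\<close> already passes the position where \<open>b\<close> and
  \<open>c\<close> split and agrees with \<open>b\<close> there, so \<open>a\<close> and
  \<open>b\<close> are interchangeable in comparisons with \<open>c\<close>.\<close>

lemma lex_beyond_meet:
  assumes "a \<in> tree \<kappa>" "b \<in> tree \<kappa>" "c \<in> tree \<kappa>" "meet \<kappa> b c \<lhd> a" "a \<unlhd> b" "b \<noteq> c"
  shows "lex_less \<kappa> a c \<longleftrightarrow> lex_less \<kappa> b c" "meet \<kappa> a c = meet \<kappa> b c" "a \<noteq> c"
proof -
  obtain \<delta> where \<delta>: "split_at b c \<delta>" using ex_split assms(2,3,6) by metis
  note m = split_meet[OF assms(2,3) \<delta>]
  have "\<delta> \<in> dom a"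
  proof (rule ccontr)
    assume "\<delta> \<notin> dom a"
    then have "dom a \<subseteq> underS \<kappa> \<delta>"
      using treeD[OF assms(1)] below_total[of _ \<delta>] \<delta> unfolding split_at_def by blast
    then have "a \<unlhd> meet \<kappa> b c" using assms(5) unfolding m(1) map_le_def by auto
    then show False using assms(4) map_le_antisym unfolding strict_initseg_def by blast
  qed
  moreover have "underS \<kappa> \<delta> \<subseteq> dom a" using \<open>\<delta> \<in> dom a\<close> treeD[OF assms(1)] by blast
  ultimately have eq: "a \<delta> = b \<delta>" "\<And>z. z \<in> underS \<kappa> \<delta> \<Longrightarrow> a z = b z"
    using assms(5) unfolding map_le_def by auto
  then have s: "split_at a c \<delta>" using \<delta> unfolding split_at_def by auto
  show "lex_less \<kappa> a c \<longleftrightarrow> lex_less \<kappa> b c"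
    using split_lex[OF assms(1,3) s] split_lex[OF assms(2,3) \<delta>] eq by simp
  show "meet \<kappa> a c = meet \<kappa> b c"
    unfolding m(1) split_meet(1)[OF assms(1,3) s] by (rule ext) (simp add: restrict_map_def eq)
  show "a \<noteq> c" using s unfolding split_at_def by blast
qed

section \<open>Quantifier-free types of nodes\<close>

text \<open>An abstract copy of a set of nodes, given by its table of meets and its lexicographic
  order, so that types can be compared without formulas. Initial segments are read off from meets,
  and one implication for \<open>lt\<close> suffices since \<open>lex_less\<close> is asymmetric and
  \<open>lt\<close> is total on \<open>C\<close>.\<close>

definition tree_table ::
  "'c set \<Rightarrow> ('c \<Rightarrow> 'c \<Rightarrow> 'c) \<Rightarrow> ('c \<Rightarrow> 'c \<Rightarrow> bool) \<Rightarrow> ('c \<Rightarrow> 'k node) \<Rightarrow> bool" where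
  "tree_table C mt lt s \<longleftrightarrow> s ` C \<subseteq> tree \<kappa> \<and>
     (\<forall>c \<in> C. \<forall>d \<in> C. mt c d \<in> C \<and> meet \<kappa> (s c) (s d) = s (mt c d) \<and>
        (lt c d \<longrightarrow> lex_less \<kappa> (s c) (s d)) \<and> (c \<noteq> d \<longrightarrow> lt c d \<or> lt d c))"

lemma tree_table_iff:
  assumes "tree_table C mt lt s" "c \<in> C" "d \<in> C"
  shows "s c = s d \<longleftrightarrow> c = d" "lex_less \<kappa> (s c) (s d) \<longleftrightarrow> lt c d" "s c \<unlhd> s d \<longleftrightarrow> mt c d = c"
proof -
  have t: "s c \<in> tree \<kappa>" "s d \<in> tree \<kappa>" using assms unfolding tree_table_def by auto
  have *: "s c = s d \<longleftrightarrow> c = d" if "c \<in> C" "d \<in> C" for c d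
    using assms(1) that lex_irrefl unfolding tree_table_def by metis
  show "s c = s d \<longleftrightarrow> c = d" using * assms by blast
  show "lex_less \<kappa> (s c) (s d) \<longleftrightarrow> lt c d"
    using assms lex_asym[OF t] lex_irrefl unfolding tree_table_def by metis
  show "s c \<unlhd> s d \<longleftrightarrow> mt c d = c"
    unfolding initseg_iff_meet[OF t] using assms * unfolding tree_table_def by metis
qed

end

lemma tree_lang_simps [simp]:
  "fsyms tree_lang = UNIV" "rsyms tree_lang = UNIV" "farity tree_lang x = 2" "rarity tree_lang y = 2"
  by (simp_all add: tree_lang_def)

lemma length_2_cases: "length xs = 2 \<Longrightarrow> \<exists>x y. xs = [x, y]"
  by (auto simp: length_Suc_conv numeral_2_eq_2)

lemma tree_struct_simps [simp]:
  "fint (tree_struct \<kappa>) F [x, y] = meet \<kappa> x y"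
  "rint (tree_struct \<kappa>) InitSegR [x, y] \<longleftrightarrow> x \<unlhd> y"
  "rint (tree_struct \<kappa>) LexR [x, y] \<longleftrightarrow> lex_less \<kappa> x y"
  by (simp_all add: tree_struct_def)

context infinite_cardinal
begin

text \<open>A term is evaluated inside \<open>C\<close> by \<open>mt\<close>, so it has one abstract
  value in \<open>C\<close>, of which both families give the image.\<close>

lemma tree_table_val:
  assumes "tree_table C mt lt s" "tree_table C mt lt s'" "set cs \<subseteq> C"
    and "wf_tm tree_lang t" "fv_tm t \<subseteq> {..<length cs}"
  shows "\<exists>c \<in> C. val (tree_struct \<kappa>) (\<lambda>v. map s cs ! v) t = s c \<and>
    val (tree_struct \<kappa>) (\<lambda>v. map s' cs ! v) t = s' c"
  using assms(4,5)
proof (induction t)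
  case (Var v)
  then show ?case using assms(3) nth_mem[of v cs] by (intro bexI[of _ "cs ! v"]) auto
next
  case (Fn F ts)
  then obtain t u where ts: "ts = [t, u]" using length_2_cases by fastforce
  obtain c where c: "c \<in> C" "val (tree_struct \<kappa>) (\<lambda>v. map s cs ! v) t = s c"
    "val (tree_struct \<kappa>) (\<lambda>v. map s' cs ! v) t = s' c" using Fn ts by force
  obtain d where d: "d \<in> C" "val (tree_struct \<kappa>) (\<lambda>v. map s cs ! v) u = s d"
    "val (tree_struct \<kappa>) (\<lambda>v. map s' cs ! v) u = s' d" using Fn ts by force
  show ?case
    using assms(1,2) c d unfolding tree_table_def ts by (intro bexI[of _ "mt c d"]) auto
qed

lemma same_qf_type_table:
  assumes "tree_table C mt lt s" "tree_table C mt lt s'" "set cs \<subseteq> C"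
  shows "same_qf_type tree_lang (tree_struct \<kappa>) (map s cs) (map s' cs)"
proof -
  let ?v = "val (tree_struct \<kappa>) (\<lambda>v. map s cs ! v)" and ?v' = "val (tree_struct \<kappa>) (\<lambda>v. map s' cs ! v)"
  have "sat_at (tree_struct \<kappa>) (map s cs) \<phi> \<longleftrightarrow> sat_at (tree_struct \<kappa>) (map s' cs) \<phi>"
    if "wf_fm tree_lang \<phi>" "fv \<phi> \<subseteq> {..<length cs}" "qfree \<phi>" for \<phi>
    using that
  proof (induction \<phi>)
    case (Eq t u)
    obtain c where c: "c \<in> C" "?v t = s c" "?v' t = s' c"
      using tree_table_val[OF assms] Eq.prems by force
    obtain d where d: "d \<in> C" "?v u = s d" "?v' u = s' d"
      using tree_table_val[OF assms] Eq.prems by force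
    show ?case
      using tree_table_iff(1)[OF assms(1) c(1) d(1)] tree_table_iff(1)[OF assms(2) c(1) d(1)] c d
      by simp
  next
    case (Rel R ts)
    then obtain t u where ts: "ts = [t, u]" using length_2_cases by fastforce
    obtain c where c: "c \<in> C" "?v t = s c" "?v' t = s' c"
      using tree_table_val[OF assms] Rel.prems ts by force
    obtain d where d: "d \<in> C" "?v u = s d" "?v' u = s' d"
      using tree_table_val[OF assms] Rel.prems ts by force
    show ?case
      using tree_table_iff(2,3)[OF assms(1) c(1) d(1)] tree_table_iff(2,3)[OF assms(2) c(1) d(1)] c d
      by (cases R) (simp_all add: ts)
  qed simp_all
  then show ?thesis unfolding same_qf_type_def fms_def by simp
qed

lemma strongly_indiscernible_table:
  assumes "strongly_indiscernible L M \<kappa> a"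
    and "tree_table C mt lt s" "tree_table C mt lt s'" "set cs \<subseteq> C"
  shows "same_type L M (concat (map (\<lambda>c. a (s c)) cs)) (concat (map (\<lambda>c. a (s' c)) cs))"
proof -
  have "set (map s cs) \<subseteq> tree \<kappa>" "set (map s' cs) \<subseteq> tree \<kappa>"
    using assms(2-4) unfolding tree_table_def by force+
  then have "same_type L M (concat (map a (map s cs))) (concat (map a (map s' cs)))"
    using assms(1) same_qf_type_table[OF assms(2-4)] unfolding strongly_indiscernible_def by blast
  then show ?thesis by (simp add: o_def)
qed

end

section \<open>Chains and combs\<close>

context infinite_cardinal
begin

lemma Refl: "Refl \<kappa>"
  using wo unfolding well_order_on_def linear_order_on_def partial_order_on_def preorder_on_def
  by blast

lemma in_Restr_iff: "(x, y) \<in> Restr \<kappa> A \<longleftrightarrow> x \<in> A \<and> y \<in> A \<and> (x, y) \<in> \<kappa>"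
  by auto

lemma card_underS: "\<alpha> \<in> Field \<kappa> \<Longrightarrow> |underS \<kappa> \<alpha>| <o \<kappa>"
  by (rule card_of_underS[OF card])

text \<open>The order type of a final segment of \<open>\<kappa>\<close> is \<open>\<kappa>\<close>: it is at least \<open>\<kappa>\<close> for reasons of
  cardinality, and if it were larger, then \<open>\<kappa>\<close> would be the type of a proper initial segment.\<close>

lemma ex_shift:
  assumes \<alpha>: "\<alpha> \<in> Field \<kappa>"
  obtains g where "bij_betw g (Field \<kappa>) (Field \<kappa> - underS \<kappa> \<alpha>)"
    "\<And>x y. x \<in> Field \<kappa> \<Longrightarrow> y \<in> Field \<kappa> \<Longrightarrow> (x, y) \<in> \<kappa> \<longleftrightarrow> (g x, g y) \<in> \<kappa>"
proof -
  define A where "A = Field \<kappa> - underS \<kappa> \<alpha>"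
  have AF: "A \<subseteq> Field \<kappa>" unfolding A_def by auto
  have wr: "Well_order (Restr \<kappa> A)" by (rule Well_order_Restr[OF wo])
  have FA: "Field (Restr \<kappa> A) = A" by (rule Refl_Field_Restr2[OF Refl AF])
  have "\<not> |A| <o \<kappa>"
  proof
    assume "|A| <o \<kappa>"
    then have "|A \<union> underS \<kappa> \<alpha>| <o \<kappa>"
      using card_of_Un_ordLess_infinite_Field[OF inf card] card_underS[OF \<alpha>] by blast
    moreover have "A \<union> underS \<kappa> \<alpha> = Field \<kappa>" unfolding A_def using below_Field by blast
    ultimately have "|Field \<kappa>| <o \<kappa>" by simp
    then show False using card_of_Field_ordIso[OF card] not_ordLess_ordIso by blast
  qed
  then have "\<kappa> \<le>o |A|" using wo card_of_Well_order not_ordLess_iff_ordLeq by blast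
  also have "|A| \<le>o Restr \<kappa> A" using wr FA by (intro card_of_least) simp
  finally have 1: "\<kappa> \<le>o Restr \<kappa> A" .
  have "\<not> \<kappa> <o Restr \<kappa> A"
  proof
    assume "\<kappa> <o Restr \<kappa> A"
    then obtain a where a: "a \<in> A" "\<kappa> =o Restr (Restr \<kappa> A) (underS (Restr \<kappa> A) a)"
      using ordLess_iff_ordIso_Restr[OF wr wo] FA by auto
    have "Field (Restr (Restr \<kappa> A) (underS (Restr \<kappa> A) a)) \<subseteq> underS \<kappa> a"
      by (auto simp: Field_def underS_def)
    moreover have "|Field \<kappa>| =o |Field (Restr (Restr \<kappa> A) (underS (Restr \<kappa> A) a))|"
      by (rule card_of_cong[OF a(2)])
    ultimately have "|Field \<kappa>| \<le>o |underS \<kappa> a|"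
      using card_of_mono1 ordIso_ordLeq_trans by metis
    then have "|Field \<kappa>| <o \<kappa>" using card_underS[of a] a AF ordLeq_ordLess_trans by blast
    then show False using card_of_Field_ordIso[OF card] not_ordLess_ordIso by blast
  qed
  then have "\<kappa> =o Restr \<kappa> A" using 1 ordLeq_iff_ordLess_or_ordIso by blast
  then obtain g where "iso \<kappa> (Restr \<kappa> A) g" unfolding ordIso_def by blast
  then have g: "bij_betw g (Field \<kappa>) A"
    "\<And>x y. x \<in> Field \<kappa> \<Longrightarrow> y \<in> Field \<kappa> \<Longrightarrow> (x, y) \<in> \<kappa> \<longleftrightarrow> (g x, g y) \<in> Restr \<kappa> A"
    unfolding iso_iff2 FA by auto
  show thesis
  proof (rule that)
    show "bij_betw g (Field \<kappa>) (Field \<kappa> - underS \<kappa> \<alpha>)" using g(1) unfolding A_def .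
    fix x y assume xy: "x \<in> Field \<kappa>" "y \<in> Field \<kappa>"
    then have "g x \<in> A" "g y \<in> A" using g(1) unfolding bij_betw_def by auto
    then show "(x, y) \<in> \<kappa> \<longleftrightarrow> (g x, g y) \<in> \<kappa>" using g(2)[OF xy] by blast
  qed
qed

text \<open>This yields the uniqueness of the ordinal described in the definition of
  concatenation.\<close>

lemma initial_segments_not_iso:
  assumes "y \<in> underS \<kappa> y'"
  shows "\<not> Restr \<kappa> (underS \<kappa> y) =o Restr \<kappa> (underS \<kappa> y')"
proof -
  let ?r = "Restr \<kappa> (underS \<kappa> y')"
  have F: "Field ?r = underS \<kappa> y'" using Refl_Field_Restr2[OF Refl] below_Field by blast
  have "Restr ?r (underS ?r y) <o ?r"
    using underS_Restr_ordLess[OF Well_order_Restr[OF wo]] F assms by auto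
  moreover have "underS ?r y = underS \<kappa> y"
    using assms below_trans[OF _ assms] by (auto simp: below_iff underS_def)
  moreover have "Restr ?r (underS \<kappa> y) = Restr \<kappa> (underS \<kappa> y)"
    using below_trans[OF _ assms] by auto
  ultimately show ?thesis using not_ordLess_ordIso by metis
qed

text \<open>The map \<open>g\<close> is ordinal addition of \<alpha> from the left. Concatenation is
  computed through it from here on, and the description by order types is no longer used.\<close>

lemma ex_append_shift:
  assumes \<alpha>: "\<alpha> \<in> Field \<kappa>"
  obtains g where "bij_betw g (Field \<kappa>) (Field \<kappa> - underS \<kappa> \<alpha>)"
    "\<And>x y. x \<in> Field \<kappa> \<Longrightarrow> y \<in> Field \<kappa> \<Longrightarrow> x \<in> underS \<kappa> y \<longleftrightarrow> g x \<in> underS \<kappa> (g y)"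
    "\<And>\<eta> \<nu> y. dom \<eta> = underS \<kappa> \<alpha> \<Longrightarrow> y \<in> Field \<kappa> \<Longrightarrow> node_append \<kappa> \<eta> \<nu> (g y) = \<nu> y"
proof -
  obtain g where g: "bij_betw g (Field \<kappa>) (Field \<kappa> - underS \<kappa> \<alpha>)"
    "\<And>x y. x \<in> Field \<kappa> \<Longrightarrow> y \<in> Field \<kappa> \<Longrightarrow> (x, y) \<in> \<kappa> \<longleftrightarrow> (g x, g y) \<in> \<kappa>"
    using ex_shift[OF \<alpha>] by metis
  have inj: "g x = g y \<longleftrightarrow> x = y" if "x \<in> Field \<kappa>" "y \<in> Field \<kappa>" for x y
    using g(1) that unfolding bij_betw_def inj_on_def by blast
  have below: "x \<in> underS \<kappa> y \<longleftrightarrow> g x \<in> underS \<kappa> (g y)" if "x \<in> Field \<kappa>" "y \<in> Field \<kappa>" for x y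
    using inj[OF that] g(2)[OF that] unfolding below_iff by blast
  have "node_append \<kappa> \<eta> \<nu> (g y) = \<nu> y" if \<eta>: "dom \<eta> = underS \<kappa> \<alpha>" and y: "y \<in> Field \<kappa>" for \<eta> \<nu> y
  proof -
    have gy: "g y \<in> Field \<kappa> - underS \<kappa> \<alpha>" using g(1) y unfolding bij_betw_def by auto
    let ?B = "underS \<kappa> (g y) - underS \<kappa> \<alpha>"
    \<comment> \<open>The interval from \<alpha> up to \<open>g y\<close> is the image of the
      positions below \<open>y\<close>, so it has the order type that the definition of
      concatenation asks for.\<close>
    have B: "?B = g ` underS \<kappa> y"
    proof
      show "?B \<subseteq> g ` underS \<kappa> y"
      proof
        fix z assume z: "z \<in> ?B"
        then have "z \<in> Field \<kappa> - underS \<kappa> \<alpha>" using below_Field by blast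
        then obtain x where "x \<in> Field \<kappa>" "z = g x" using g(1) unfolding bij_betw_def by blast
        then show "z \<in> g ` underS \<kappa> y" using below[of x y] y z by blast
      qed
      show "g ` underS \<kappa> y \<subseteq> ?B"
      proof
        fix z assume "z \<in> g ` underS \<kappa> y"
        then obtain x where x: "z = g x" "x \<in> underS \<kappa> y" by blast
        then have "x \<in> Field \<kappa>" using below_Field by blast
        then have "g x \<in> Field \<kappa> - underS \<kappa> \<alpha>" using bij_betwE[OF g(1)] by blast
        then show "z \<in> ?B" using x below[OF \<open>x \<in> Field \<kappa>\<close> y] by simp
      qed
    qed
    have iso: "Restr \<kappa> (underS \<kappa> y) =o Restr \<kappa> ?B"
    proof -
      have sub: "underS \<kappa> y \<subseteq> Field \<kappa>" "?B \<subseteq> Field \<kappa>" using below_Field by blast+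
      note F = Refl_Field_Restr2[OF Refl sub(1)] Refl_Field_Restr2[OF Refl sub(2)]
      have "iso (Restr \<kappa> (underS \<kappa> y)) (Restr \<kappa> ?B) g"
        unfolding iso_iff2 F
      proof (intro conjI ballI)
        show "bij_betw g (underS \<kappa> y) ?B"
          unfolding B bij_betw_def using inj below_Field by (auto simp: inj_on_def)
        fix a b assume ab: "a \<in> underS \<kappa> y" "b \<in> underS \<kappa> y"
        then have "g a \<in> ?B" "g b \<in> ?B" unfolding B by auto
        then show "(a, b) \<in> Restr \<kappa> (underS \<kappa> y) \<longleftrightarrow> (g a, g b) \<in> Restr \<kappa> ?B"
          using g(2)[of a b] ab below_Field unfolding in_Restr_iff by blast
      qed
      then show ?thesis using Well_order_Restr[OF wo] unfolding ordIso_def by blast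
    qed
    have "(THE y'. y' \<in> Field \<kappa> \<and> Restr \<kappa> (underS \<kappa> (g y) - dom \<eta>) =o Restr \<kappa> (underS \<kappa> y')) = y"
      unfolding \<eta>
    proof (rule the_equality)
      show "y \<in> Field \<kappa> \<and> Restr \<kappa> ?B =o Restr \<kappa> (underS \<kappa> y)"
        using y iso ordIso_symmetric by blast
      fix y' assume y': "y' \<in> Field \<kappa> \<and> Restr \<kappa> ?B =o Restr \<kappa> (underS \<kappa> y')"
      then have "Restr \<kappa> (underS \<kappa> y) =o Restr \<kappa> (underS \<kappa> y')"
        using iso ordIso_transitive by blast
      then show "y' = y"
        using below_total[of y y'] y y' initial_segments_not_iso ordIso_symmetric by blast
    qed
    then show ?thesis using gy unfolding node_append_def \<eta> by simp
  qed
  then show thesis using that[of g] g(1) below by blast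
qed

lemma node_append_prefix: "z \<in> dom \<eta> \<Longrightarrow> node_append \<kappa> \<eta> \<nu> z = \<eta> z"
  unfolding node_append_def by simp

lemma node_append_outside: "z \<notin> dom \<eta> \<Longrightarrow> z \<notin> Field \<kappa> \<Longrightarrow> node_append \<kappa> \<eta> \<nu> z = None"
  unfolding node_append_def by simp

section \<open>Teeth and the paths above them\<close>

lemma dom_zeros: "dom (zeros \<kappa> i) = underS \<kappa> i"
  unfolding zeros_def by (auto split: if_splits)

abbreviation tooth :: "'k \<Rightarrow> 'k node" where
  "tooth i \<equiv> node_append \<kappa> (zeros \<kappa> i) (single_one \<kappa>)"

text \<open>The shift onto the final segment from \<open>i\<close> sends the least element of
  \<kappa> to \<open>i\<close>, and \<open>single_one\<close> is defined at the least element
  only.\<close>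

lemma tooth_eq:
  assumes i: "i \<in> Field \<kappa>"
  shows "tooth i = (zeros \<kappa> i)(i \<mapsto> 1)"
proof
  obtain g where g: "bij_betw g (Field \<kappa>) (Field \<kappa> - underS \<kappa> i)"
    "\<And>x y. x \<in> Field \<kappa> \<Longrightarrow> y \<in> Field \<kappa> \<Longrightarrow> x \<in> underS \<kappa> y \<longleftrightarrow> g x \<in> underS \<kappa> (g y)"
    "\<And>\<eta> \<nu> y. dom \<eta> = underS \<kappa> i \<Longrightarrow> y \<in> Field \<kappa> \<Longrightarrow> node_append \<kappa> \<eta> \<nu> (g y) = \<nu> y"
    using ex_append_shift[OF i] by metis
  fix z
  consider "z \<in> underS \<kappa> i" | "z \<in> Field \<kappa> - underS \<kappa> i" | "z \<notin> Field \<kappa>" by blast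
  then show "tooth i z = ((zeros \<kappa> i)(i \<mapsto> 1)) z"
  proof cases
    case 1
    then have "z \<noteq> i" using below_iff by blast
    then show ?thesis using 1 node_append_prefix[of z "zeros \<kappa> i"] dom_zeros by simp
  next
    case 2
    then obtain y where y: "y \<in> Field \<kappa>" "z = g y" using g(1) unfolding bij_betw_def by blast
    have "underS \<kappa> y = {} \<longleftrightarrow> z = i"
    proof
      assume e: "underS \<kappa> y = {}"
      show "z = i"
      proof (rule ccontr)
        assume "z \<noteq> i"
        then have "i \<in> underS \<kappa> z" using 2 i below_total[of z i] by blast
        moreover have "i \<in> Field \<kappa> - underS \<kappa> i" using i below_iff by blast
        then obtain x where "x \<in> Field \<kappa>" "i = g x" using g(1) unfolding bij_betw_def by blast
        ultimately show False using g(2)[of x y] y e by blast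
      qed
    next
      assume "z = i"
      then show "underS \<kappa> y = {}"
        using g(2)[of _ y] y below_Field g(1) unfolding bij_betw_def by fast
    qed
    moreover have "tooth i z = single_one \<kappa> y" using g(3)[OF dom_zeros] y by blast
    moreover have "zeros \<kappa> i z = None" using 2 unfolding zeros_def by simp
    ultimately show ?thesis using y(1) unfolding single_one_def by simp
  next
    case 3
    then have "z \<notin> underS \<kappa> i" "z \<noteq> i" using below_Field i by blast+
    then show ?thesis using 3 node_append_outside dom_zeros unfolding zeros_def by simp
  qed
qed

lemma dom_tooth: "i \<in> Field \<kappa> \<Longrightarrow> dom (tooth i) = insert i (underS \<kappa> i)"
  unfolding tooth_eq using dom_zeros by simp

lemma tooth_tree: assumes "i \<in> Field \<kappa>" shows "tooth i \<in> tree \<kappa>"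
  using successor[OF assms] dom_tooth[OF assms] unfolding tree_def
  by (metis (mono_tags, lifting) mem_Collect_eq)

lemma zeros_strict_initseg:
  assumes "i \<in> underS \<kappa> j" shows "zeros \<kappa> i \<lhd> zeros \<kappa> j"
proof -
  have "i \<in> dom (zeros \<kappa> j)" "i \<notin> dom (zeros \<kappa> i)" using assms dom_zeros below_iff by auto
  then have "zeros \<kappa> i \<noteq> zeros \<kappa> j" by metis
  moreover have "zeros \<kappa> i \<unlhd> zeros \<kappa> j"
    unfolding map_le_def dom_zeros using below_trans[OF _ assms] by (simp add: zeros_def)
  ultimately show ?thesis unfolding strict_initseg_def by blast
qed

text \<open>The two teeth split at \<open>i\<close>, where the first has 1 and the second 0. So the
  teeth descend lexicographically as \<open>i\<close> grows, with the constant sequences as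
  spine.\<close>

lemma meet_tooth:
  assumes "i \<in> underS \<kappa> j"
  shows "meet \<kappa> (tooth i) (tooth j) = zeros \<kappa> i" "lex_less \<kappa> (tooth j) (tooth i)"
proof -
  have F: "i \<in> Field \<kappa>" "j \<in> Field \<kappa>" using assms below_Field by auto
  note t = tooth_tree[OF F(1)] tooth_tree[OF F(2)]
  have ij: "i \<noteq> j" using assms below_iff by blast
  have v: "tooth i i = Some 1" "tooth j i = Some 0"
    using assms ij unfolding tooth_eq[OF F(1)] tooth_eq[OF F(2)] by (auto simp: zeros_def)
  have eq: "tooth i z = zeros \<kappa> i z" "tooth j z = zeros \<kappa> i z" if "z \<in> underS \<kappa> i" for z
    using that below_trans[OF that assms] below_iff[of z] unfolding tooth_eq[OF F(1)] tooth_eq[OF F(2)]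
    by (auto simp: zeros_def)
  have s: "split_at (tooth i) (tooth j) i"
    unfolding split_at_def using v eq F by auto
  show "meet \<kappa> (tooth i) (tooth j) = zeros \<kappa> i"
    unfolding split_meet(1)[OF t s]
  proof
    fix z
    show "(tooth i |` underS \<kappa> i) z = zeros \<kappa> i z"
      using eq(1) by (cases "z \<in> underS \<kappa> i") (simp_all add: zeros_def)
  qed
  show "lex_less \<kappa> (tooth j) (tooth i)"
    unfolding split_lex[OF t(2,1) split_sym[OF s]] v option_less_def by simp
qed

abbreviation tooth_path :: "'k \<Rightarrow> 'k \<Rightarrow> 'k node" where
  "tooth_path i j \<equiv> node_append \<kappa> (tooth i) (zeros \<kappa> j)"

text \<open>The last statement links the chain to the comb: at the least index the path starts with
  the tooth itself.\<close>

lemma tooth_path: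
  assumes i: "i \<in> Field \<kappa>"
  shows "j \<in> Field \<kappa> \<Longrightarrow> tooth_path i j \<in> tree \<kappa>"
    "j \<in> underS \<kappa> j' \<Longrightarrow> tooth_path i j \<lhd> tooth_path i j'"
    "j \<in> Field \<kappa> \<Longrightarrow> underS \<kappa> j = {} \<Longrightarrow> tooth_path i j = tooth i"
proof -
  obtain i' where i': "i' \<in> Field \<kappa>" "underS \<kappa> i' = insert i (underS \<kappa> i)"
    using successor[OF i] by metis
  have d: "dom (tooth i) = underS \<kappa> i'" using dom_tooth[OF i] i' by simp
  obtain g where g: "bij_betw g (Field \<kappa>) (Field \<kappa> - underS \<kappa> i')"
    "\<And>x y. x \<in> Field \<kappa> \<Longrightarrow> y \<in> Field \<kappa> \<Longrightarrow> x \<in> underS \<kappa> y \<longleftrightarrow> g x \<in> underS \<kappa> (g y)"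
    "\<And>\<eta> \<nu> y. dom \<eta> = underS \<kappa> i' \<Longrightarrow> y \<in> Field \<kappa> \<Longrightarrow> node_append \<kappa> \<eta> \<nu> (g y) = \<nu> y"
    using ex_append_shift[OF i'(1)] by metis
  have cases: "z \<in> underS \<kappa> i' \<or> (\<exists>y \<in> Field \<kappa>. z = g y) \<or> z \<notin> Field \<kappa>" for z
    using g(1) unfolding bij_betw_def by blast
  have val: "tooth_path i j z = (if z \<in> underS \<kappa> i' then tooth i z
      else if \<exists>y \<in> underS \<kappa> j. z = g y then Some 0 else None)" for j z
  proof -
    have gF: "g y \<in> Field \<kappa>" "g y \<notin> underS \<kappa> i'" if "y \<in> Field \<kappa>" for y
      using g(1) that unfolding bij_betw_def by auto
    consider "z \<in> underS \<kappa> i'" | y where "y \<in> Field \<kappa>" "z = g y" | "z \<notin> Field \<kappa>" using cases by blast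
    then show ?thesis
    proof cases
      case 1
      then show ?thesis using node_append_prefix d by simp
    next
      case 2
      have "(\<exists>y' \<in> underS \<kappa> j. z = g y') \<longleftrightarrow> y \<in> underS \<kappa> j"
        using g(1) 2 below_Field unfolding bij_betw_def inj_on_def by metis
      moreover have "tooth_path i j z = zeros \<kappa> j y" using g(3)[OF d 2(1)] 2(2) by simp
      ultimately show ?thesis using gF(2)[OF 2(1)] 2(2) unfolding zeros_def by simp
    next
      case 3
      then have "z \<notin> underS \<kappa> i'" "\<not> (\<exists>y \<in> underS \<kappa> j. z = g y)" using below_Field gF by blast+
      then show ?thesis using 3 node_append_outside d by simp
    qed
  qed
  have dom: "dom (tooth_path i j) = underS \<kappa> (g j)" if j: "j \<in> Field \<kappa>" for j
  proof
    have gj: "g j \<in> Field \<kappa> - underS \<kappa> i'" using g(1) j unfolding bij_betw_def by auto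
    show "dom (tooth_path i j) \<subseteq> underS \<kappa> (g j)"
    proof
      fix z assume "z \<in> dom (tooth_path i j)"
      then consider "z \<in> underS \<kappa> i'" | y where "y \<in> underS \<kappa> j" "z = g y"
        using val[of j z] by (auto split: if_splits)
      then show "z \<in> underS \<kappa> (g j)"
      proof cases
        case 1
        then show ?thesis
          using below_total[of "g j" i'] gj i' below_trans below_iff by blast
      next
        case 2
        then show ?thesis using g(2) j below_Field by blast
      qed
    qed
    show "underS \<kappa> (g j) \<subseteq> dom (tooth_path i j)"
    proof
      fix z assume z: "z \<in> underS \<kappa> (g j)"
      then consider "z \<in> underS \<kappa> i'" | y where "y \<in> Field \<kappa>" "z = g y" using cases below_Field by blast
      then show "z \<in> dom (tooth_path i j)"
      proof cases
        case 1
        then show ?thesis using val[of j z] d by (metis domIff)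
      next
        case 2
        then have "y \<in> underS \<kappa> j" using g(2) j z by blast
        then show ?thesis using val[of j z] 2 d by (metis domIff option.distinct(1))
      qed
    qed
  qed
  show "tooth_path i j \<in> tree \<kappa>" if "j \<in> Field \<kappa>"
  proof -
    have "g j \<in> Field \<kappa>" using g(1) that unfolding bij_betw_def by auto
    then show ?thesis using dom[OF that] unfolding tree_def by blast
  qed
  show "tooth_path i j \<lhd> tooth_path i j'" if j: "j \<in> underS \<kappa> j'"
  proof -
    have F: "j \<in> Field \<kappa>" "j' \<in> Field \<kappa>" using j below_Field by auto
    have "g j \<in> underS \<kappa> (g j')" using g(2)[OF F] j by blast
    then have "dom (tooth_path i j) \<noteq> dom (tooth_path i j')" unfolding dom[OF F(1)] dom[OF F(2)]
      using below_iff by blast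
    moreover have "tooth_path i j \<unlhd> tooth_path i j'"
      unfolding map_le_def
    proof
      fix z assume "z \<in> dom (tooth_path i j)"
      then have "z \<in> underS \<kappa> i' \<or> (\<exists>y \<in> underS \<kappa> j. z = g y)"
        using val[of j z] by (auto split: if_splits)
      then show "tooth_path i j z = tooth_path i j' z"
        unfolding val using below_trans[OF _ j] by auto
    qed
    ultimately show ?thesis unfolding strict_initseg_def by metis
  qed
  show "tooth_path i j = tooth i" if "j \<in> Field \<kappa>" "underS \<kappa> j = {}"
  proof
    fix z show "tooth_path i j z = tooth i z"
      using val[of j z] that d by (cases "z \<in> underS \<kappa> i'") (simp, metis domIff empty_iff)
  qed
qed

text \<open>The table mentions only \<open>N\<close>, so strong indiscernibility gives all chains of
  \<open>N\<close> nodes the same type.\<close>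

lemma tree_table_chain:
  assumes "\<And>j. j < N \<Longrightarrow> s j \<in> tree \<kappa>" "\<And>j k. j < k \<Longrightarrow> k < N \<Longrightarrow> s j \<lhd> s k"
  shows "tree_table {..<N} min (<) (s :: nat \<Rightarrow> _)"
proof -
  have "meet \<kappa> (s c) (s d) = s (min c d)" if "c < N" "d < N" for c d
  proof -
    have "meet \<kappa> (s c) (s d) = s (min c d)" if "c \<le> d" "d < N" for c d
    proof -
      have "s c \<unlhd> s d" using assms(2)[of c d] that unfolding strict_initseg_def
        by (cases "c = d") auto
      then show ?thesis using meet_absorb assms(1) that by (simp add: min_def)
    qed
    then show ?thesis using that meet_commute by (metis min.commute nle_le)
  qed
  then show ?thesis
    unfolding tree_table_def using assms lex_strict_initseg by auto
qed

text \<open>The teeth \<open>e 0, \<dots>, e (N - 1)\<close> of a comb and its spine \<open>m 0, \<dots>, m (N - 2)\<close>.\<close>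

definition comb_seq :: "nat \<Rightarrow> (nat \<Rightarrow> 'k node) \<Rightarrow> (nat \<Rightarrow> 'k node) \<Rightarrow> bool" where
  "comb_seq N e m \<longleftrightarrow> (\<forall>t < N. e t \<in> tree \<kappa>) \<and>
     (\<forall>t < N. \<forall>s < t. e s \<bottom> e t \<and> meet \<kappa> (e s) (e t) = m s \<and> lex_less \<kappa> (e t) (e s)) \<and>
     (\<forall>t. Suc t < N \<longrightarrow> (\<forall>s < t. m s \<lhd> m t))"

end

text \<open>\<open>(t, True)\<close> stands for the tooth \<open>e t\<close> and
  \<open>(t, False)\<close> for the spine node \<open>m t\<close>. The last tooth has no spine node,
  hence the condition \<open>Suc t < N\<close>.\<close>

definition comb_index :: "nat \<Rightarrow> (nat \<times> bool) set" where
  "comb_index N = {(t, x). t < N \<and> (x \<or> Suc t < N)}"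

fun comb_meet :: "nat \<times> bool \<Rightarrow> nat \<times> bool \<Rightarrow> nat \<times> bool" where
  "comb_meet (s, x) (t, y) = (if s = t then (s, x \<and> y) else (min s t, False))"

text \<open>The whole spine precedes all teeth lexicographically; the spine ascends and the teeth
  descend.\<close>

fun comb_less :: "nat \<times> bool \<Rightarrow> nat \<times> bool \<Rightarrow> bool" where
  "comb_less (s, x) (t, y) \<longleftrightarrow> (if x then y \<and> t < s else y \<or> s < t)"

context infinite_cardinal
begin

text \<open>A comb is thereby determined up to quantifier-free type by its number of teeth, wherever
  it lies in the tree.\<close>

lemma tree_table_comb:
  assumes "comb_seq N e m"
  shows "tree_table (comb_index N) comb_meet comb_less (\<lambda>(t, x). if x then e t else m t)"
proof -
  let ?s = "\<lambda>(t, x). if x then e t else m t"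
  have e: "e t \<in> tree \<kappa>" if "t < N" for t using assms that unfolding comb_seq_def by blast
  have mt: "meet \<kappa> (e s) (e t) = m s" "lex_less \<kappa> (e t) (e s)" if "s < t" "t < N" for s t
    using assms that unfolding comb_seq_def by auto
  have m: "m s \<lhd> m t" if "s < t" "Suc t < N" for s t using assms that unfolding comb_seq_def by auto
  have mtree: "m t \<in> tree \<kappa>" if "Suc t < N" for t
    using mt(1)[of t "Suc t"] meet_tree[OF e[of t] e[of "Suc t"]] that by simp
  have me: "m s \<unlhd> e t" if "s \<le> t" "t < N" "Suc s < N" for s t
  proof (cases "s = t")
    case True
    then show ?thesis using mt(1)[of s "Suc s"] meet_le1[OF e[of s] e[of "Suc s"]] that by simp
  next
    case False
    then show ?thesis using mt(1)[of s t] meet_le2[OF e[of s] e[of t]] that by simp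
  qed
  have nle: "\<not> e s \<unlhd> e t" if "s \<noteq> t" "s < N" "t < N" for s t
    using assms that unfolding comb_seq_def incomparable_def by (metis nat_neq_iff)
  have ms: "m s \<lhd> e t" if "s \<le> t" "t < N" "Suc s < N" for s t
  proof -
    have "m s \<noteq> e t"
    proof
      assume *: "m s = e t"
      show False
      proof (cases "s = t")
        case True
        then show False using me[of s "Suc s"] nle[of s "Suc s"] * that by simp
      next
        case False
        then show False using me[of s s] nle[of t s] * that by simp
      qed
    qed
    then show ?thesis using me[OF that] unfolding strict_initseg_def by blast
  qed
  \<comment> \<open>For \<open>t < s\<close> the spine node \<open>m s\<close> lies on
    \<open>e s\<close> strictly beyond the meet \<open>m t\<close> of \<open>e s\<close> and
    \<open>e t\<close>, so it compares with \<open>e t\<close> in the same way as \<open>e s\<close>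
    does.\<close>
  have above: "meet \<kappa> (m s) (e t) = m t" "lex_less \<kappa> (m s) (e t)" if "t < s" "Suc s < N" for s t
  proof -
    have st: "s < N" "t < N" using that by auto
    have "e s \<noteq> e t" using nle[of s t] that st by auto
    moreover have "meet \<kappa> (e s) (e t) = m t" using mt(1)[OF that(1) st(1)] meet_commute by metis
    moreover have "m t \<lhd> m s" "m s \<unlhd> e s" using m[OF that] me[of s s] that by auto
    ultimately show "meet \<kappa> (m s) (e t) = m t" "lex_less \<kappa> (m s) (e t)"
      using lex_beyond_meet[OF mtree[OF that(2)] e[OF st(1)] e[OF st(2)]] mt(2)[OF that(1) st(1)] by auto
  qed
  have mm: "meet \<kappa> (m s) (m t) = m s" if "s \<le> t" "Suc t < N" for s t
  proof -
    have "m s \<unlhd> m t" using m[of s t] that unfolding strict_initseg_def by (cases "s = t") auto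
    then show ?thesis using meet_absorb mtree that by simp
  qed
  show ?thesis
    unfolding tree_table_def
  proof (intro conjI ballI)
    show "?s ` comb_index N \<subseteq> tree \<kappa>" using e mtree by (auto simp: comb_index_def)
    fix c d assume "c \<in> comb_index N" "d \<in> comb_index N"
    then obtain s x t y where c: "c = (s, x)" "s < N" "x \<or> Suc s < N"
      and d: "d = (t, y)" "t < N" "y \<or> Suc t < N" unfolding comb_index_def by auto
    show "comb_meet c d \<in> comb_index N"
      using c d by (auto simp: comb_index_def)
    show "c \<noteq> d \<longrightarrow> comb_less c d \<or> comb_less d c" using c d by auto
    have me': "meet \<kappa> (m i) (e j) = (if i \<le> j then m i else m j)" if "Suc i < N" "j < N" for i j
      using that me[of i j] meet_absorb[OF mtree[of i] e[of j]] above(1)[of j i] by simp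
    have ee: "meet \<kappa> (e i) (e j) = (if i = j then e i else m (min i j))" if "i < N" "j < N" for i j
      using that mt(1)[of i j] mt(1)[of j i] meet_absorb[OF e[of i] e[of i]] meet_commute[of "e i" "e j"]
      by (auto simp: min_def)
    have mm': "meet \<kappa> (m i) (m j) = m (min i j)" if "Suc i < N" "Suc j < N" for i j
      using that mm[of i j] mm[of j i] meet_commute[of "m i" "m j"] by (auto simp: min_def)
    show "meet \<kappa> (?s c) (?s d) = ?s (comb_meet c d)"
    proof (cases x; cases y)
      assume "\<not> x" "y"
      then show ?thesis using me'[of s t] c d by (auto simp: min_def)
    next
      assume "x" "\<not> y"
      then show ?thesis using me'[of t s] c d meet_commute[of "e s" "m t"] by (auto simp: min_def)
    qed (use ee[of s t] mm'[of s t] c d in auto)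
    show "comb_less c d \<longrightarrow> lex_less \<kappa> (?s c) (?s d)"
    proof (cases x; cases y)
      assume "\<not> x" "y"
      then show ?thesis using ms[of s t] above(2)[of t s] c d lex_strict_initseg by (cases "s \<le> t") auto
    next
      assume "\<not> x" "\<not> y"
      then show ?thesis using m[of s t] c d lex_strict_initseg by auto
    qed (use mt(2)[of t s] c d in auto)
  qed
qed

lemma comb_seq_teeth:
  assumes "\<And>s t. s < t \<Longrightarrow> t < N \<Longrightarrow> i s \<in> underS \<kappa> (i t)" "\<And>t. t < N \<Longrightarrow> i t \<in> Field \<kappa>"
  shows "comb_seq N (\<lambda>t. tooth (i t)) (\<lambda>t. zeros \<kappa> (i t))"
proof -
  have "tooth x \<bottom> tooth y" if "x \<in> underS \<kappa> y" for x y
  proof -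
    have F: "x \<in> Field \<kappa>" "y \<in> Field \<kappa>" using that below_Field by auto
    have "x \<in> dom (tooth x) - dom (zeros \<kappa> x)" "y \<in> dom (tooth y) - dom (zeros \<kappa> x)"
      using that F dom_tooth dom_zeros below_asym by (auto simp: below_iff)
    then have "zeros \<kappa> x \<noteq> tooth x" "zeros \<kappa> x \<noteq> tooth y" by auto
    then show ?thesis
      using meet_tooth(1)[OF that] initseg_iff_meet[OF tooth_tree tooth_tree] F meet_commute
      unfolding incomparable_def by metis
  qed
  then show ?thesis
    unfolding comb_seq_def
    using assms tooth_tree meet_tooth zeros_strict_initseg by auto
qed

end

interpretation nat: infinite_cardinal natLeq
  by unfold_locales (rule natLeq_Card_order, simp add: Field_natLeq)

section \<open>Descending combs\<close>

text \<open>The meet of a tail with at least two teeth is the spine node at its start: it lies below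
  all later teeth, and the first two teeth of the tail allow nothing longer.\<close>

lemma descending_comb_of_seq:
  assumes "nat.comb_seq N e m"
  shows "descending_comb (e ` {..<N})"
proof -
  have e: "e t \<in> tree natLeq" if "t < N" for t using assms that unfolding nat.comb_seq_def by blast
  have st: "e s \<bottom> e t" "meet natLeq (e s) (e t) = m s" "lex_less natLeq (e t) (e s)" if "s < t" "t < N" for s t
    using assms that unfolding nat.comb_seq_def by auto
  have m: "m s \<lhd> m t" if "s < t" "Suc t < N" for s t using assms that unfolding nat.comb_seq_def by auto
  have inc: "e s \<bottom> e t" if "s \<noteq> t" "s < N" "t < N" for s t
    using st(1)[of s t] st(1)[of t s] that unfolding incomparable_def by (metis nat_neq_iff)
  have inj: "inj_on e {..<N}"
    using inc unfolding inj_on_def incomparable_def by (metis lessThan_iff map_le_refl)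
  have M: "Meet natLeq (e ` {j \<in> {..<N}. i \<le> j}) = m i" if "Suc i < N" for i
  proof (rule nat.Meet_eqI)
    have i: "i < N" "i < Suc i" using that by auto
    have mi: "m i = meet natLeq (e i) (e (Suc i))" using st(2)[OF i(2) that] by simp
    show "m i \<in> tree natLeq" unfolding mi by (rule nat.meet_tree[OF e[OF i(1)] e[OF that]])
    show "m i \<unlhd> \<eta>" if "\<eta> \<in> e ` {j \<in> {..<N}. i \<le> j}" for \<eta>
    proof -
      obtain j where j: "\<eta> = e j" "i \<le> j" "j < N" using \<open>\<eta> \<in> _\<close> by blast
      show ?thesis
      proof (cases "j = i")
        case True
        then show ?thesis
          using nat.meet_le1[OF e[OF i(1)] e[OF \<open>Suc i < N\<close>]] unfolding mi j by simp
      next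
        case False
        then have "m i = meet natLeq (e i) (e j)" using st(2)[of i j] j by simp
        then show ?thesis using nat.meet_le2[OF e[OF i(1)] e[OF j(3)]] j by simp
      qed
    qed
    fix \<mu>' assume \<mu>': "\<mu>' \<in> tree natLeq" "\<And>\<eta>. \<eta> \<in> e ` {j \<in> {..<N}. i \<le> j} \<Longrightarrow> \<mu>' \<unlhd> \<eta>"
    then have "\<mu>' \<unlhd> e i" "\<mu>' \<unlhd> e (Suc i)" using i that by auto
    then show "\<mu>' \<unlhd> m i" unfolding mi using nat.meet_greatest e i that \<mu>'(1) by blast
  qed
  have "Meet natLeq (e ` {j \<in> {..<N}. i \<le> j}) \<lhd> Meet natLeq (e ` {j \<in> {..<N}. Suc i \<le> j})"
    if i: "Suc i < N" for i
  proof (cases "Suc (Suc i) < N")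
    case True
    then show ?thesis using M[OF i] M[OF True] m[of i "Suc i"] by simp
  next
    \<comment> \<open>The last tail is a single tooth, which is its own meet; the last spine node is
      a proper initial segment of it because the last two teeth are incomparable.\<close>
    case False
    then have "{j \<in> {..<N}. Suc i \<le> j} = {Suc i}" using i by auto
    moreover have "Meet natLeq {e (Suc i)} = e (Suc i)"
      by (rule nat.Meet_eqI) (use e i in auto)
    moreover have "m i \<lhd> e (Suc i)"
    proof -
      have t: "e i \<in> tree natLeq" "e (Suc i) \<in> tree natLeq" using e i by auto
      have mi: "m i = meet natLeq (e i) (e (Suc i))" using st(2)[of i "Suc i"] i by simp
      have "m i \<noteq> e (Suc i)"
        using st(1)[of i "Suc i"] i nat.meet_le1[OF t] unfolding mi incomparable_def by fastforce
      then show ?thesis using nat.meet_le2[OF t] unfolding mi strict_initseg_def by blast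
    qed
    ultimately show ?thesis using M[OF i] by simp
  qed
  moreover have "lex_less natLeq (e (Suc i)) (e i)" if "Suc i < N" for i using st(3)[of i "Suc i"] that by simp
  ultimately have "\<exists>J e'. (J = UNIV \<or> (\<exists>n. J = {..<n})) \<and> bij_betw e' J (e ` {..<N}) \<and>
     (\<forall>i. Suc i \<in> J \<longrightarrow> lex_less natLeq (e' (Suc i)) (e' i) \<and>
        Meet natLeq (e' ` {j \<in> J. i \<le> j}) \<lhd> Meet natLeq (e' ` {j \<in> J. Suc i \<le> j}))"
    using inj by (intro exI[of _ "{..<N}"] exI[of _ e]) (auto simp: bij_betw_def)
  moreover have "e ` {..<N} \<subseteq> tree natLeq" using e by auto
  moreover have "\<forall>\<eta> \<in> e ` {..<N}. \<forall>\<nu> \<in> e ` {..<N}. \<eta> \<noteq> \<nu> \<longrightarrow> \<eta> \<bottom> \<nu>"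
  proof (intro ballI impI)
    fix \<eta> \<nu> assume *: "\<eta> \<in> e ` {..<N}" "\<nu> \<in> e ` {..<N}" "\<eta> \<noteq> \<nu>"
    then obtain s t where "\<eta> = e s" "\<nu> = e t" "s < N" "t < N" by auto
    then show "\<eta> \<bottom> \<nu>" using inc[of s t] *(3) by auto
  qed
  ultimately show ?thesis unfolding descending_comb_def by blast
qed

lemma strict_initseg_trans: "\<eta> \<lhd> \<nu> \<Longrightarrow> \<nu> \<lhd> \<mu> \<Longrightarrow> \<eta> \<lhd> \<mu>"
  unfolding strict_initseg_def by (metis map_le_antisym map_le_trans)

text \<open>Consistency concerns finite subsets only. A finite subset of a comb, listed in the order
  of the comb, is again a comb, with meets of tails of the whole comb as spine.\<close>

lemma descending_comb_seq:
  assumes "descending_comb X" "finite Y" "Y \<subseteq> X"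
  obtains e m where "Y = e ` {..<card Y}" "nat.comb_seq (card Y) e m"
proof -
  note comb = assms(1)[unfolded descending_comb_def]
  obtain J e where J: "J = UNIV \<or> (\<exists>n. J = {..<n})" and bij: "bij_betw e J X"
    and stp: "\<forall>i. Suc i \<in> J \<longrightarrow> lex_less natLeq (e (Suc i)) (e i) \<and>
      Meet natLeq (e ` {j \<in> J. i \<le> j}) \<lhd> Meet natLeq (e ` {j \<in> J. Suc i \<le> j})"
    using comb by (elim conjE exE) assumption+
  have step: "\<And>i. Suc i \<in> J \<Longrightarrow> lex_less natLeq (e (Suc i)) (e i)"
      "\<And>i. Suc i \<in> J \<Longrightarrow> Meet natLeq (e ` {j \<in> J. i \<le> j}) \<lhd> Meet natLeq (e ` {j \<in> J. Suc i \<le> j})"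
    using stp by auto
  have X: "X \<subseteq> tree natLeq" "\<And>\<eta> \<nu>. \<eta> \<in> X \<Longrightarrow> \<nu> \<in> X \<Longrightarrow> \<eta> \<noteq> \<nu> \<Longrightarrow> \<eta> \<bottom> \<nu>"
    using comb by auto
  define Mt where "Mt i = Meet natLeq (e ` {j \<in> J. i \<le> j})" for i
  have down: "i \<in> J" if "j \<in> J" "i \<le> j" for i j using J that by auto
  have eX: "e j \<in> X" if "j \<in> J" for j using bij that unfolding bij_betw_def by blast
  have et: "e j \<in> tree natLeq" if "j \<in> J" for j using eX[OF that] X by blast
  have Mp: "Mt i \<in> tree natLeq" "\<And>j. j \<in> J \<Longrightarrow> i \<le> j \<Longrightarrow> Mt i \<unlhd> e j"
    "\<And>\<mu>. \<mu> \<in> tree natLeq \<Longrightarrow> (\<And>j. j \<in> J \<Longrightarrow> i \<le> j \<Longrightarrow> \<mu> \<unlhd> e j) \<Longrightarrow> \<mu> \<unlhd> Mt i" if "i \<in> J" for i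
  proof -
    have ne: "e ` {j \<in> J. i \<le> j} \<noteq> {}" "e ` {j \<in> J. i \<le> j} \<subseteq> tree natLeq" using that et by auto
    show "Mt i \<in> tree natLeq" unfolding Mt_def by (rule nat.Meet_properties(1)[OF ne])
    show "\<And>j. j \<in> J \<Longrightarrow> i \<le> j \<Longrightarrow> Mt i \<unlhd> e j" unfolding Mt_def
      by (rule nat.Meet_properties(2)[OF ne]) blast
    show "\<And>\<mu>. \<mu> \<in> tree natLeq \<Longrightarrow> (\<And>j. j \<in> J \<Longrightarrow> i \<le> j \<Longrightarrow> \<mu> \<unlhd> e j) \<Longrightarrow> \<mu> \<unlhd> Mt i"
      unfolding Mt_def by (rule nat.Meet_properties(3)[OF ne]) auto
  qed
  have Mstep: "Mt i \<lhd> Mt (Suc i)" if "Suc i \<in> J" for i using step(2)[OF that] unfolding Mt_def .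
  have Mlt: "Mt i \<lhd> Mt j" if "i < j" "j \<in> J" for i j
    using that
  proof (induction j)
    case (Suc j)
    then have "j \<in> J" using down by simp
    then show ?case using Suc Mstep[OF Suc.prems(2)] strict_initseg_trans by (cases "i = j") auto
  qed simp
  have lex: "lex_less natLeq (e j) (e i)" if "i < j" "j \<in> J" for i j
    using that
  proof (induction j)
    case (Suc j)
    have J: "j \<in> J" "i \<in> J" using Suc.prems down by auto
    then show ?case
      using Suc step(1)[OF Suc.prems(2)] nat.lex_trans[OF et[OF Suc.prems(2)] et[OF J(1)] et[OF J(2)]]
      by (cases "i = j") auto
  qed simp
  \<comment> \<open>A common initial segment of \<open>e i\<close> and \<open>e j\<close> is
    comparable with the meet of the tail from \<open>Suc i\<close>. If it is shorter, it lies below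
    all later teeth. If it is longer, that tail meet would lie below \<open>e i\<close> as well,
    contradicting the strict growth of the tail meets.\<close>
  have meet: "meet natLeq (e i) (e j) = Mt i" if ij: "i < j" "j \<in> J" for i j
  proof (rule nat.Meet_eqI)
    have iJ: "i \<in> J" "Suc i \<in> J" using ij down by auto
    show "Mt i \<in> tree natLeq" by (rule Mp(1)[OF iJ(1)])
    show "Mt i \<unlhd> \<eta>" if "\<eta> \<in> {e i, e j}" for \<eta> using Mp(2)[OF iJ(1)] that iJ ij by auto
    fix \<mu> assume \<mu>: "\<mu> \<in> tree natLeq" "\<And>\<eta>. \<eta> \<in> {e i, e j} \<Longrightarrow> \<mu> \<unlhd> \<eta>"
    have MS: "Mt (Suc i) \<unlhd> e j" using Mp(2)[OF iJ(2) ij(2)] ij by simp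
    have "\<mu> \<unlhd> e j" "\<mu> \<unlhd> e i" using \<mu>(2) by auto
    then consider "\<mu> \<unlhd> Mt (Suc i)" | "Mt (Suc i) \<unlhd> \<mu>"
      using nat.initseg_comparable[OF \<mu>(1) Mp(1)[OF iJ(2)]] MS by blast
    then show "\<mu> \<unlhd> Mt i"
    proof cases
      case 1
      have "\<mu> \<unlhd> e k" if "k \<in> J" "i \<le> k" for k
        using that 1 Mp(2)[OF iJ(2) that(1)] \<open>\<mu> \<unlhd> e i\<close> map_le_trans by (cases "k = i") auto
      then show ?thesis by (rule Mp(3)[OF iJ(1) \<mu>(1)])
    next
      case 2
      have "Mt (Suc i) \<unlhd> e k" if "k \<in> J" "i \<le> k" for k
        using that 2 Mp(2)[OF iJ(2) that(1)] \<open>\<mu> \<unlhd> e i\<close> map_le_trans by (cases "k = i") auto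
      then have "Mt (Suc i) \<unlhd> Mt i" by (rule Mp(3)[OF iJ(1) Mp(1)[OF iJ(2)]])
      then show ?thesis using Mstep[OF iJ(2)] map_le_antisym unfolding strict_initseg_def by blast
    qed
  qed
  define I where "I = {j \<in> J. e j \<in> Y}"
  have injI: "inj_on e I" using bij unfolding bij_betw_def I_def by (auto intro: inj_on_subset)
  have eI: "e ` I = Y" using bij assms(3) unfolding I_def bij_betw_def by blast
  have fI: "finite I" using finite_imageD[OF _ injI] eI assms(2) by simp
  have cI: "card I = card Y" using card_image[OF injI] eI by simp
  define l where "l = sorted_list_of_set I"
  have l: "length l = card Y" "set l = I" "\<And>s t. s < t \<Longrightarrow> t < card Y \<Longrightarrow> l ! s < l ! t"
    using fI cI sorted_wrt_nth_less[OF strict_sorted_list_of_set[of I]] unfolding l_def by auto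
  have lI: "l ! t \<in> J" if "t < card Y" for t using that l(1,2) nth_mem[of t l] unfolding I_def by simp
  show thesis
  proof (rule that)
    show "Y = (\<lambda>t. e (l ! t)) ` {..<card Y}"
    proof -
      have "I = (\<lambda>t. l ! t) ` {..<card Y}" using l(1,2) by (auto simp: set_conv_nth)
      then show ?thesis using eI by (simp add: image_image)
    qed
    show "nat.comb_seq (card Y) (\<lambda>t. e (l ! t)) (\<lambda>t. Mt (l ! t))"
      unfolding nat.comb_seq_def
    proof (intro conjI allI impI)
      fix t assume t: "t < card Y"
      show "e (l ! t) \<in> tree natLeq" using et lI t by blast
      fix s assume s: "s < t"
      have "e (l ! s) \<noteq> e (l ! t)" using lex[OF l(3)[OF s t] lI[OF t]] nat.lex_irrefl by metis
      then show "e (l ! s) \<bottom> e (l ! t)" using X(2) eX lI s t by simp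
      show "meet natLeq (e (l ! s)) (e (l ! t)) = Mt (l ! s)" by (rule meet[OF l(3)[OF s t] lI[OF t]])
      show "lex_less natLeq (e (l ! t)) (e (l ! s))" by (rule lex[OF l(3)[OF s t] lI[OF t]])
    next
      fix t s assume "Suc t < card Y" "s < t"
      then show "Mt (l ! s) \<lhd> Mt (l ! t)" using Mlt l(3) lI by simp
    qed
  qed
qed

context infinite_cardinal
begin

text \<open>\<open>\<omega>\<close> is an initial segment of \<open>\<kappa>\<close>, so the tree of finite sequences embeds into that of
  sequences of length less than \<open>\<kappa>\<close>.\<close>

lemma ex_tree_embedding:
  obtains h where "\<And>\<eta>. \<eta> \<in> tree natLeq \<Longrightarrow> h \<eta> \<in> tree \<kappa>"
    "\<And>\<eta> \<nu>. \<eta> \<lhd> \<nu> \<Longrightarrow> h \<eta> \<lhd> h \<nu>"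
    "\<And>N e m. nat.comb_seq N e m \<Longrightarrow> comb_seq N (\<lambda>t. h (e t)) (\<lambda>t. h (m t))"
proof -
  have "natLeq \<le>o \<kappa>" using infinite_iff_natLeq_ordLeq inf card_of_Field_ordIso[OF card] ordLeq_ordIso_trans by blast
  then obtain g where g: "embed natLeq \<kappa> g" unfolding ordLeq_def by blast
  have gF: "g n \<in> Field \<kappa>" for n using embed_in_Field[OF g] by (simp add: Field_natLeq)
  have ginj: "g n = g k \<longleftrightarrow> n = k" for n k
    using embed_inj_on[OF natLeq_Well_order g] by (auto simp: Field_natLeq inj_on_def)
  have gS: "underS \<kappa> (g n) = g ` {..<n}" for n
    using embed_underS[OF natLeq_Well_order g, of n] natLeq_underS_less[of n]
    by (auto simp: Field_natLeq bij_betw_def lessThan_def)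
  define h :: "nat node \<Rightarrow> 'k node" where "h \<eta> = (\<lambda>z. if z \<in> range g then \<eta> (inv g z) else None)" for \<eta>
  have hg: "h \<eta> (g n) = \<eta> n" for \<eta> n
    unfolding h_def using ginj by (simp add: inv_f_f inj_def)
  have hn: "z \<notin> range g \<Longrightarrow> h \<eta> z = None" for \<eta> z unfolding h_def by simp
  have dom: "dom (h \<eta>) = g ` dom \<eta>" for \<eta>
  proof
    show "dom (h \<eta>) \<subseteq> g ` dom \<eta>"
    proof
      fix z assume z: "z \<in> dom (h \<eta>)"
      then obtain n where "z = g n" using hn[of z \<eta>] by (cases "z \<in> range g") auto
      then show "z \<in> g ` dom \<eta>" using z hg[of \<eta> n] by (simp add: domIff)
    qed
    show "g ` dom \<eta> \<subseteq> dom (h \<eta>)" using hg by auto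
  qed
  have ht: "h \<eta> \<in> tree \<kappa>" if "\<eta> \<in> tree natLeq" for \<eta>
  proof -
    obtain n where "dom \<eta> = {..<n}"
      using \<open>\<eta> \<in> _\<close> unfolding tree_def by (auto simp: Field_natLeq natLeq_underS_less lessThan_def)
    then have "dom (h \<eta>) = underS \<kappa> (g n)" unfolding dom gS by simp
    then show ?thesis using gF unfolding tree_def by blast
  qed
  have hle: "h \<eta> \<unlhd> h \<nu> \<longleftrightarrow> \<eta> \<unlhd> \<nu>" for \<eta> \<nu>
    unfolding map_le_def dom by (simp add: hg)
  have hinj: "h \<eta> = h \<nu> \<longleftrightarrow> \<eta> = \<nu>" for \<eta> \<nu>
    using hle map_le_antisym map_le_refl by metis
  have strict: "h \<eta> \<lhd> h \<nu> \<longleftrightarrow> \<eta> \<lhd> \<nu>" for \<eta> \<nu> unfolding strict_initseg_def hle hinj ..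
  \<comment> \<open>Moving positions along the initial embedding \<open>g\<close> keeps the values,
    so two sequences split at the image of their old splitting position; meets and lexicographic
    order follow.\<close>
  have spl: "split_at (h \<eta>) (h \<nu>) (g n)" if "nat.split_at \<eta> \<nu> n" for \<eta> \<nu> n
    using that gF unfolding split_at_def nat.split_at_def gS natLeq_underS_less by (auto simp: hg)
  have lex: "lex_less \<kappa> (h \<eta>) (h \<nu>)" and meet: "meet \<kappa> (h \<eta>) (h \<nu>) = h (meet natLeq \<eta> \<nu>)"
    if t: "\<eta> \<in> tree natLeq" "\<nu> \<in> tree natLeq" and l: "lex_less natLeq \<eta> \<nu>" for \<eta> \<nu>
  proof -
    obtain n where n: "nat.split_at \<eta> \<nu> n" using nat.ex_split t l nat.lex_irrefl by metis
    note s = spl[OF n] and ht2 = ht[OF t(1)] ht[OF t(2)]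
    show "lex_less \<kappa> (h \<eta>) (h \<nu>)"
      using l unfolding split_lex[OF ht2 s] nat.split_lex[OF t n] hg .
    show "meet \<kappa> (h \<eta>) (h \<nu>) = h (meet natLeq \<eta> \<nu>)"
      unfolding split_meet(1)[OF ht2 s] nat.split_meet(1)[OF t n]
    proof
      fix z
      show "(h \<eta> |` underS \<kappa> (g n)) z = h (\<eta> |` underS natLeq n) z"
      proof (cases "z \<in> range g")
        case True
        then obtain k where "z = g k" by blast
        then show ?thesis by (auto simp: hg restrict_map_def gS natLeq_underS_less ginj)
      qed (simp add: hn restrict_map_def)
    qed
  qed
  have "comb_seq N (\<lambda>t. h (e t)) (\<lambda>t. h (m t))" if c: "nat.comb_seq N e m" for N e m
    unfolding comb_seq_def
  proof (intro conjI allI impI)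
    fix t assume t: "t < N"
    show "h (e t) \<in> tree \<kappa>" using c ht t unfolding nat.comb_seq_def by blast
    fix s assume s: "s < t"
    then have *: "e s \<in> tree natLeq" "e t \<in> tree natLeq" "e s \<bottom> e t" "meet natLeq (e s) (e t) = m s"
      "lex_less natLeq (e t) (e s)" using c t unfolding nat.comb_seq_def by auto
    show "h (e s) \<bottom> h (e t)" using *(3) unfolding incomparable_def hle .
    show "meet \<kappa> (h (e s)) (h (e t)) = h (m s)"
      using meet[OF *(2,1,5)] *(4) meet_commute nat.meet_commute by metis
    show "lex_less \<kappa> (h (e t)) (h (e s))" by (rule lex[OF *(2,1,5)])
  next
    fix t s assume "Suc t < N" "s < t"
    then show "h (m s) \<lhd> h (m t)" using c strict unfolding nat.comb_seq_def by blast
  qed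
  then show thesis using that[of h] ht strict by blast
qed

end

section \<open>Ramsey's theorem for increasing maps\<close>

text \<open>The map \<open>\<rho>\<close> fixes an order of \<open>D\<close>. If it is injective on
  \<open>D\<close>, an increasing map lists a set of \<open>card D\<close> numbers in this order,
  which is how labelled tuples enter Ramsey's theorem.\<close>

definition increasing :: "('d \<Rightarrow> nat) \<Rightarrow> 'd set \<Rightarrow> ('d \<Rightarrow> nat) \<Rightarrow> bool" where
  "increasing \<rho> D x \<longleftrightarrow> (\<forall>d \<in> D. \<forall>d' \<in> D. \<rho> d < \<rho> d' \<longrightarrow> x d < x d')"

definition homogeneous :: "('d \<Rightarrow> nat) \<Rightarrow> 'd set \<Rightarrow> nat set \<Rightarrow> (('d \<Rightarrow> nat) \<Rightarrow> 'c) \<Rightarrow> bool" where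
  "homogeneous \<rho> D H col \<longleftrightarrow> (\<forall>x y. increasing \<rho> D x \<and> increasing \<rho> D y \<and>
     x ` D \<subseteq> H \<and> y ` D \<subseteq> H \<longrightarrow> col x = col y)"

lemma homogeneous_mono: "homogeneous \<rho> D H col \<Longrightarrow> H' \<subseteq> H \<Longrightarrow> homogeneous \<rho> D H' col"
  unfolding homogeneous_def by (meson subset_trans)

lemma sorted_list_of_set_rank:
  fixes Y :: "nat set"
  assumes "finite Y" "y \<in> Y"
  shows "sorted_list_of_set Y ! card {y' \<in> Y. y' < y} = y"
proof -
  define l where "l = sorted_list_of_set Y"
  have l: "set l = Y" "sorted_wrt (<) l" "distinct l" using assms(1) unfolding l_def by auto
  then obtain k where k: "k < length l" "l ! k = y" using assms(2) by (metis in_set_conv_nth)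
  have "{y' \<in> Y. y' < y} = (!) l ` {..<k}"
  proof
    show "{y' \<in> Y. y' < y} \<subseteq> (!) l ` {..<k}"
    proof
      fix y' assume y': "y' \<in> {y' \<in> Y. y' < y}"
      then obtain i where i: "i < length l" "l ! i = y'" using l by (metis (mono_tags, lifting) in_set_conv_nth mem_Collect_eq)
      have "i < k"
      proof (rule ccontr)
        assume "\<not> i < k"
        then have "l ! k \<le> l ! i" using sorted_wrt_nth_less[OF l(2), of k i] i by (cases "i = k") auto
        then show False using k i y' by simp
      qed
      then show "y' \<in> (!) l ` {..<k}" using i by blast
    qed
    show "(!) l ` {..<k} \<subseteq> {y' \<in> Y. y' < y}"
      using l(1) k sorted_wrt_nth_less[OF l(2), of _ k] nth_mem[of _ l] by (auto dest: less_trans)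
  qed
  moreover have "inj_on ((!) l) {..<k}" using l(3) k by (auto simp: inj_on_def nth_eq_iff_index_eq)
  ultimately have "card {y' \<in> Y. y' < y} = k" by (simp add: card_image)
  then show ?thesis using k unfolding l_def by simp
qed

text \<open>On \<open>D\<close>, an increasing map is determined by its set of values,
  \<open>rk d\<close> being the place of \<open>x d\<close> in the sorted list. Colouring such maps
  thus means colouring sets of size \<open>card D\<close>.\<close>

lemma Ramsey_increasing:
  fixes col :: "('d \<Rightarrow> nat) \<Rightarrow> 'c" and Z :: "nat set"
  assumes "finite D" "inj_on \<rho> D" "finite C" "\<And>x. col x \<in> C" "infinite Z"
    and supp: "\<And>x y. (\<And>d. d \<in> D \<Longrightarrow> x d = y d) \<Longrightarrow> col x = col y"
  obtains H where "H \<subseteq> Z" "infinite H" "homogeneous \<rho> D H col"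
proof -
  obtain code :: "'c \<Rightarrow> nat" and s where code: "inj_on code C" "code ` C = {..<s}"
    using finite_imp_inj_to_nat_seg[OF assms(3)] by (metis lessThan_def)
  define rk where "rk d = card {d' \<in> D. \<rho> d' < \<rho> d}" for d
  define f where "f Y = code (col (\<lambda>d. sorted_list_of_set Y ! rk d))" for Y
  have "\<forall>X. X \<subseteq> Z \<and> finite X \<and> card X = card D \<longrightarrow> f X < s"
    unfolding f_def using code assms(4) by blast
  from Ramsey[OF assms(5) this] obtain H t where H: "H \<subseteq> Z" "infinite H"
    and "\<forall>X. X \<subseteq> H \<and> finite X \<and> card X = card D \<longrightarrow> f X = t" by (elim exE conjE)
  then have Ht: "f X = t" if "X \<subseteq> H" "finite X" "card X = card D" for X using that by simp
  have "code (col x) = t" if x: "increasing \<rho> D x" "x ` D \<subseteq> H" for x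
  proof -
    have lt: "x d < x d' \<longleftrightarrow> \<rho> d < \<rho> d'" if "d \<in> D" "d' \<in> D" for d d'
    proof -
      have "\<rho> d = \<rho> d' \<longleftrightarrow> d = d'" using assms(2) that unfolding inj_on_def by blast
      then show ?thesis using x(1) that unfolding increasing_def by (metis nat_neq_iff not_less_iff_gr_or_eq)
    qed
    have inj: "inj_on x D"
      using lt assms(2) unfolding inj_on_def by (metis nat_neq_iff)
    have "sorted_list_of_set (x ` D) ! rk d = x d" if d: "d \<in> D" for d
    proof -
      have "{y \<in> x ` D. y < x d} = x ` {d' \<in> D. \<rho> d' < \<rho> d}" using lt d by auto
      moreover have "inj_on x {d' \<in> D. \<rho> d' < \<rho> d}" using inj by (rule inj_on_subset) blast
      ultimately have "card {y \<in> x ` D. y < x d} = rk d" unfolding rk_def by (simp add: card_image)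
      then show ?thesis using sorted_list_of_set_rank[of "x ` D" "x d"] assms(1) d by auto
    qed
    then have "f (x ` D) = code (col x)" unfolding f_def by (metis supp)
    then show ?thesis using Ht[of "x ` D"] x(2) assms(1) card_image[OF inj] by simp
  qed
  then have "homogeneous \<rho> D H col"
    using code(1) assms(4) unfolding homogeneous_def inj_on_def by metis
  then show thesis using that[OF H(1,2)] by blast
qed

lemma Ramsey_increasing_finite:
  fixes col :: "'q \<Rightarrow> ('d \<Rightarrow> nat) \<Rightarrow> 'c" and Z :: "nat set"
  assumes "finite Q" "infinite Z" "finite C" "\<And>q x. q \<in> Q \<Longrightarrow> col q x \<in> C"
    and "\<And>q. q \<in> Q \<Longrightarrow> finite (D q)" "\<And>q. q \<in> Q \<Longrightarrow> inj_on (\<rho> q) (D q)"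
    and "\<And>q x y. q \<in> Q \<Longrightarrow> (\<And>d. d \<in> D q \<Longrightarrow> x d = y d) \<Longrightarrow> col q x = col q y"
  shows "\<exists>H \<subseteq> Z. infinite H \<and> (\<forall>q \<in> Q. homogeneous (\<rho> q) (D q) H (col q))"
  using assms(1,4-)
proof (induction Q)
  case empty
  then show ?case using assms(2) by blast
next
  case (insert q Q)
  have "\<exists>H \<subseteq> Z. infinite H \<and> (\<forall>q \<in> Q. homogeneous (\<rho> q) (D q) H (col q))"
  proof (rule insert.IH)
    fix q' assume "q' \<in> Q"
    then have q': "q' \<in> insert q Q" by blast
    show "col q' x \<in> C" for x by (rule insert.prems(1)[OF q'])
    show "finite (D q')" by (rule insert.prems(2)[OF q'])
    show "inj_on (\<rho> q') (D q')" by (rule insert.prems(3)[OF q'])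
    show "col q' x = col q' y" if "\<And>d. d \<in> D q' \<Longrightarrow> x d = y d" for x y
      using q' that by (rule insert.prems(4))
  qed
  then obtain H where H: "H \<subseteq> Z" "infinite H" "\<And>q. q \<in> Q \<Longrightarrow> homogeneous (\<rho> q) (D q) H (col q)"
    by blast
  have q: "q \<in> insert q Q" by blast
  obtain H' where H': "H' \<subseteq> H" "infinite H'" "homogeneous (\<rho> q) (D q) H' (col q)"
  proof (rule Ramsey_increasing[of "D q" "\<rho> q" C "col q" H])
    show "col q x = col q y" if "\<And>d. d \<in> D q \<Longrightarrow> x d = y d" for x y
      using q that by (rule insert.prems(4))
    show "finite (D q)" by (rule insert.prems(2)[OF q])
    show "inj_on (\<rho> q) (D q)" by (rule insert.prems(3)[OF q])
    show "finite C" by (rule assms(3))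
    show "col q x \<in> C" for x by (rule insert.prems(1)[OF q])
    show "infinite H" by (rule H(2))
  qed
  have "homogeneous (\<rho> q') (D q') H' (col q')" if "q' \<in> insert q Q" for q'
    using that H'(1,3) H(3) homogeneous_mono[OF _ H'(1)] by blast
  then show ?case using H(1) H'(1,2) by (intro exI[of _ H']) blast
qed

lemma finite_ordLeq_infinite: "finite A \<Longrightarrow> infinite X \<Longrightarrow> |A| \<le>o |X|"
  using card_of_ordLeq_finite card_of_Well_order ordLeq_total by metis

section \<open>Cardinality\<close>

lemma card_of_lists_ordLeq:
  assumes "infinite X" "|I| \<le>o |X|"
  shows "|{xs. set xs \<subseteq> I}| \<le>o |X|"
proof -
  let ?L = "\<lambda>k. {xs. set xs \<subseteq> I \<and> length xs = k}"
  have L: "|?L k| \<le>o |X|" for k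
  proof (induction k)
    case 0
    have "?L 0 = {[]}" by auto
    then have "finite (?L 0)" by simp
    then show ?case using finite_ordLeq_infinite[OF _ assms(1)] by blast
  next
    case (Suc k)
    have "?L (Suc k) \<subseteq> (\<lambda>(x, xs). x # xs) ` (I \<times> ?L k)"
      by (auto simp: length_Suc_conv)
    then have "|?L (Suc k)| \<le>o |I \<times> ?L k|" using surj_imp_ordLeq by blast
    also have "|I \<times> ?L k| \<le>o |X|"
      using assms Suc by (intro card_of_Times_ordLeq_infinite_Field card_of_Card_order) (simp_all add: Field_card_of)
    finally show ?case .
  qed
  have "{xs. set xs \<subseteq> I} = (\<Union>k \<in> UNIV :: nat set. ?L k)" by auto
  moreover have "|UNIV :: nat set| \<le>o |X|" using assms(1) by (simp add: infinite_iff_card_of_nat)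
  ultimately show ?thesis
    using card_of_UNION_ordLeq_infinite[OF assms(1), of "UNIV :: nat set" ?L] L by simp
qed

text \<open>Otherwise \<open>A\<close> would be a union of at most |X| finite sets. An infinite
  fibre is all that is wanted, since only finite combs of teeth will be drawn from it.\<close>

lemma ex_infinite_fibre:
  assumes "infinite X" "f ` A \<subseteq> B" "|B| \<le>o |X|" "\<not> |A| \<le>o |X|"
  obtains p where "infinite {x \<in> A. f x = p}"
proof (rule ccontr)
  assume "\<not> thesis"
  then have fin: "finite {x \<in> A. f x = p}" for p using that by blast
  have "|{x \<in> A. f x = p}| \<le>o |X|" for p
    by (rule finite_ordLeq_infinite[OF fin assms(1)])
  then have "|\<Union>p \<in> B. {x \<in> A. f x = p}| \<le>o |X|"
    by (intro card_of_UNION_ordLeq_infinite[OF assms(1,3)] ballI)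
  moreover have "(\<Union>p \<in> B. {x \<in> A. f x = p}) = A" using assms(2) by auto
  ultimately show False using assms(4) by simp
qed

text \<open>A complete theory contains, up to a negation, the existential closure of every formula, and a
  formula \<open>\<phi>\<close> can be read off the closure of \<open>\<phi> \<and> \<phi>\<close>.\<close>

fun strip_ex :: "('f, 'r) fm \<Rightarrow> ('f, 'r) fm" where
  "strip_ex (Ex v \<phi>) = strip_ex \<phi>"
| "strip_ex (Neg \<phi>) = strip_ex \<phi>"
| "strip_ex (Conj \<phi> \<psi>) = \<phi>"
| "strip_ex \<phi> = \<phi>"

lemma card_formulas:
  fixes T :: "('f, 'r) fm set"
  assumes "complete_theory L T"
  shows "|{\<phi>. wf_fm L \<phi>}| \<le>o |T|"
proof -
  have "{\<phi>. wf_fm L \<phi>} \<subseteq> strip_ex ` T"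
  proof
    fix \<phi> :: "('f, 'r) fm" assume "\<phi> \<in> {\<phi>. wf_fm L \<phi>}"
    then have \<phi>: "wf_fm L \<phi>" by simp
    have "\<exists>\<psi>. wf_fm L \<psi> \<and> fv \<psi> = fv \<phi> - W \<and> strip_ex \<psi> = \<phi>" if "finite W" for W
      using that
    proof (induction W)
      case empty
      then show ?case using \<phi> by (intro exI[of _ "Conj \<phi> \<phi>"]) simp
    next
      case (insert w W)
      then obtain \<psi> where "wf_fm L \<psi> \<and> fv \<psi> = fv \<phi> - W \<and> strip_ex \<psi> = \<phi>" by blast
      then show ?case by (intro exI[of _ "Ex w \<psi>"]) auto
    qed
    from this[OF finite_fv[of \<phi>]] obtain \<psi> where \<psi>: "wf_fm L \<psi>" "fv \<psi> = {}" "strip_ex \<psi> = \<phi>" by auto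
    then have "\<psi> \<in> fms L 0" unfolding fms_def by simp
    then have "\<psi> \<in> T \<or> Neg \<psi> \<in> T" using assms unfolding complete_theory_def by blast
    moreover have "strip_ex (Neg \<psi>) = \<phi>" using \<psi>(3) by simp
    ultimately show "\<phi> \<in> strip_ex ` T" using \<psi>(3) by (metis image_eqI)
  qed
  then show ?thesis using surj_imp_ordLeq by blast
qed

lemma infinite_complete_theory:
  fixes T :: "('f, 'r) fm set"
  assumes "complete_theory L T"
  shows "infinite T"
proof
  assume "finite T"
  then have "finite {\<phi>. wf_fm L \<phi>}" using card_formulas[OF assms] card_of_ordLeq_finite by blast
  moreover have "range (\<lambda>n. Eq (Var n) (Var n)) \<subseteq> {\<phi>. wf_fm L \<phi>}" by auto
  ultimately have "finite (range (\<lambda>n. Eq (Var n) (Var n) :: ('f, 'r) fm))" using finite_subset by blast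
  moreover have "inj (\<lambda>n. Eq (Var n) (Var n) :: ('f, 'r) fm)" by (auto simp: inj_def)
  ultimately show False using finite_imageD by blast
qed

lemma card_of_Pow_ordLeq:
  assumes "|A| \<le>o |B|" shows "|Pow A| \<le>o |Pow B|"
proof -
  obtain f where f: "inj_on f A" "f ` A \<subseteq> B" using assms unfolding card_of_ordLeq[symmetric] by blast
  have "inj_on ((`) f) (Pow A)" using f(1) by (rule inj_on_image_Pow)
  moreover have "(`) f ` Pow A \<subseteq> Pow B" using f(2) by auto
  ultimately show ?thesis unfolding card_of_ordLeq[symmetric] by blast
qed

lemma ctwo_cexp_Pow: "ctwo ^c |X| =o |Pow X|"
  unfolding ctwo_def cexp_def Field_card_of by (rule ordIso_symmetric[OF card_of_Pow_Func])

context infinite_cardinal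
begin

lemma ex_increasing_enumeration:
  assumes "finite Z" "Z \<subseteq> Field \<kappa>"
  obtains i where "Z = i ` {..<card Z}" "\<And>s t. s < t \<Longrightarrow> t < card Z \<Longrightarrow> i s \<in> underS \<kappa> (i t)"
proof -
  have max: "\<exists>m \<in> Z. \<forall>x \<in> Z. x = m \<or> x \<in> underS \<kappa> m" if "finite Z" "Z \<noteq> {}" "Z \<subseteq> Field \<kappa>" for Z
    using that
  proof (induction Z rule: finite_ne_induct)
    case (insert z Z)
    then obtain m where m: "m \<in> Z" "\<forall>x \<in> Z. x = m \<or> x \<in> underS \<kappa> m" by auto
    show ?case
    proof (cases "z \<in> underS \<kappa> m")
      case True
      then show ?thesis using m by (intro bexI[of _ m]) auto
    next
      case False
      then have "m \<in> underS \<kappa> z \<or> z = m" using below_total[of z m] m insert.prems by auto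
      then show ?thesis using m below_trans[of _ m z] by (intro bexI[of _ z]) auto
    qed
  qed simp
  have "\<exists>i. Z = i ` {..<card Z} \<and> (\<forall>s t. s < t \<longrightarrow> t < card Z \<longrightarrow> i s \<in> underS \<kappa> (i t))"
    using assms
  proof (induction "card Z" arbitrary: Z)
    case 0
    then show ?case by simp
  next
    case (Suc N)
    then have "Z \<noteq> {}" by auto
    then obtain m where m: "m \<in> Z" "\<forall>x \<in> Z. x = m \<or> x \<in> underS \<kappa> m" using max Suc.prems by blast
    have cN: "card (Z - {m}) = N" using Suc.hyps(2) m Suc.prems by simp
    have "N = card (Z - {m})" "finite (Z - {m})" "Z - {m} \<subseteq> Field \<kappa>" using cN Suc.prems by auto
    from Suc.hyps(1)[OF this] obtain i
      where i: "Z - {m} = i ` {..<N}" "\<And>s t. s < t \<Longrightarrow> t < N \<Longrightarrow> i s \<in> underS \<kappa> (i t)"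
      unfolding cN by blast
    let ?i = "i(N := m)"
    have "?i ` {..<Suc N} = insert m (i ` {..<N})" by (auto simp: lessThan_Suc)
    then have "Z = ?i ` {..<card Z}" using i(1) m(1) Suc.hyps(2) by (metis insert_Diff)
    moreover have "?i s \<in> underS \<kappa> (?i t)" if "s < t" "t < card Z" for s t
    proof (cases "t = N")
      case True
      then have "i s \<in> Z - {m}" using i(1) that by auto
      then show ?thesis using True m(2) that by auto
    next
      case False
      then show ?thesis using i(2)[of s t] that Suc.hyps(2) by simp
    qed
    ultimately show ?case by blast
  qed
  then show thesis using that by blast
qed

lemma ex_omega_sequence:
  obtains g :: "nat \<Rightarrow> 'k" where "\<And>n. g n \<in> Field \<kappa>" "\<And>n k. n < k \<Longrightarrow> g n \<in> underS \<kappa> (g k)"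
proof -
  have "natLeq \<le>o \<kappa>"
    using infinite_iff_natLeq_ordLeq inf card_of_Field_ordIso[OF card] ordLeq_ordIso_trans by blast
  then obtain g where g: "embed natLeq \<kappa> g" unfolding ordLeq_def by blast
  have "g n \<in> Field \<kappa>" for n using embed_in_Field[OF g] by (simp add: Field_natLeq)
  moreover have "g n \<in> underS \<kappa> (g k)" if "n < k" for n k
    using embed_underS[OF natLeq_Well_order g, of k] natLeq_underS_less[of k] that
    by (auto simp: Field_natLeq bij_betw_def)
  ultimately show thesis by (rule that)
qed

end

section \<open>Solutions along indiscernible families\<close>

text \<open>Solvability of a finite system in the parameters \<open>A t\<close> is a formula about
  their concatenation. The variables \<open>Inl l\<close> stand for the solution and
  \<open>Inr (t, l)\<close> for the entries of the tuple at \<open>t\<close>.\<close>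

lemma same_type_solution:
  fixes A B :: "'t \<Rightarrow> 'a list"
  assumes same: "same_type L M (concat (map A ts)) (concat (map B ts))"
    and len': "\<forall>t \<in> set ts. length (A t) = n" "\<forall>t \<in> set ts. length (B t) = n"
    and \<phi>: "\<phi> \<in> fms L (m + n)" and xs: "length xs = m" "\<forall>t \<in> set ts. sat_at M (xs @ A t) \<phi>"
  shows "\<exists>ys. length ys = m \<and> (\<forall>t \<in> set ts. sat_at M (ys @ B t) \<phi>)"
proof -
  let ?y = "\<lambda>t. map (\<lambda>l. Inr (t, l) :: nat + 't \<times> nat) [0..<n]"
  have len: "\<And>t. t \<in> set ts \<Longrightarrow> length (A t) = n" "\<And>t. t \<in> set ts \<Longrightarrow> length (B t) = n"
    using len' by auto
  let ?x = "map Inl [0..<m] :: (nat + 't \<times> nat) list"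
  let ?vs = "concat (map ?y ts)"
  let ?R = "\<lambda>e. \<forall>t \<in> set ts. sat_at M (map e (?x @ ?y t)) \<phi>"
  have def: "definable L M UNIV ?R"
    by (intro definable_ball definable_sat_at) (use \<phi> in auto)
  let ?e = "\<lambda>C. case_sum (\<lambda>l. xs ! l) (\<lambda>(t, l). C t ! l)"
  have e: "map (?e C) ?vs = concat (map C ts)" "\<And>t. t \<in> set ts \<Longrightarrow> map (?e C) (?y t) = C t"
    if "\<And>t. t \<in> set ts \<Longrightarrow> length (C t) = n" for C
  proof -
    have 1: "map (?e C) (?y t) = C t" if "t \<in> set ts" for t
      by (rule nth_equalityI) (use \<open>\<And>t. t \<in> set ts \<Longrightarrow> length (C t) = n\<close> that in auto)
    then show "\<And>t. t \<in> set ts \<Longrightarrow> map (?e C) (?y t) = C t" .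
    have "map (?e C) ?vs = concat (map (\<lambda>t. map (?e C) (?y t)) ts)" by (simp add: map_concat o_def)
    also have "\<dots> = concat (map C ts)" by (metis (no_types, lifting) 1 map_cong)
    finally show "map (?e C) ?vs = concat (map C ts)" .
  qed
  have st: "same_type L M (map (?e A) ?vs) (map (?e B) ?vs)"
  proof -
    have "map (?e A) ?vs = concat (map A ts)" "map (?e B) ?vs = concat (map B ts)"
      by (rule e(1), rule len, assumption)+
    then show ?thesis using same by (simp only:)
  qed
  have x: "map (?e C) ?x = xs" for C by (rule nth_equalityI) (use xs in auto)
  have "?R (?e A)"
    unfolding map_append x using xs(2) e(2)[of A, OF len(1)] by simp
  then have "\<exists>e1. (\<forall>v \<in> set ?vs. e1 v = ?e A v) \<and> ?R e1" by blast
  then obtain e1 where e1: "\<forall>v \<in> set ?vs. e1 v = ?e B v" "?R e1"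
    unfolding same_type_definable_ex[OF st def] by blast
  show ?thesis
  proof (intro exI[of _ "map e1 ?x"] conjI ballI)
    show "length (map e1 ?x) = m" by simp
    fix t assume t: "t \<in> set ts"
    have "map e1 (?y t) = map (?e B) (?y t)" using e1(1) t by (intro map_cong) auto
    also have "\<dots> = B t" using e(2)[of B, OF len(2)] t by blast
    finally show "sat_at M (map e1 ?x @ B t) \<phi>" using e1(2) t by (simp only: map_append) metis
  qed
qed

lemma finite_consistent_iff:
  assumes "finite p"
  shows "consistent M m p \<longleftrightarrow> (\<exists>xs. length xs = m \<and> realizes M xs p)"
proof
  assume "consistent M m p"
  then show "\<exists>xs. length xs = m \<and> realizes M xs p" using assms unfolding consistent_def by blast
next
  assume "\<exists>xs. length xs = m \<and> realizes M xs p"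
  then obtain xs where "length xs = m" "realizes M xs p" by blast
  moreover have "realizes M xs q" if "q \<subseteq> p" for q
    using \<open>realizes M xs p\<close> that unfolding realizes_def by auto
  ultimately show "consistent M m p" unfolding consistent_def by blast
qed

lemma branch_restrict_chain:
  "branch_restrict \<eta> i \<in> tree natLeq" "i < j \<Longrightarrow> branch_restrict \<eta> i \<lhd> branch_restrict \<eta> j"
proof -
  have d: "dom (branch_restrict \<eta> i) = {..<i}" for i
    unfolding branch_restrict_def by (auto split: if_splits)
  then show "branch_restrict \<eta> i \<in> tree natLeq"
    unfolding tree_def Field_natLeq natLeq_underS_less lessThan_def by blast
  assume "i < j"
  moreover have "branch_restrict \<eta> i \<noteq> branch_restrict \<eta> j"
    using d[of i] d[of j] \<open>i < j\<close> by (metis lessThan_iff less_irrefl)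
  ultimately show "branch_restrict \<eta> i \<lhd> branch_restrict \<eta> j"
    unfolding strict_initseg_def map_le_def d by (auto simp: branch_restrict_def)
qed

context infinite_cardinal
begin

text \<open>The tree is pulled back to finite sequences along \<open>h\<close>. A finite comb there
  has the type of equally many teeth with indices in \<open>F\<close>, where \<open>xs\<close> is a
  solution; \<open>N\<close> nodes of a branch have the type of the inconsistent chain
  \<open>s\<close>. So \<open>N\<close> serves as the number k of CTP.\<close>

lemma CTP_of_inconsistent_chain:
  assumes si: "strongly_indiscernible L M \<kappa> a" and len: "\<And>\<eta>. \<eta> \<in> tree \<kappa> \<Longrightarrow> length (a \<eta>) = n"
    and \<phi>: "\<phi> \<in> fms L (m + n)"
    and F: "infinite F" "F \<subseteq> Field \<kappa>"
    and xs: "length xs = m" "\<And>i. i \<in> F \<Longrightarrow> sat_at M (xs @ a (tooth i)) \<phi>"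
    and s: "\<And>t. t < (N :: nat) \<Longrightarrow> s t \<in> tree \<kappa>" "\<And>t u. t < u \<Longrightarrow> u < N \<Longrightarrow> s t \<lhd> s u"
    and incons: "\<And>ys. length ys = m \<Longrightarrow> (\<And>t. t < N \<Longrightarrow> sat_at M (ys @ a (s t)) \<phi>) \<Longrightarrow> False"
  shows "CTP L M"
proof -
  obtain h where h: "\<And>\<eta>. \<eta> \<in> tree natLeq \<Longrightarrow> h \<eta> \<in> tree \<kappa>"
    "\<And>\<eta> \<nu>. \<eta> \<lhd> \<nu> \<Longrightarrow> h \<eta> \<lhd> h \<nu>"
    "\<And>N e m. nat.comb_seq N e m \<Longrightarrow> comb_seq N (\<lambda>t. h (e t)) (\<lambda>t. h (m t))"
    by (rule ex_tree_embedding) (rule that)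
  have "consistent M m {(\<phi>, a (h \<eta>)) | \<eta>. \<eta> \<in> X}" if X: "descending_comb X" for X
    unfolding consistent_def
  proof (intro allI impI, elim conjE)
    fix q assume q: "q \<subseteq> {(\<phi>, a (h \<eta>)) | \<eta>. \<eta> \<in> X}" "finite q"
    then have "q \<subseteq> (\<lambda>\<eta>. (\<phi>, a (h \<eta>))) ` X" by blast
    from finite_subset_image[OF q(2) this] obtain Y
      where Y: "Y \<subseteq> X" "finite Y" "q = (\<lambda>\<eta>. (\<phi>, a (h \<eta>))) ` Y" by blast
    obtain e m' where e: "Y = e ` {..<card Y}" "nat.comb_seq (card Y) e m'"
      using descending_comb_seq[OF X Y(2,1)] by blast
    obtain Z where Z: "Z \<subseteq> F" "finite Z" "card Z = card Y"
      using F(1) infinite_arbitrarily_large by blast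
    obtain i where i: "Z = i ` {..<card Z}" "\<And>s t. s < t \<Longrightarrow> t < card Z \<Longrightarrow> i s \<in> underS \<kappa> (i t)"
      by (rule ex_increasing_enumeration[of Z]) (use Z F that in auto)
    have iF: "i t \<in> F" if "t < card Y" for t using i(1) Z that by auto
    have "comb_seq (card Y) (\<lambda>t. tooth (i t)) (\<lambda>t. zeros \<kappa> (i t))"
      by (rule comb_seq_teeth) (use i(2) Z(3) iF F(2) in auto)
    note tab = tree_table_comb[OF this] tree_table_comb[OF h(3)[OF e(2)]]
    let ?ts = "[0..<card Y]"
    have sub: "set (map (\<lambda>t. (t, True)) ?ts) \<subseteq> comb_index (card Y)" unfolding comb_index_def by auto
    have same: "same_type L M (concat (map (\<lambda>t. a (tooth (i t))) ?ts)) (concat (map (\<lambda>t. a (h (e t))) ?ts))"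
      using strongly_indiscernible_table[OF si tab sub] by (simp add: o_def)
    have 1: "\<forall>t \<in> set ?ts. length (a (tooth (i t))) = n"
      using len tooth_tree iF F(2) by (simp add: subset_iff)
    have 2: "\<forall>t \<in> set ?ts. length (a (h (e t))) = n"
      using e(2) len h(1) unfolding nat.comb_seq_def by simp
    have 3: "\<forall>t \<in> set ?ts. sat_at M (xs @ a (tooth (i t))) \<phi>"
      using xs(2) iF by simp
    obtain ys where "length ys = m" "\<forall>t \<in> set ?ts. sat_at M (ys @ a (h (e t))) \<phi>"
      using same_type_solution[OF same 1 2 \<phi> xs(1) 3] by (elim exE conjE)
    moreover from this have "realizes M ys q"
      unfolding realizes_def Y(3) by (subst e(1)) auto
    ultimately show "\<exists>xs. length xs = m \<and> realizes M xs q" by blast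
  qed
  moreover have "k_inconsistent M m N (\<lambda>i::nat. (\<phi>, a (h (branch_restrict \<eta> i))))" for \<eta>
    unfolding k_inconsistent_def
  proof (intro allI impI notI, elim conjE)
    fix J :: "nat set" assume J: "finite J" "card J = N"
      and c: "consistent M m ((\<lambda>i. (\<phi>, a (h (branch_restrict \<eta> i)))) ` J)"
    obtain xs where xs: "length xs = m" "realizes M xs ((\<lambda>i. (\<phi>, a (h (branch_restrict \<eta> i)))) ` J)"
      using c finite_consistent_iff J(1) by blast
    define l where "l = sorted_list_of_set J"
    have l: "length l = N" "set l = J" "\<And>s t. s < t \<Longrightarrow> t < N \<Longrightarrow> l ! s < l ! t"
      using J sorted_wrt_nth_less[OF strict_sorted_list_of_set[of J]] unfolding l_def by auto
    let ?s = "\<lambda>t. h (branch_restrict \<eta> (l ! t))"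
    have tab: "tree_table {..<N} min (<) ?s"
      by (rule tree_table_chain) (use h(1,2) branch_restrict_chain l(3) in blast)+
    have tab': "tree_table {..<N} min (<) s"
      by (rule tree_table_chain) (use s in blast)+
    let ?ts = "[0..<N]"
    have same: "same_type L M (concat (map (\<lambda>t. a (?s t)) ?ts)) (concat (map (\<lambda>t. a (s t)) ?ts))"
      by (rule strongly_indiscernible_table[OF si tab tab']) auto
    have 1: "\<forall>t \<in> set ?ts. length (a (?s t)) = n" using len h(1) branch_restrict_chain(1) by blast
    have 2: "\<forall>t \<in> set ?ts. length (a (s t)) = n" using len s(1) by simp
    have 3: "\<forall>t \<in> set ?ts. sat_at M (xs @ a (?s t)) \<phi>"
    proof
      fix t assume "t \<in> set ?ts"
      then have "l ! t \<in> J" using l(1,2) nth_mem[of t l] by simp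
      then show "sat_at M (xs @ a (?s t)) \<phi>" using xs(2) unfolding realizes_def by auto
    qed
    obtain ys where "length ys = m" "\<forall>t \<in> set ?ts. sat_at M (ys @ a (s t)) \<phi>"
      using same_type_solution[OF same 1 2 \<phi> xs(1) 3] by (elim exE conjE)
    then show False by (intro incons[of ys]) simp_all
  qed
  moreover have "\<forall>\<eta> \<in> tree natLeq. length (a (h \<eta>)) = n" using len h(1) by blast
  ultimately show ?thesis
    unfolding CTP_def using \<phi>
    by (intro exI[of _ m] exI[of _ n] exI[of _ \<phi>] exI[of _ "\<lambda>\<eta>. a (h \<eta>)"] exI[of _ N]) blast
qed


section \<open>From NCTP to indiscernibility\<close>

text \<open>The parameter \<open>b\<close> may be an infinite family, so its type is a set of pairs
  of a formula and a finite list of indices. Saturation enters twice: for a realization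
  \<open>u\<close> of this type along the whole path, and for the final \<open>b'\<close>, whose
  finite approximations are built from \<open>u\<close>.\<close>

theorem indiscernible_realization:
  fixes L :: "('f, 'r) lang" and T :: "('f, 'r) fm set"
    and M :: "('f, 'r, 'a) struct" and \<mu> :: "'k rel" and b :: "'k \<Rightarrow> 'a"
  assumes T: "complete_theory L T" and sat: "saturated L M \<mu>" and nctp: "NCTP L M"
    and \<mu>: "\<kappa> <o \<mu>" and big: "ctwo ^c ( |T| +c |I| +c natLeq) <o \<kappa>"
    and si: "strongly_indiscernible L M \<kappa> a"
  shows "\<exists>b'. \<exists>i \<in> Field \<kappa>. same_type_over_inf L M (set (a (tooth i))) I b' b \<and>
    indiscernible_over L M (b' ` I) \<kappa> (\<lambda>j. a (tooth_path i j))"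
proof -
  obtain n where len: "\<And>\<eta>. \<eta> \<in> tree \<kappa> \<Longrightarrow> length (a \<eta>) = n"
    using si unfolding strongly_indiscernible_def by blast
  \<comment> \<open>\<open>X\<close> bounds the number of formulas with finite lists of indices, so
    at most 2^|X| types of \<open>b\<close> together with a tooth can occur.\<close>
  define X where "X = T <+> I <+> (UNIV :: nat set)"
  have csum: "|T| +c |I| +c natLeq = |X|"
    unfolding csum_def Field_card_of Field_natLeq X_def ..
  have infX: "infinite X" unfolding X_def by simp
  have TX: "|T| \<le>o |X|" unfolding X_def by (rule card_of_Plus1)
  have IX: "|I| \<le>o |X|"
    unfolding X_def by (rule ordLeq_transitive[OF card_of_Plus1 card_of_Plus2])
  define S where "S = {\<phi>. wf_fm L \<phi>} \<times> {is. set is \<subseteq> I}"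
  have "|S| \<le>o |X|"
    unfolding S_def
    using card_of_Times_ordLeq_infinite_Field[of "|X|"] infX card_of_Card_order
      ordLeq_transitive[OF card_formulas[OF T] TX] card_of_lists_ordLeq[OF infX IX] Field_card_of
    by metis
  then have "|Pow S| \<le>o |Pow X|" by (rule card_of_Pow_ordLeq)
  have PX: "|Pow X| <o \<kappa>"
    using ordIso_ordLess_trans[OF ordIso_symmetric[OF ctwo_cexp_Pow]] big unfolding csum by blast
  define tp where "tp i = {(\<phi>, is). set is \<subseteq> I \<and> \<phi> \<in> fms L (length is + n) \<and>
    sat_at M (map b is @ a (tooth i)) \<phi>}" for i
  have "tp ` Field \<kappa> \<subseteq> Pow S" unfolding tp_def S_def fms_def by auto
  moreover have "\<not> |Field \<kappa>| \<le>o |Pow X|"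
    using PX card_of_Field_ordIso[OF card] not_ordLess_ordLeq ordIso_ordLeq_trans ordIso_symmetric by metis
  moreover have "infinite (Pow X)" using infX by simp
  ultimately obtain p where fib: "infinite {i \<in> Field \<kappa>. tp i = p}"
    using ex_infinite_fibre[of "Pow X" tp "Field \<kappa>" "Pow S"] \<open>|Pow S| \<le>o |Pow X|\<close> by metis
  \<comment> \<open>The path is taken above a tooth whose type with \<open>b\<close> is
    \<open>p\<close>; realizing \<open>p\<close> at this tooth then means having the type of
    \<open>b\<close> over it.\<close>
  then obtain i0 where i0: "i0 \<in> Field \<kappa>" "tp i0 = p" using infinite_imp_nonempty by blast
  define c where "c j = a (tooth_path i0 j)" for j
  have lc: "length (c j) = n" if "j \<in> Field \<kappa>" for j
    unfolding c_def by (rule len[OF tooth_path(1)[OF i0(1) that]])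
  have pI: "set is \<subseteq> I" "\<phi> \<in> fms L (length is + n)" if "(\<phi>, is) \<in> p" for \<phi> "is"
    using that i0(2) unfolding tp_def by auto
  \<comment> \<open>The finite set \<open>A\<close> is merged into one formula \<phi> in the
    coordinates \<open>vs\<close> of \<open>b\<close> that it mentions. Since \<open>b\<close>
    satisfies \<phi> at infinitely many teeth, \<phi> would witness CTP if it had no solution along
    the path.\<close>
  have finite_solution: "\<exists>u. \<forall>(\<phi>, is) \<in> A. \<forall>j \<in> Z. sat_at M (map u is @ c j) \<phi>"
    if A: "finite A" "A \<subseteq> p" and Z: "finite Z" "Z \<subseteq> Field \<kappa>" for A Z
  proof -
    have "finite (\<Union>q \<in> A. set (snd q))" using A(1) by simp
    from finite_distinct_list[OF this] obtain vs
      where vs: "set vs = (\<Union>q \<in> A. set (snd q))" "distinct vs" by (elim exE conjE)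
    let ?y = "map Inr [0..<n] :: ('k + nat) list" and ?x = "map Inl vs :: ('k + nat) list"
    let ?R = "\<lambda>e. \<forall>q \<in> A. sat_at M (map e (map Inl (snd q) @ ?y)) (fst q)"
    have "definable L M (set (?x @ ?y)) ?R"
    proof (intro definable_ball definable_sat_at)
      fix q assume q: "q \<in> A"
      then show "fst q \<in> fms L (length (map Inl (snd q) @ ?y))" using pI(2)[of "fst q" "snd q"] A(2) by auto
      show "set (map Inl (snd q) @ ?y) \<subseteq> set (?x @ ?y)" using q vs(1) by (force simp: image_iff)
    qed (rule A(1))
    from definable_imp_sat_at[OF this subset_refl] obtain \<phi>
      where \<phi>: "\<phi> \<in> fms L (length (?x @ ?y))" "\<And>e. ?R e \<longleftrightarrow> sat_at M (map e (?x @ ?y)) \<phi>" by metis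
    have \<phi>': "\<phi> \<in> fms L (length vs + n)" using \<phi>(1) by simp
    have my: "map (case_sum u ((!) d)) ?y = d" if "length d = n" for u :: "'k \<Rightarrow> 'a" and d
      by (rule nth_equalityI) (use that in auto)
    have mx: "map (case_sum u d) (map Inl zs) = map u zs" for u :: "'k \<Rightarrow> 'a" and d :: "nat \<Rightarrow> 'a" and zs
      by simp
    have R: "sat_at M (map u vs @ d) \<phi> \<longleftrightarrow> (\<forall>q \<in> A. sat_at M (map u (snd q) @ d) (fst q))"
      if "length d = n" for u d
      using \<phi>(2)[of "case_sum u ((!) d)"] unfolding map_append mx my[OF that] by blast
    have xs: "sat_at M (map b vs @ a (tooth i)) \<phi>" if i: "i \<in> {i \<in> Field \<kappa>. tp i = p}" for i
    proof -
      have "length (a (tooth i)) = n" using i by (intro len tooth_tree) simp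
      moreover have "sat_at M (map b (snd q) @ a (tooth i)) (fst q)" if "q \<in> A" for q
      proof -
        have "(fst q, snd q) \<in> tp i" using that A(2) i by auto
        then show ?thesis unfolding tp_def by blast
      qed
      ultimately show ?thesis by (subst R) blast+
    qed
    obtain \<beta> where \<beta>: "Z = \<beta> ` {..<card Z}" "\<And>s t. s < t \<Longrightarrow> t < card Z \<Longrightarrow> \<beta> s \<in> underS \<kappa> (\<beta> t)"
      by (rule ex_increasing_enumeration[OF Z]) (rule that)
    have \<beta>F: "\<beta> t \<in> Field \<kappa>" if "t < card Z" for t using \<beta>(1) Z(2) that by auto
    obtain ys where ys: "length ys = length vs" "\<And>t. t < card Z \<Longrightarrow> sat_at M (ys @ c (\<beta> t)) \<phi>"
    proof (rule ccontr)
      assume no: "\<not> thesis"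
      have "CTP L M"
      proof (rule CTP_of_inconsistent_chain[OF si len \<phi>' fib _ length_map xs])
        show "tooth_path i0 (\<beta> t) \<in> tree \<kappa>" if "t < card Z" for t
          by (rule tooth_path(1)[OF i0(1) \<beta>F[OF that]])
        show "tooth_path i0 (\<beta> t) \<lhd> tooth_path i0 (\<beta> u)" if "t < u" "u < card Z" for t u
          by (rule tooth_path(2)[OF i0(1) \<beta>(2)[OF that]])
        fix ys assume "length ys = length vs"
          "\<And>t. t < card Z \<Longrightarrow> sat_at M (ys @ a (tooth_path i0 (\<beta> t))) \<phi>"
        then show False using no that unfolding c_def by blast
      qed auto
      then show False using nctp by blast
    qed
    define u where "u = the \<circ> map_of (zip vs ys)"
    have u: "map u vs = ys"
      by (rule nth_equalityI) (use ys(1) vs(2) in \<open>auto simp: u_def map_of_zip_nth\<close>)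
    have "sat_at M (map u (snd q) @ c j) (fst q)" if "q \<in> A" "j \<in> Z" for q j
    proof -
      obtain t where t: "t < card Z" "j = \<beta> t" using \<open>j \<in> Z\<close> \<beta>(1) by auto
      show ?thesis using ys(2)[OF t(1)] R[OF lc[OF \<beta>F[OF t(1)]], of u] that(1) unfolding u t(2) by blast
    qed
    then show ?thesis by (intro exI[of _ u]) auto
  qed
  \<comment> \<open>\<open>Inl v\<close> is the coordinate of the unknown at \<open>v\<close>, and
    \<open>Inr (j, l)\<close> is the \<open>l\<close>-th entry of the node \<open>c j\<close>. The
    latter are frozen by \<open>e0\<close> when saturation is applied.\<close>
  define yv :: "'k \<Rightarrow> ('k + 'k \<times> nat) list" where "yv j = map (\<lambda>l. Inr (j, l)) [0..<n]" for j
  define V :: "('k + 'k \<times> nat) set" where "V = Inl ` I \<union> Inr ` (Field \<kappa> \<times> {..<n})"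
  define e0 :: "'k + 'k \<times> nat \<Rightarrow> 'a" where "e0 = case_sum b (\<lambda>(j, l). c j ! l)"
  have myv: "map e (yv j) = d j" if "length (d j) = n" "\<And>l. e (Inr (j, l)) = d j ! l"
    for e :: "'k + 'k \<times> nat \<Rightarrow> 'a" and d and j :: 'k
    by (rule nth_equalityI) (use that in \<open>auto simp: yv_def\<close>)
  have lyv: "length (yv j) = n" for j unfolding yv_def by simp
  have yvV: "set (yv j) \<subseteq> Inr ` ({j} \<times> {..<n})" for j unfolding yv_def by auto
  have V: "|V| <o \<mu>"
  proof -
    have "|I| \<le>o \<kappa>"
      using IX card_of_Pow[of X] PX ordLeq_ordLess_trans ordLess_transitive ordLess_imp_ordLeq by blast
    then have 1: "|Inl ` I :: ('k + 'k \<times> nat) set| \<le>o \<kappa>" using card_of_image ordLeq_transitive by blast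
    have "|{..<n}| \<le>o \<kappa>"
      using finite_ordLeq_infinite[OF _ inf] card_of_Field_ordIso[OF card] ordLeq_ordIso_trans by blast
    moreover have "|Field \<kappa>| \<le>o \<kappa>" using card_of_Field_ordIso[OF card] ordIso_imp_ordLeq by blast
    ultimately have "|Field \<kappa> \<times> {..<n}| \<le>o \<kappa>"
      using card_of_Times_ordLeq_infinite_Field[OF inf] card by blast
    then have 2: "|Inr ` (Field \<kappa> \<times> {..<n}) :: ('k + 'k \<times> nat) set| \<le>o \<kappa>"
      using card_of_image ordLeq_transitive by blast
    show ?thesis
      unfolding V_def using card_of_Un_ordLeq_infinite_Field[OF inf 1 2 card] \<mu> ordLeq_ordLess_trans by blast
  qed
  define P1 :: "('f, 'r) fm \<times> 'k list \<Rightarrow> 'k \<Rightarrow> ('k + 'k \<times> nat \<Rightarrow> 'a) \<Rightarrow> bool"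
    where "P1 q j = (\<lambda>e. sat_at M (map e (map Inl (snd q) @ yv j)) (fst q))" for q j
  have P1def: "definable L M (Inl ` I \<union> Inr ` ({j} \<times> {..<n})) (P1 q j)" if "q \<in> p" for q j
    unfolding P1_def
  proof (rule definable_sat_at)
    show "fst q \<in> fms L (length (map Inl (snd q) @ yv j))" using pI(2)[of "fst q" "snd q"] that lyv by simp
    show "set (map Inl (snd q) @ yv j) \<subseteq> Inl ` I \<union> Inr ` ({j} \<times> {..<n})"
      using pI(1)[of "fst q" "snd q"] that yvV[of j] by auto
  qed
  \<comment> \<open>First use of saturation: one family satisfies \<open>p\<close> at all nodes of
    the path.\<close>
  obtain e' where e': "\<And>v. v \<in> range Inr \<Longrightarrow> e' v = e0 v"
    "\<And>R. R \<in> (\<lambda>(q, j). P1 q j) ` (p \<times> Field \<kappa>) \<Longrightarrow> R e'"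
  proof (rule saturated_realizes[OF sat V])
    fix R assume "R \<in> (\<lambda>(q, j). P1 q j) ` (p \<times> Field \<kappa>)"
    then obtain q j where "q \<in> p" "j \<in> Field \<kappa>" "R = P1 q j" by auto
    then show "definable L M V R"
      using definable_mono[OF P1def[of q j], of V] unfolding V_def by blast
  next
    fix Q assume Q: "finite Q" "Q \<subseteq> (\<lambda>(q, j). P1 q j) ` (p \<times> Field \<kappa>)"
    obtain B where B: "B \<subseteq> p \<times> Field \<kappa>" "finite B" "Q = (\<lambda>(q, j). P1 q j) ` B"
      using finite_subset_image[OF Q] by blast
    have fs: "finite (fst ` B)" "fst ` B \<subseteq> p" "finite (snd ` B)" "snd ` B \<subseteq> Field \<kappa>" using B by auto
    obtain u where u: "\<forall>(\<phi>, is) \<in> fst ` B. \<forall>j \<in> snd ` B. sat_at M (map u is @ c j) \<phi>"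
      using finite_solution[OF fs] by blast
    let ?e = "case_sum u (\<lambda>(j, l). c j ! l)"
    have "P1 q j ?e" if "(q, j) \<in> B" for q j
    proof -
      have "map ?e (yv j) = c j" by (rule myv) (use lc B that in auto)
      moreover have "sat_at M (map u (snd q) @ c j) (fst q)" using u that by force
      ultimately show ?thesis unfolding P1_def by (simp add: o_def)
    qed
    then show "\<exists>e. (\<forall>v \<in> range Inr. e v = e0 v) \<and> (\<forall>R \<in> Q. R e)"
      unfolding B(3) e0_def by (intro exI[of _ ?e]) auto
  qed blast
  define u where "u v = e' (Inl v)" for v
  have u: "sat_at M (map u is @ c j) \<phi>" if "(\<phi>, is) \<in> p" "j \<in> Field \<kappa>" for \<phi> "is" j
  proof -
    have "P1 (\<phi>, is) j e'" using e'(2) that by blast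
    moreover have "map e' (yv j) = c j" by (rule myv) (use lc that e'(1) in \<open>auto simp: e0_def\<close>)
    ultimately show ?thesis unfolding P1_def u_def by (simp add: o_def)
  qed
  obtain j0 where j0: "j0 \<in> Field \<kappa>" "underS \<kappa> j0 = {}"
  proof -
    obtain j0 where "j0 \<in> Field \<kappa>" "\<And>x. x \<in> Field \<kappa> \<Longrightarrow> x \<notin> underS \<kappa> j0"
      using ex_minimal[OF subset_refl] i0(1) by blast
    then show thesis using that below_Field by blast
  qed
  have c0: "c j0 = a (tooth i0)" unfolding c_def tooth_path(3)[OF i0(1) j0] ..
  let ?sorted = "sorted_wrt (\<lambda>i j. i \<noteq> j \<and> (i, j) \<in> \<kappa>)"
  \<comment> \<open>All instances of indiscernibility over the unknown family: \<open>P2\<close>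
    says that \<open>\<psi>\<close> does not distinguish two increasing tuples of nodes.\<close>
  define K where "K = {(js, js', is, \<psi>). set js \<subseteq> Field \<kappa> \<and> set js' \<subseteq> Field \<kappa> \<and> length js = length js' \<and>
    ?sorted js \<and> ?sorted js' \<and> set is \<subseteq> I \<and> \<psi> \<in> fms L (length js * n + length is)}"
  define P2 :: "'k list \<times> 'k list \<times> 'k list \<times> ('f, 'r) fm \<Rightarrow> ('k + 'k \<times> nat \<Rightarrow> 'a) \<Rightarrow> bool"
    where "P2 = (\<lambda>(js, js', is, \<psi>) e. sat_at M (map e (concat (map yv js) @ map Inl is)) \<psi> \<longleftrightarrow>
      sat_at M (map e (concat (map yv js') @ map Inl is)) \<psi>)"
  have lyvs: "length (concat (map yv js)) = length js * n" for js
    by (induction js) (simp_all add: lyv)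
  have yvsV: "set (concat (map yv js)) \<subseteq> Inr ` (set js \<times> {..<n})" for js unfolding yv_def by auto
  have P2def: "definable L M (Inl ` I \<union> Inr ` ((set js \<union> set js') \<times> {..<n})) (P2 (js, js', is, \<psi>))"
    if "(js, js', is, \<psi>) \<in> K" for js js' "is" \<psi>
    unfolding P2_def prod.case
  proof (intro definable_iff definable_sat_at)
    show "\<psi> \<in> fms L (length (concat (map yv js) @ map Inl is))"
      "\<psi> \<in> fms L (length (concat (map yv js') @ map Inl is))"
      using that unfolding K_def length_append lyvs by auto
    show "set (concat (map yv js) @ map Inl is) \<subseteq> Inl ` I \<union> Inr ` ((set js \<union> set js') \<times> {..<n})"
      "set (concat (map yv js') @ map Inl is) \<subseteq> Inl ` I \<union> Inr ` ((set js \<union> set js') \<times> {..<n})"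
      using that yvsV[of js] yvsV[of js'] unfolding K_def by auto
  qed
  \<comment> \<open>Second use of saturation. Besides indiscernibility, \<open>p\<close> is demanded
    only at the least node, that is, at the tooth.\<close>
  obtain e where e: "\<And>v. v \<in> range Inr \<Longrightarrow> e v = e0 v"
    "\<And>R. R \<in> (\<lambda>q. P1 q j0) ` p \<union> P2 ` K \<Longrightarrow> R e"
  proof (rule saturated_realizes[OF sat V])
    fix R assume "R \<in> (\<lambda>q. P1 q j0) ` p \<union> P2 ` K"
    then consider q where "q \<in> p" "R = P1 q j0"
      | js js' "is" \<psi> where "(js, js', is, \<psi>) \<in> K" "R = P2 (js, js', is, \<psi>)" by auto
    then show "definable L M V R"
    proof cases
      case 1
      then show ?thesis using definable_mono[OF P1def[of q j0], of V] j0(1) unfolding V_def by blast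
    next
      case 2
      have "(set js \<union> set js') \<subseteq> Field \<kappa>" using 2(1) unfolding K_def by auto
      then have "Inl ` I \<union> Inr ` ((set js \<union> set js') \<times> {..<n}) \<subseteq> V" unfolding V_def by auto
      then show ?thesis using definable_mono[OF P2def[OF 2(1)]] 2(2) by blast
    qed
  next
    fix Q assume Q: "finite Q" "Q \<subseteq> (\<lambda>q. P1 q j0) ` p \<union> P2 ` K"
    have "finite (Q \<inter> P2 ` K)" "Q \<inter> P2 ` K \<subseteq> P2 ` K" using Q by auto
    from finite_subset_image[OF this] obtain B where B: "B \<subseteq> K" "finite B" "Q \<inter> P2 ` K = P2 ` B" by blast
    have Qcases: "(\<exists>q \<in> p. R = P1 q j0) \<or> (\<exists>q \<in> B. R = P2 q)" if "R \<in> Q" for R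
    proof (cases "R \<in> P2 ` K")
      case True
      then have "R \<in> P2 ` B" using that B(3) by blast
      then show ?thesis by blast
    next
      case False
      then show ?thesis using that Q(2) by blast
    qed
    define Z where "Z = insert j0 (\<Union>(js, js', is, \<psi>) \<in> B. set js \<union> set js')"
    have Z: "finite Z" "Z \<subseteq> Field \<kappa>" using B(1,2) j0(1) unfolding Z_def K_def by auto
    have ZB: "set js \<union> set js' \<subseteq> Z" if "(js, js', is, \<psi>) \<in> B" for js js' "is" \<psi>
      using that unfolding Z_def by fast
    obtain \<beta> where \<beta>: "Z = \<beta> ` {..<card Z}" "\<And>s t. s < t \<Longrightarrow> t < card Z \<Longrightarrow> \<beta> s \<in> underS \<kappa> (\<beta> t)"
      by (rule ex_increasing_enumeration[OF Z]) (rule that)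
    have \<beta>F: "\<beta> t \<in> Field \<kappa>" if "t < card Z" for t using \<beta>(1) Z(2) that by auto
    define ix where "ix = inv_into {..<card Z} \<beta>"
    have ix: "ix j < card Z" "\<beta> (ix j) = j" if "j \<in> Z" for j
      using that \<beta>(1) inv_into_into[of j \<beta> "{..<card Z}"] f_inv_into_f[of j \<beta> "{..<card Z}"]
      unfolding ix_def by auto
    have ix\<beta>: "ix (\<beta> t) = t" if "t < card Z" for t
    proof -
      have "inj_on \<beta> {..<card Z}" using Z(1) \<beta>(1) by (metis card_lessThan eq_card_imp_inj_on finite_lessThan)
      then show ?thesis unfolding ix_def using that by simp
    qed
    have ix_mono: "ix j < ix j'" if "j \<in> Z" "j' \<in> Z" "j \<in> underS \<kappa> j'" for j j'
    proof (rule ccontr)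
      assume "\<not> ix j < ix j'"
      then have "ix j' = ix j \<or> \<beta> (ix j') \<in> underS \<kappa> (\<beta> (ix j))"
        using \<beta>(2)[of "ix j'" "ix j"] ix(1)[OF that(1)] by linarith
      then show False using ix(2) that below_asym[OF that(3)] below_iff by metis
    qed
    obtain g :: "nat \<Rightarrow> 'k" where g: "\<And>n. g n \<in> Field \<kappa>" "\<And>n k. n < k \<Longrightarrow> g n \<in> underS \<kappa> (g k)"
      by (rule ex_omega_sequence) (rule that)
    \<comment> \<open>The colour of a choice of places in an increasing \<omega>-sequence of path
      nodes is the truth value of \<open>\<psi>\<close> at these nodes together with
      \<open>u\<close>.\<close>
    define col where "col = (\<lambda>(js :: 'k list, js' :: 'k list, is, \<psi>) x.
      sat_at M (concat (map (\<lambda>t. c (g (x t))) [0..<length js]) @ map u is) \<psi>)"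
    have "\<exists>H \<subseteq> UNIV. infinite H \<and> (\<forall>q \<in> B. homogeneous id {..<length (fst q)} H (col q))"
    proof (rule Ramsey_increasing_finite[where C = UNIV])
      show "col q x = col q y" if "\<And>d. d \<in> {..<length (fst q)} \<Longrightarrow> x d = y d" for q x y
      proof -
        obtain js js' "is" \<psi> where q: "q = (js, js', is, \<psi>)" by (cases q) auto
        have "map (\<lambda>t. c (g (x t))) [0..<length js] = map (\<lambda>t. c (g (y t))) [0..<length js]"
          by (rule map_cong) (use that q in auto)
        from this show ?thesis unfolding col_def q prod.case by (simp only:)
      qed
    qed (use B(2) in auto)
    then obtain H where H: "infinite H" "\<And>q. q \<in> B \<Longrightarrow> homogeneous id {..<length (fst q)} H (col q)"
      by blast
    obtain \<theta> :: "nat \<Rightarrow> nat" where \<theta>: "strict_mono \<theta>" "\<And>t. \<theta> t \<in> H"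
      using infinite_enumerate[OF H(1)] by blast
    \<comment> \<open>Here \<open>u\<close> is kept, and the nodes of \<open>Z\<close> are replaced
      by members of the homogeneous subsequence. All of \<open>Q\<close> holds: the part about
      \<open>p\<close> because \<open>u\<close> satisfies \<open>p\<close> everywhere on the path,
      the rest by homogeneity.\<close>
    define e2 where "e2 = case_sum u (\<lambda>(j, l). c (g (\<theta> (ix j))) ! l)"
    have e2yv: "map e2 (yv j) = c (g (\<theta> (ix j)))" for j
      by (rule myv) (simp_all add: lc g(1) e2_def)
    have e2yvs: "map e2 (concat (map yv js)) = concat (map (\<lambda>j. c (g (\<theta> (ix j)))) js)" for js
      by (induction js) (simp_all add: e2yv)
    have e2x: "map e2 (map Inl is) = map u is" for "is" unfolding e2_def by simp
    have 1: "P1 q j0 e2" if "q \<in> p" for q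
      unfolding P1_def map_append e2yv e2x using u[of "fst q" "snd q"] that g(1) by simp
    have 2: "P2 q e2" if q: "q \<in> B" for q
    proof -
      obtain js js' "is" \<psi> where qe: "q = (js, js', is, \<psi>)" by (cases q) auto
      have qK: "length js = length js'" "?sorted js" "?sorted js'" using q B(1) unfolding qe K_def by auto
      have sat: "sat_at M (map e2 (concat (map yv zs) @ map Inl is)) \<psi> \<longleftrightarrow>
          col q (\<lambda>t. \<theta> (ix (zs ! t)))" if "length zs = length js" for zs
      proof -
        have "map (\<lambda>j. c (g (\<theta> (ix j)))) zs = map (\<lambda>t. c (g (\<theta> (ix (zs ! t))))) [0..<length js]"
          by (rule nth_equalityI) (use that in auto)
        then show ?thesis unfolding col_def qe prod.case map_append e2yvs e2x by simp
      qed
      have inc: "increasing id {..<length js} (\<lambda>t. \<theta> (ix (zs ! t)))"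
        if "?sorted zs" "set zs \<subseteq> Z" "length zs = length js" for zs
        unfolding increasing_def
      proof (intro ballI impI)
        fix s t assume st: "s \<in> {..<length js}" "t \<in> {..<length js}" "id s < id t"
        then have "zs ! s \<in> underS \<kappa> (zs ! t)"
          using sorted_wrt_nth_less[OF that(1), of s t] that(3) unfolding below_iff by simp
        moreover have "zs ! s \<in> Z" "zs ! t \<in> Z" using st that(2,3) nth_mem by auto
        ultimately show "\<theta> (ix (zs ! s)) < \<theta> (ix (zs ! t))"
          using ix_mono \<theta>(1) unfolding strict_mono_def by blast
      qed
      have "set js \<subseteq> Z" "set js' \<subseteq> Z" using ZB q unfolding qe by auto
      note i = inc[OF qK(2) this(1) refl] inc[OF qK(3) this(2) qK(1)[symmetric]]
      have "homogeneous id {..<length js} H (col q)" using H(2)[OF q] unfolding qe by simp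
      then have "col q (\<lambda>t. \<theta> (ix (js ! t))) = col q (\<lambda>t. \<theta> (ix (js' ! t)))"
        using i \<theta>(2) unfolding homogeneous_def by blast
      then show ?thesis using sat[OF refl] sat[OF qK(1)[symmetric]] unfolding P2_def qe prod.case by blast
    qed
    let ?vs = "concat (map (\<lambda>t. yv (\<beta> t)) [0..<card Z])"
    have tab: "tree_table {..<card Z} min (<) (\<lambda>t. tooth_path i0 (g (\<theta> t)))"
      using tooth_path[OF i0(1)] g \<theta>(1) unfolding strict_mono_def by (intro tree_table_chain) blast+
    have tab': "tree_table {..<card Z} min (<) (\<lambda>t. tooth_path i0 (\<beta> t))"
      using tooth_path[OF i0(1)] \<beta>F \<beta>(2) by (intro tree_table_chain) blast+
    \<comment> \<open>The substituted nodes and the actual ones are chains of equal length. Hence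
      the solution for the former gives one for the latter, whose entries are the prescribed
      ones.\<close>
    have st: "same_type L M (map e2 ?vs) (map e0 ?vs)"
    proof -
      have "map e2 (yv (\<beta> t)) = c (g (\<theta> t))" if "t < card Z" for t using e2yv ix\<beta>[OF that] by simp
      then have m2: "map e2 ?vs = concat (map (\<lambda>t. c (g (\<theta> t))) [0..<card Z])"
        unfolding map_concat map_map o_def by (intro arg_cong[where f = concat] map_cong) simp_all
      have "map e0 (yv (\<beta> t)) = c (\<beta> t)" if "t < card Z" for t
        by (rule myv) (use lc \<beta>F that in \<open>auto simp: e0_def\<close>)
      then have m0: "map e0 ?vs = concat (map (\<lambda>t. c (\<beta> t)) [0..<card Z])"
        unfolding map_concat map_map o_def by (intro arg_cong[where f = concat] map_cong) simp_all
      show ?thesis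
        unfolding m2 m0 c_def by (rule strongly_indiscernible_table[OF si tab tab']) auto
    qed
    have vsZ: "Inr ` (Z \<times> {..<n}) \<subseteq> set ?vs"
    proof
      fix v :: "'k + 'k \<times> nat" assume "v \<in> Inr ` (Z \<times> {..<n})"
      then obtain j l where v: "v = Inr (j, l)" "j \<in> Z" "l < n" by auto
      then have "ix j < card Z" "v \<in> set (yv (\<beta> (ix j)))" using ix[of j] unfolding yv_def by auto
      then show "v \<in> set ?vs" by auto
    qed
    have def: "definable L M (Inl ` I \<union> set ?vs) (\<lambda>e. \<forall>R \<in> Q. R e)"
    proof (rule definable_ball[OF Q(1)])
      fix R assume "R \<in> Q"
      then consider q where "q \<in> p" "R = P1 q j0" | q where "q \<in> B" "R = P2 q" using Qcases by blast
      then show "definable L M (Inl ` I \<union> set ?vs) R"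
      proof cases
        case 1
        have "{j0} \<times> {..<n} \<subseteq> Z \<times> {..<n}" unfolding Z_def by auto
        then have "Inl ` I \<union> Inr ` ({j0} \<times> {..<n}) \<subseteq> Inl ` I \<union> set ?vs"
          using vsZ by (meson Un_mono image_mono subset_refl subset_trans)
        then show ?thesis unfolding 1(2) by (rule definable_mono[OF P1def[OF 1(1)]])
      next
        case 2
        obtain js js' "is" \<psi> where qe: "q = (js, js', is, \<psi>)" by (cases q) auto
        have "(set js \<union> set js') \<times> {..<n} \<subseteq> Z \<times> {..<n}"
          by (rule Sigma_mono[OF ZB subset_refl]) (use 2(1) qe in blast)
        then have "Inl ` I \<union> Inr ` ((set js \<union> set js') \<times> {..<n}) \<subseteq> Inl ` I \<union> set ?vs"
          using vsZ by (meson Un_mono image_mono subset_refl subset_trans)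
        moreover have "(js, js', is, \<psi>) \<in> K" using 2(1) B(1) unfolding qe by blast
        ultimately show ?thesis unfolding 2(2) qe by (intro definable_mono[OF P2def])
      qed
    qed
    have "R e2" if "R \<in> Q" for R
    proof -
      consider q where "q \<in> p" "R = P1 q j0" | q where "q \<in> B" "R = P2 q" using Qcases[OF \<open>R \<in> Q\<close>] by blast
      then show ?thesis using 1 2 by cases auto
    qed
    then have "\<exists>e1. (\<forall>v \<in> set ?vs. e1 v = e2 v) \<and> (\<forall>R \<in> Q. R e1)" by blast
    then obtain e1 where e1: "\<forall>v \<in> set ?vs. e1 v = e0 v" "\<forall>R \<in> Q. R e1"
      unfolding same_type_definable_ex[OF st def] by blast
    \<comment> \<open>The transported solution is right only at the entries occurring in
      \<open>?vs\<close>; the remaining ones are reset, which the conditions in \<open>Q\<close> do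
      not notice.\<close>
    define e3 where "e3 v = (case v of Inl w \<Rightarrow> e1 (Inl w) | Inr w \<Rightarrow> e0 (Inr w))" for v
    have "e1 v = e3 v" if "v \<in> Inl ` I \<union> set ?vs" for v
      using that e1(1) unfolding e3_def by (cases v) auto
    then have "\<forall>R \<in> Q. R e3" using definable_cong[OF def, of e1 e3] e1(2) by blast
    moreover have "\<forall>v \<in> range Inr. e3 v = e0 v" unfolding e3_def by auto
    ultimately show "\<exists>e. (\<forall>v \<in> range Inr. e v = e0 v) \<and> (\<forall>R \<in> Q. R e)" by blast
  qed blast
  define b' where "b' v = e (Inl v)" for v
  have eyv: "map e (yv j) = c j" if "j \<in> Field \<kappa>" for j
    by (rule myv) (use lc that e(1) in \<open>auto simp: e0_def\<close>)
  have ex: "map e (map Inl is) = map b' is" for "is" unfolding b'_def by simp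
  have b': "sat_at M (map b' is @ a (tooth i0)) \<phi>"
    if "set is \<subseteq> I" "\<phi> \<in> fms L (length is + n)" "sat_at M (map b is @ a (tooth i0)) \<phi>" for "is" \<phi>
  proof -
    have "(\<phi>, is) \<in> p" using that i0(2) unfolding tp_def by blast
    then have "P1 (\<phi>, is) j0 e" using e(2) by blast
    then show ?thesis unfolding P1_def map_append eyv[OF j0(1)] ex c0 by simp
  qed
  \<comment> \<open>The type of \<open>b\<close> contains each formula or its negation, so
    preservation in one direction is enough.\<close>
  have b'_iff: "sat_at M (map b' is @ a (tooth i0)) \<phi> \<longleftrightarrow> sat_at M (map b is @ a (tooth i0)) \<phi>"
    if "set is \<subseteq> I" "\<phi> \<in> fms L (length is + n)" for "is" \<phi>
  proof -
    have "Neg \<phi> \<in> fms L (length is + n)" using that(2) unfolding fms_def by simp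
    from b'[OF that(1) this] b'[OF that] show ?thesis by auto
  qed
  have lt: "length (a (tooth i0)) = n" by (rule len[OF tooth_tree[OF i0(1)]])
  have "same_type_over_inf L M (set (a (tooth i0))) I b' b"
    unfolding same_type_over_inf_def same_type_over_def
  proof (intro allI impI)
    fix "is" cs assume isI: "set is \<subseteq> I" and cs: "set cs \<subseteq> set (a (tooth i0))"
    \<comment> \<open>A list of parameters among the entries of the tooth is named by positions,
      which reduces the claim to formulas in the full tuple.\<close>
    have "\<forall>x \<in> set cs. \<exists>l < n. a (tooth i0) ! l = x" using cs lt by (metis in_set_conv_nth subsetD)
    then obtain f where f: "\<And>x. x \<in> set cs \<Longrightarrow> f x < n \<and> a (tooth i0) ! f x = x" by metis
    let ?x = "map Inl [0..<length is] :: (nat + nat) list" and ?y = "map Inr [0..<n] :: (nat + nat) list"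
    have "sat_at M (map b' is @ cs) \<phi> \<longleftrightarrow> sat_at M (map b is @ cs) \<phi>"
      if \<phi>: "\<phi> \<in> fms L (length is + length cs)" for \<phi>
    proof -
      have d: "definable L M (set (?x @ ?y)) (\<lambda>e. sat_at M (map e (?x @ map (Inr \<circ> f) cs)) \<phi>)"
        by (rule definable_sat_at) (use \<phi> f in auto)
      obtain \<chi> where \<chi>: "\<chi> \<in> fms L (length (?x @ ?y))"
        "\<And>e. sat_at M (map e (?x @ map (Inr \<circ> f) cs)) \<phi> \<longleftrightarrow> sat_at M (map e (?x @ ?y)) \<chi>"
        using definable_imp_sat_at[OF d subset_refl] by metis
      have "sat_at M (map d is @ cs) \<phi> \<longleftrightarrow> sat_at M (map d is @ a (tooth i0)) \<chi>" for d :: "'k \<Rightarrow> 'a"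
      proof -
        let ?e = "case_sum (\<lambda>k. d (is ! k)) ((!) (a (tooth i0)))"
        have "map ?e ?x = map d is" by (rule nth_equalityI) auto
        moreover have "map ?e ?y = a (tooth i0)" by (rule nth_equalityI) (use lt in auto)
        moreover have "map ?e (map (Inr \<circ> f) cs) = cs" using f by (simp add: o_def map_idI)
        ultimately show ?thesis using \<chi>(2)[of ?e] unfolding map_append by simp
      qed
      then show ?thesis using b'_iff[OF isI, of \<chi>] \<chi>(1) by simp
    qed
    then show "same_type L M (map b' is @ cs) (map b is @ cs)" unfolding same_type_def by simp
  qed
  moreover have "indiscernible_over L M (b' ` I) \<kappa> c"
    unfolding indiscernible_over_def same_type_over_def
  proof (intro allI impI, elim conjE)
    fix js js' cs assume js: "set js \<subseteq> Field \<kappa>" "set js' \<subseteq> Field \<kappa>" "length js = length js'"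
      "?sorted js" "?sorted js'" and cs: "set cs \<subseteq> b' ` I"
    obtain "is" where isI: "set is \<subseteq> I" "cs = map b' is"
    proof -
      have "\<forall>x \<in> set cs. \<exists>v. v \<in> I \<and> b' v = x" using cs by blast
      then obtain f where f: "\<And>x. x \<in> set cs \<Longrightarrow> f x \<in> I \<and> b' (f x) = x" by metis
      show thesis by (rule that[of "map f cs"]) (use f in \<open>auto simp: map_idI\<close>)
    qed
    have ec: "map e (concat (map yv zs) @ map Inl is) = concat (map c zs) @ cs" if "set zs \<subseteq> Field \<kappa>" for zs
    proof -
      have "map e (concat (map yv zs)) = concat (map c zs)"
        using that by (induction zs) (simp_all add: eyv)
      then show ?thesis using ex isI(2) by simp
    qed
    have lcs: "length (concat (map c zs)) = length zs * n" if "set zs \<subseteq> Field \<kappa>" for zs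
      using that by (induction zs) (simp_all add: lc)
    have "sat_at M (concat (map c js) @ cs) \<psi> \<longleftrightarrow> sat_at M (concat (map c js') @ cs) \<psi>"
      if "\<psi> \<in> fms L (length js * n + length is)" for \<psi>
    proof -
      have "(js, js', is, \<psi>) \<in> K" using js isI(1) that unfolding K_def by blast
      then have "P2 (js, js', is, \<psi>) e" using e(2) by blast
      then show ?thesis unfolding P2_def prod.case ec[OF js(1)] ec[OF js(2)] .
    qed
    then show "same_type L M (concat (map c js) @ cs) (concat (map c js') @ cs)"
      unfolding same_type_def length_append lcs[OF js(1)] lcs[OF js(2)] using js(3) isI(2) by simp
  qed
  ultimately show ?thesis using i0(1) unfolding c_def by blast
qed

end

section \<open>A Ramsey theorem for trees\<close>

text \<open>One infinite set need not be homogeneous for infinitely many colourings. Each stage of a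
  descending sequence settles one of them, and a diagonal set is homogeneous for every colouring
  beyond a finite initial part.\<close>

lemma Ramsey_increasing_countable:
  fixes col :: "'w::countable \<Rightarrow> ('d \<Rightarrow> nat) \<Rightarrow> 'c"
  assumes "finite C" "\<And>w x. col w x \<in> C" "\<And>w. finite (D w)" "\<And>w. inj_on (\<rho> w) (D w)"
    and supp: "\<And>w x y. (\<And>d. d \<in> D w \<Longrightarrow> x d = y d) \<Longrightarrow> col w x = col w y"
  obtains H where "infinite H" "\<And>w. \<exists>j. homogeneous (\<rho> w) (D w) (H \<inter> {j..}) (col w)"
proof -
  let ?hom = "\<lambda>k Z. homogeneous (\<rho> (from_nat k)) (D (from_nat k)) Z (col (from_nat k))"
  have "\<exists>Z. \<forall>k. (infinite (Z k)) \<and> (Z (Suc k) \<subseteq> Z k \<and> ?hom k (Z (Suc k)))"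
  proof (rule dependent_nat_choice)
    show "\<exists>x :: nat set. infinite x" by (rule exI[of _ UNIV]) simp
    fix Z :: "nat set" and k assume Z: "infinite Z"
    obtain H where "H \<subseteq> Z" "infinite H" "?hom k H"
    proof (rule Ramsey_increasing[of "D (from_nat k)" "\<rho> (from_nat k)" C "col (from_nat k)" Z])
      show "col (from_nat k) x = col (from_nat k) y" if "\<And>d. d \<in> D (from_nat k) \<Longrightarrow> x d = y d" for x y
        using that by (rule supp)
    qed (rule assms Z)+
    then show "\<exists>Z'. infinite Z' \<and> (Z' \<subseteq> Z \<and> ?hom k Z')" by blast
  qed
  then obtain Z where Z: "\<And>k. infinite (Z k)" "\<And>k. Z (Suc k) \<subseteq> Z k" "\<And>k. ?hom k (Z (Suc k))"
    by blast
  have Zmono: "Z k \<subseteq> Z i" if "i \<le> k" for i k using lift_Suc_antimono_le[of Z, OF Z(2) that] .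
  have "\<exists>h. \<forall>k. h k \<in> Z k \<and> h k < (h (Suc k) :: nat)"
  proof (rule dependent_nat_choice)
    show "\<exists>x. x \<in> Z 0" using Z(1)[of 0] infinite_imp_nonempty by blast
    show "\<exists>y. y \<in> Z (Suc k) \<and> x < y" for x k
      using Z(1)[of "Suc k"] unfolding infinite_nat_iff_unbounded by blast
  qed
  then obtain h where h: "\<And>k. h k \<in> Z k" "\<And>k. h k < h (Suc k)" by blast
  have sm: "strict_mono h" using h(2) by (rule strict_mono_Suc_iff[THEN iffD2, rule_format])
  show thesis
  proof (rule that)
    show "infinite (range h)" using strict_mono_imp_inj_on[OF sm] range_inj_infinite by blast
    fix w :: 'w
    define k where "k = to_nat w"
    have "range h \<inter> {h (Suc k)..} \<subseteq> Z (Suc k)"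
    proof
      fix v assume "v \<in> range h \<inter> {h (Suc k)..}"
      then obtain i where i: "v = h i" "h (Suc k) \<le> h i" by auto
      then have "Suc k \<le> i" using sm by (simp add: strict_mono_less_eq)
      then show "v \<in> Z (Suc k)" using h(1)[of i] Zmono i(1) by blast
    qed
    then have "?hom k (range h \<inter> {h (Suc k)..})" using homogeneous_mono[OF Z(3)] by blast
    then show "\<exists>j. homogeneous (\<rho> w) (D w) (range h \<inter> {j..}) (col w)" unfolding k_def by auto
  qed
qed

section \<open>Colourings of tuples of words\<close>

definition entries :: "nat list list \<Rightarrow> nat set" where
  "entries ws = (\<Union>w \<in> set ws. set w)"

lemma map_map_cong: "(\<And>d. d \<in> entries ws \<Longrightarrow> x d = y d) \<Longrightarrow> map (map x) ws = map (map y) ws"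
  unfolding entries_def by auto

text \<open>Along a suitable sparse set, the colour of a tuple of words depends only on the order pattern of
  their entries.\<close>

lemma limit_colouring:
  fixes col :: "nat list list \<Rightarrow> 'c"
  assumes "finite C" "\<And>ws. col ws \<in> C"
  obtains lim where "\<And>ws. lim ws \<in> C"
    "\<And>ws \<theta>. increasing id (entries ws) \<theta> \<Longrightarrow> lim (map (map \<theta>) ws) = lim ws"
    "\<And>W. finite W \<Longrightarrow> \<exists>y. strict_mono y \<and> (\<forall>ws \<in> W. col (map (map y) ws) = lim ws)"
proof -
  obtain H where H: "infinite H"
    "\<And>ws. \<exists>j. homogeneous id (entries ws) (H \<inter> {j..}) (\<lambda>y. col (map (map y) ws))"
  proof (rule Ramsey_increasing_countable[of C "\<lambda>ws y. col (map (map y) ws)" entries "\<lambda>_. id"])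
    show "col (map (map x) ws) = col (map (map y) ws)" if "\<And>d. d \<in> entries ws \<Longrightarrow> x d = y d" for ws x y
      by (simp only: map_map_cong[OF that])
  qed (auto simp: assms entries_def)
  then obtain J where J: "\<And>ws. homogeneous id (entries ws) (H \<inter> {J ws..}) (\<lambda>y. col (map (map y) ws))"
    by metis
  define Y where "Y j v = enumerate H (v + j)" for j v :: nat
  have Yj: "Y j v \<in> H" "j \<le> Y j v" "strict_mono (Y j)" for j v
    unfolding Y_def using H(1) enumerate_in_set le_enumerate[OF H(1), of "v + j"]
    by (auto intro!: strict_monoI enumerate_mono)
  have Yinc: "increasing id D (Y j \<circ> \<theta>)" if "increasing id D \<theta>" for D :: "nat set" and \<theta> j
    using that Yj(3)[of j] unfolding increasing_def strict_mono_def by simp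
  \<comment> \<open>\<open>lim\<close> is the colour that stabilizes once the entries are spread far
    enough out in \<open>H\<close>. Each \<open>Y j\<close> skips the first \<open>j\<close>
    elements of \<open>H\<close>, so all its values are at least \<open>j\<close>.\<close>
  define lim where "lim ws = col (map (map (Y (J ws))) ws)" for ws
  have lim: "col (map (map (Y j \<circ> \<theta>)) ws) = lim ws"
    if "J ws \<le> j" "increasing id (entries ws) \<theta>" for j \<theta> ws
  proof -
    have "(Y j \<circ> \<theta>) ` entries ws \<subseteq> H \<inter> {J ws..}" "Y (J ws) ` entries ws \<subseteq> H \<inter> {J ws..}"
      using Yj(1) order_trans[OF that(1) Yj(2)] Yj(2) by auto
    moreover have "increasing id (entries ws) (Y j \<circ> \<theta>)" by (rule Yinc[OF that(2)])
    moreover have "increasing id (entries ws) (Y (J ws))"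
      using Yinc[of "entries ws" id] by (simp add: increasing_def)
    ultimately show ?thesis unfolding lim_def using J[of ws] unfolding homogeneous_def by blast
  qed
  have id: "increasing id D id" for D :: "nat set" unfolding increasing_def by simp
  show thesis
  proof (rule that[of lim])
    show "lim ws \<in> C" for ws unfolding lim_def by (rule assms(2))
    show "lim (map (map \<theta>) ws) = lim ws" if \<theta>: "increasing id (entries ws) \<theta>" for ws \<theta>
    proof -
      let ?j = "max (J ws) (J (map (map \<theta>) ws))"
      have "lim ws = col (map (map (Y ?j \<circ> \<theta>)) ws)" using lim[OF _ \<theta>, of ?j] by simp
      also have "\<dots> = col (map (map (Y ?j \<circ> id)) (map (map \<theta>) ws))" by (simp add: o_def)
      also have "\<dots> = lim (map (map \<theta>) ws)" using lim[OF _ id, of "map (map \<theta>) ws" ?j] by simp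
      finally show ?thesis by simp
    qed
    show "\<exists>y. strict_mono y \<and> (\<forall>ws \<in> W. col (map (map y) ws) = lim ws)" if "finite W" for W
    proof -
      obtain j where j: "\<And>ws. ws \<in> W \<Longrightarrow> J ws \<le> j"
      proof -
        have "J ws \<le> Max (J ` W)" if "ws \<in> W" for ws using that \<open>finite W\<close> by simp
        then show thesis by (rule that)
      qed
      have "col (map (map (Y j)) ws) = lim ws" if "ws \<in> W" for ws
        using lim[OF j[OF that] id] by simp
      then show ?thesis using Yj(3) by blast
    qed
  qed
qed

definition node_of :: "nat list \<Rightarrow> nat node" where
  "node_of w = (\<lambda>i. if i < length w then Some (w ! i) else None)"

lemma dom_node_of: "dom (node_of w) = {..<length w}"
  unfolding node_of_def by (auto split: if_splits)

lemma node_of_tree: "node_of w \<in> tree natLeq"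
  unfolding tree_def Field_natLeq natLeq_underS_less using dom_node_of[of w] by (auto simp: lessThan_def)

text \<open>As \<open>k * k + z\<close> stays below the next square for \<open>z < k\<close>, it
  codes the pairs in their lexicographic order.\<close>

lemma square_pair_less:
  fixes z k z' k' :: nat
  assumes "z < k" "z' < k'"
  shows "k * k + z < k' * k' + z' \<longleftrightarrow> k < k' \<or> k = k' \<and> z < z'"
proof -
  have *: "k * k + z < k' * k' + z'" if "k < k'" "z < k" for k k' z z' :: nat
  proof -
    have "k * k + z < Suc k * Suc k" using that(2) by simp
    also have "\<dots> \<le> k' * k'" by (rule mult_le_mono) (use that(1) in simp_all)
    finally show ?thesis by simp
  qed
  show ?thesis using *[of k k' z z'] *[of k' k z' z] assms by (cases k k' rule: linorder_cases) auto
qed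

context infinite_cardinal
begin

section \<open>Coding the nodes of a finite meet-closed set by words\<close>

definition lex_increasing :: "'k node set \<Rightarrow> ('k node \<Rightarrow> nat) \<Rightarrow> bool" where
  "lex_increasing A x \<longleftrightarrow> (\<forall>s \<in> A. \<forall>t \<in> A. lex_less \<kappa> s t \<longrightarrow> x s < x t)"

definition meet_closed :: "'k node set \<Rightarrow> bool" where
  "meet_closed A \<longleftrightarrow> A \<subseteq> tree \<kappa> \<and> (\<forall>s \<in> A. \<forall>t \<in> A. meet \<kappa> s t \<in> A)"

text \<open>The node \<open>s\<close> of \<open>A\<close> is coded by a word of length \<open>x s\<close>. Its entry at position \<open>z\<close> codes the
  pair of \<open>z\<close> and the first node below \<open>s\<close> in \<open>A\<close> whose word is longer than \<open>z\<close>. The entries of all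
  words are thus ordered first by the lexicographic order of the nodes responsible for them, and then
  by position.\<close>

definition stage :: "'k node set \<Rightarrow> ('k node \<Rightarrow> nat) \<Rightarrow> 'k node \<Rightarrow> nat \<Rightarrow> nat" where
  "stage A x s z = (LEAST k. \<exists>u \<in> A. u \<unlhd> s \<and> z < x u \<and> k = x u)"

definition entry :: "'k node set \<Rightarrow> ('k node \<Rightarrow> nat) \<Rightarrow> 'k node \<Rightarrow> nat \<Rightarrow> nat" where
  "entry A x s z = stage A x s z * stage A x s z + z"

definition code :: "'k node set \<Rightarrow> ('k node \<Rightarrow> nat) \<Rightarrow> 'k node \<Rightarrow> nat list" where
  "code A x s = map (entry A x s) [0..<x s]"

lemma lex_increasing_le:
  assumes "lex_increasing A x" "u \<in> A" "v \<in> A" "u \<unlhd> v"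
  shows "x u \<le> x v"
  using assms lex_strict_initseg[of u v] unfolding lex_increasing_def strict_initseg_def
  by (cases "u = v") (auto intro: less_imp_le)

lemma initseg_of_le:
  assumes "lex_increasing A x" "A \<subseteq> tree \<kappa>" "u \<in> A" "v \<in> A" "u \<unlhd> s" "v \<unlhd> s" "x u \<le> x v"
  shows "u \<unlhd> v"
proof (rule ccontr)
  assume n: "\<not> u \<unlhd> v"
  then have "v \<unlhd> u" using initseg_comparable[of u v s] assms by blast
  then have "v \<lhd> u" using n unfolding strict_initseg_def by auto
  then show False using assms(1,3,4,7) lex_strict_initseg unfolding lex_increasing_def by fastforce
qed

text \<open>The nodes of \<open>A\<close> below \<open>s\<close> form a chain on which
  \<open>x\<close> is strictly increasing, so the least value is attained at the least node whose
  word is longer than \<open>z\<close>.\<close>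

lemma stage_node:
  assumes "lex_increasing A x" "A \<subseteq> tree \<kappa>" "s \<in> A" "z < x s"
  obtains u where "u \<in> A" "u \<unlhd> s" "z < x u" "stage A x s z = x u"
    "\<And>v. v \<in> A \<Longrightarrow> v \<unlhd> s \<Longrightarrow> z < x v \<Longrightarrow> u \<unlhd> v"
proof -
  let ?P = "\<lambda>k. \<exists>u \<in> A. u \<unlhd> s \<and> z < x u \<and> k = x u"
  have "?P (x s)" using assms(3,4) by (intro bexI[of _ s]) auto
  then have "?P (stage A x s z)" unfolding stage_def by (rule LeastI)
  then obtain u where u: "u \<in> A" "u \<unlhd> s" "z < x u" "stage A x s z = x u" by blast
  have "u \<unlhd> v" if v: "v \<in> A" "v \<unlhd> s" "z < x v" for v
  proof -
    have "stage A x s z \<le> x v" unfolding stage_def by (rule Least_le) (use v in blast)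
    then show ?thesis using initseg_of_le[OF assms(1,2) u(1) v(1) u(2) v(2)] u(4) by simp
  qed
  then show thesis using u that by blast
qed

text \<open>For \<open>z < x s\<close>, the first node below \<open>t\<close> with a word longer
  than \<open>z\<close> already lies below \<open>s\<close>. Consequently the word of
  \<open>s\<close> is an initial part of the word of \<open>t\<close>.\<close>

lemma stage_initseg:
  assumes "lex_increasing A x" "A \<subseteq> tree \<kappa>" "s \<in> A" "t \<in> A" "s \<unlhd> t" "z < x s"
  shows "stage A x s z = stage A x t z"
proof -
  have "x s \<le> x t" by (rule lex_increasing_le[OF assms(1,3,4,5)])
  then have zt: "z < x t" using assms(6) by simp
  obtain u where u: "u \<in> A" "u \<unlhd> s" "z < x u" "stage A x s z = x u"
    "\<And>v. v \<in> A \<Longrightarrow> v \<unlhd> s \<Longrightarrow> z < x v \<Longrightarrow> u \<unlhd> v"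
    by (rule stage_node[OF assms(1,2,3,6)]) (rule that)
  obtain v where v: "v \<in> A" "v \<unlhd> t" "z < x v" "stage A x t z = x v"
    "\<And>w. w \<in> A \<Longrightarrow> w \<unlhd> t \<Longrightarrow> z < x w \<Longrightarrow> v \<unlhd> w"
    by (rule stage_node[OF assms(1,2,4) zt]) (rule that)
  have "v \<unlhd> u" using v(5)[OF u(1) _ u(3)] u(2) assms(5) map_le_trans by blast
  moreover have "v \<unlhd> s" using v(5)[OF assms(3,5,6)] .
  then have "u \<unlhd> v" using u(5) v by blast
  ultimately show ?thesis using u(4) v(4) map_le_antisym by metis
qed

text \<open>By \<open>lex_beyond_meet\<close> the node \<open>p\<close> may be replaced by
  \<open>u\<close>, and after that \<open>q\<close> by \<open>v\<close>.\<close>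

lemma lex_above_meet:
  assumes "p \<in> tree \<kappa>" "q \<in> tree \<kappa>" "u \<in> tree \<kappa>" "v \<in> tree \<kappa>" "lex_less \<kappa> p q"
    and "meet \<kappa> p q \<lhd> u" "u \<unlhd> p" "meet \<kappa> p q \<lhd> v" "v \<unlhd> q"
  shows "lex_less \<kappa> u v"
proof -
  have "p \<noteq> q" using assms(5) lex_irrefl by blast
  note 1 = lex_beyond_meet[OF assms(3,1,2,6,7) this]
  have m: "meet \<kappa> q u \<lhd> v" using assms(8) 1(2) meet_commute by metis
  note 2 = lex_beyond_meet[OF assms(4,2,3) m assms(9) 1(3)[symmetric]]
  have "\<not> lex_less \<kappa> v u" using 1(1) 2(1) assms(5) lex_asym[OF assms(3,2)] by blast
  then show ?thesis using lex_total[OF assms(3,4)] 2(3) by blast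
qed

lemma strict_above_meet:
  assumes "lex_increasing A x" "A \<subseteq> tree \<kappa>" "m \<in> A" "u \<in> A" "m \<unlhd> s" "u \<unlhd> s" "x m < x u"
  shows "m \<lhd> u"
  using initseg_of_le[OF assms(1-6)] assms(7) unfolding strict_initseg_def by auto

text \<open>The two nodes responsible for the position \<open>x (meet \<kappa> s t)\<close> have
  longer words than the meet, so they lie strictly above it, one on each side. They are ordered as
  \<open>s\<close> and \<open>t\<close> are, and their lengths decide the comparison of the
  entries.\<close>

lemma entry_incomparable:
  assumes "lex_increasing A x" "meet_closed A" "s \<in> A" "t \<in> A" "s \<bottom> t" "lex_less \<kappa> s t"
  shows "x (meet \<kappa> s t) < x s" "x (meet \<kappa> s t) < x t"
    "entry A x s (x (meet \<kappa> s t)) < entry A x t (x (meet \<kappa> s t))"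
proof -
  have A: "A \<subseteq> tree \<kappa>" using assms(2) unfolding meet_closed_def by blast
  have t: "s \<in> tree \<kappa>" "t \<in> tree \<kappa>" using assms(3,4) A by auto
  let ?m = "meet \<kappa> s t"
  have m: "?m \<in> A" using assms(2-4) unfolding meet_closed_def by blast
  note le = meet_le1[OF t] meet_le2[OF t]
  have "?m \<lhd> s" "?m \<lhd> t" using le assms(5) unfolding strict_initseg_def incomparable_def by auto
  then show lt: "x ?m < x s" "x ?m < x t"
    using assms(1,3,4) m lex_strict_initseg unfolding lex_increasing_def by blast+
  obtain u where u: "u \<in> A" "u \<unlhd> s" "x ?m < x u" "stage A x s (x ?m) = x u"
    by (rule stage_node[OF assms(1) A assms(3) lt(1)]) (rule that)
  obtain v where v: "v \<in> A" "v \<unlhd> t" "x ?m < x v" "stage A x t (x ?m) = x v"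
    by (rule stage_node[OF assms(1) A assms(4) lt(2)]) (rule that)
  have "?m \<lhd> u" "?m \<lhd> v"
    using strict_above_meet[OF assms(1) A m u(1) le(1) u(2,3)]
      strict_above_meet[OF assms(1) A m v(1) le(2) v(2,3)] by auto
  then have "lex_less \<kappa> u v"
    using lex_above_meet[OF t _ _ assms(6)] u(1,2) v(1,2) A by blast
  then have "x u < x v" using assms(1) u(1) v(1) unfolding lex_increasing_def by blast
  then show "entry A x s (x ?m) < entry A x t (x ?m)"
    unfolding entry_def u(4) v(4) using square_pair_less[OF u(3) v(3)] by simp
qed

text \<open>The words of incomparable nodes both extend the word of their meet, and
  \<open>entry_incomparable\<close> separates them directly after it. Relabelling entries by a
  strictly increasing \<open>y\<close> preserves this.\<close>

lemma code_embedding: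
  fixes y :: "nat \<Rightarrow> nat"
  assumes inc: "lex_increasing A x" and mc: "meet_closed A" and y: "strict_mono y"
  defines "F \<equiv> \<lambda>s. node_of (map y (code A x s))"
  assumes s: "s \<in> A" and t: "t \<in> A"
  shows "s \<lhd> t \<Longrightarrow> F s \<lhd> F t" "meet natLeq (F s) (F t) = F (meet \<kappa> s t)"
    "lex_less \<kappa> s t \<Longrightarrow> lex_less natLeq (F s) (F t)"
proof -
  have A: "A \<subseteq> tree \<kappa>" using mc unfolding meet_closed_def by blast
  have tr: "s \<in> tree \<kappa>" "t \<in> tree \<kappa>" using s t A by auto
  have Ft: "F s \<in> tree natLeq" for s unfolding F_def by (rule node_of_tree)
  have dF: "dom (F s) = {..<x s}" for s unfolding F_def dom_node_of code_def by simp
  have val: "F s z = (if z < x s then Some (y (entry A x s z)) else None)" for s z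
    unfolding F_def node_of_def code_def by simp
  have le: "F s \<unlhd> F t" if "s \<in> A" "t \<in> A" "s \<unlhd> t" for s t
    unfolding map_le_def dF
  proof
    fix z assume "z \<in> {..<x s}"
    then show "F s z = F t z"
      using stage_initseg[OF inc A that] lex_increasing_le[OF inc that] unfolding val entry_def by simp
  qed
  have strict: "F s \<lhd> F t" if "s \<in> A" "t \<in> A" "s \<lhd> t" for s t
  proof -
    have "x s < x t" using inc that lex_strict_initseg unfolding lex_increasing_def by blast
    then have "F s \<noteq> F t" using dF[of s] dF[of t] by (metis lessThan_eq_iff less_irrefl)
    then show ?thesis using le that unfolding strict_initseg_def by blast
  qed
  then show "s \<lhd> t \<Longrightarrow> F s \<lhd> F t" using s t by blast
  have inco: "meet natLeq (F s) (F t) = F (meet \<kappa> s t) \<and> lex_less natLeq (F s) (F t)"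
    if st: "s \<in> A" "t \<in> A" "s \<bottom> t" "lex_less \<kappa> s t" for s t
  proof -
    let ?m = "meet \<kappa> s t"
    have m: "?m \<in> A" using mc st unfolding meet_closed_def by blast
    have tr: "s \<in> tree \<kappa>" "t \<in> tree \<kappa>" using st A by auto
    note e = entry_incomparable[OF inc mc st]
    have "F ?m \<unlhd> F s" "F ?m \<unlhd> F t" using le m st meet_le1[OF tr] meet_le2[OF tr] by auto
    then have eq: "F s z = F ?m z" "F t z = F ?m z" if "z < x ?m" for z
      using that unfolding map_le_def dF by auto
    have yy: "y (entry A x s (x ?m)) < y (entry A x t (x ?m))"
      using e(3) y unfolding strict_mono_def by blast
    have sp: "nat.split_at (F s) (F t) (x ?m)"
      unfolding nat.split_at_def natLeq_underS_less using eq yy e(1,2) by (auto simp: Field_natLeq val)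
    have "F s |` underS natLeq (x ?m) = F ?m"
    proof
      fix z show "(F s |` underS natLeq (x ?m)) z = F ?m z"
        using eq(1)[of z] by (cases "z < x ?m") (auto simp: restrict_map_def natLeq_underS_less val)
    qed
    then have "meet natLeq (F s) (F t) = F ?m" using nat.split_meet(1)[OF Ft Ft sp] by simp
    moreover have "lex_less natLeq (F s) (F t)"
      unfolding nat.split_lex[OF Ft Ft sp] nat.option_less_def using yy e(1,2) by (simp add: val)
    ultimately show ?thesis by blast
  qed
  show "meet natLeq (F s) (F t) = F (meet \<kappa> s t)"
  proof -
    consider "s \<unlhd> t" | "t \<unlhd> s" | "s \<bottom> t" "lex_less \<kappa> s t" | "s \<bottom> t" "lex_less \<kappa> t s"
      using lex_total[OF tr] unfolding incomparable_def by (cases "s = t") auto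
    then show ?thesis
    proof cases
      case 1
      then show ?thesis using meet_absorb[OF tr] nat.meet_absorb[OF Ft Ft] le[OF s t] by simp
    next
      case 2
      then show ?thesis
        using meet_absorb[OF tr(2,1)] nat.meet_absorb[OF Ft Ft] le[OF t s] meet_commute nat.meet_commute
        by metis
    next
      case 3
      then show ?thesis using inco s t by blast
    next
      case 4
      then have "t \<bottom> s" unfolding incomparable_def by blast
      then show ?thesis using inco[OF t s] 4 meet_commute nat.meet_commute by metis
    qed
  qed
  show "lex_less natLeq (F s) (F t)" if "lex_less \<kappa> s t"
    using that inco[OF s t] strict[OF s t] nat.lex_strict_initseg unfolding lex_less_def by blast
qed

text \<open>Omitting nodes of \<open>S\<close> changes the stages, since a later node becomes
  responsible for a position, but it does not change the order of the entries. In the proof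
  \<open>p\<close>, \<open>q\<close> are responsible within \<open>A\<close> and \<open>u\<close>,
  \<open>v\<close> within \<open>S\<close>, so \<open>u\<close> and \<open>v\<close> are initial
  segments of \<open>p\<close> and \<open>q\<close>. Closure of \<open>A\<close> under meets keeps
  \<open>u\<close> and \<open>v\<close> above the meet of \<open>p\<close> and \<open>q\<close> when
  these are incomparable.\<close>

lemma entry_order:
  assumes inc: "lex_increasing S x" and S: "S \<subseteq> tree \<kappa>" and mc: "meet_closed A" and AS: "A \<subseteq> S"
    and c: "c \<in> A" "z < x c" and d: "d \<in> A" "w < x d"
  shows "entry S x c z < entry S x d w \<longleftrightarrow> entry A x c z < entry A x d w"
proof -
  have incA: "lex_increasing A x" using inc AS unfolding lex_increasing_def by blast
  have A: "A \<subseteq> tree \<kappa>" using S AS by blast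
  have main: "(stage A x c z < stage A x d w \<longrightarrow> stage S x c z < stage S x d w) \<and>
      (stage A x c z = stage A x d w \<longrightarrow> (z < w \<longrightarrow> stage S x c z \<le> stage S x d w) \<and>
        (z = w \<longrightarrow> stage S x c z = stage S x d w))"
    if c: "c \<in> A" "z < x c" and d: "d \<in> A" "w < x d" for c z d w
  proof -
    have cdS: "c \<in> S" "d \<in> S" using c d AS by auto
    obtain p where p: "p \<in> A" "p \<unlhd> c" "z < x p" "stage A x c z = x p"
      "\<And>v. v \<in> A \<Longrightarrow> v \<unlhd> c \<Longrightarrow> z < x v \<Longrightarrow> p \<unlhd> v"
      by (rule stage_node[OF incA A c]) (rule that)
    obtain q where q: "q \<in> A" "q \<unlhd> d" "w < x q" "stage A x d w = x q"
      "\<And>v. v \<in> A \<Longrightarrow> v \<unlhd> d \<Longrightarrow> w < x v \<Longrightarrow> q \<unlhd> v"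
      by (rule stage_node[OF incA A d]) (rule that)
    obtain u where u: "u \<in> S" "u \<unlhd> c" "z < x u" "stage S x c z = x u"
      "\<And>v. v \<in> S \<Longrightarrow> v \<unlhd> c \<Longrightarrow> z < x v \<Longrightarrow> u \<unlhd> v"
      by (rule stage_node[OF inc S cdS(1) c(2)]) (rule that)
    obtain v where v: "v \<in> S" "v \<unlhd> d" "w < x v" "stage S x d w = x v"
      "\<And>u. u \<in> S \<Longrightarrow> u \<unlhd> d \<Longrightarrow> w < x u \<Longrightarrow> v \<unlhd> u"
      by (rule stage_node[OF inc S cdS(2) d(2)]) (rule that)
    have pq: "p \<in> S" "q \<in> S" "p \<in> tree \<kappa>" "q \<in> tree \<kappa>" using p q AS S by auto
    have uv: "u \<in> tree \<kappa>" "v \<in> tree \<kappa>" using u v S by auto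
    have up: "u \<unlhd> p" and vq: "v \<unlhd> q" using u(5)[OF pq(1) p(2,3)] v(5)[OF pq(2) q(2,3)] by auto
    have less: "x u < x v" if "lex_less \<kappa> p q"
    proof (cases "p \<unlhd> q")
      \<comment> \<open>As \<open>q\<close> is the first node of \<open>A\<close> below
        \<open>d\<close> with a word longer than \<open>w\<close>, the word of \<open>p\<close> has
        length at most \<open>w\<close>, and \<open>x u \<le> x p \<le> w < x v\<close>.\<close>
      case True
      have "p \<noteq> q" using that lex_irrefl by blast
      then have "\<not> w < x p" using q(5)[OF p(1)] True q(2) map_le_trans map_le_antisym by metis
      then show ?thesis using lex_increasing_le[OF inc u(1) pq(1) up] v(3) by simp
    next
      case False
      let ?m = "meet \<kappa> p q"
      have m: "?m \<in> A" "?m \<in> S" using mc p(1) q(1) AS unfolding meet_closed_def by auto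
      note le = meet_le1[OF pq(3,4)] meet_le2[OF pq(3,4)]
      have mc: "?m \<unlhd> c" "?m \<unlhd> d" using le p(2) q(2) map_le_trans by blast+
      have nq: "\<not> q \<unlhd> p"
      proof
        assume "q \<unlhd> p"
        then have "q \<lhd> p" using False unfolding strict_initseg_def by auto
        then show False using lex_asym[OF pq(3,4) that] lex_strict_initseg by blast
      qed
      \<comment> \<open>Were the word of the meet longer than \<open>z\<close>, the node
        \<open>p\<close>, being the first one in \<open>A\<close> below \<open>c\<close> with this
        property, would lie below the meet and hence below \<open>q\<close>.\<close>
      have "\<not> z < x ?m" using p(5)[OF m(1) mc(1)] False le(2) map_le_trans by blast
      then have "?m \<lhd> u" using strict_above_meet[OF inc S m(2) u(1) le(1) up] u(3) by simp
      moreover have "\<not> w < x ?m" using q(5)[OF m(1) mc(2)] nq le(1) map_le_trans by blast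
      then have "?m \<lhd> v" using strict_above_meet[OF inc S m(2) v(1) le(2) vq] v(3) by simp
      ultimately have "lex_less \<kappa> u v" using lex_above_meet[OF pq(3,4) uv that _ up _ vq] by blast
      then show ?thesis using inc u(1) v(1) unfolding lex_increasing_def by blast
    qed
    have eqp: "p = q" if "x p = x q"
    proof (rule ccontr)
      assume "p \<noteq> q"
      then have "x p < x q \<or> x q < x p"
        using lex_total[OF pq(3,4)] incA p(1) q(1) unfolding lex_increasing_def by blast
      then show False using that by simp
    qed
    \<comment> \<open>If one node of \<open>A\<close> is responsible for both entries, their order
      over \<open>A\<close> is that of the positions; over \<open>S\<close> the stage can only grow
      with the position.\<close>
    have le1: "x u \<le> x v" if "p = q" "z \<le> w"
    proof -
      have "v \<unlhd> c" using vq p(2) that(1) map_le_trans by blast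
      then have "u \<unlhd> v" using u(5)[OF v(1)] v(3) that(2) by simp
      then show ?thesis using lex_increasing_le[OF inc u(1) v(1)] by blast
    qed
    have le2: "x v \<le> x u" if "p = q" "w \<le> z"
    proof -
      have "u \<unlhd> d" using up q(2) that(1) map_le_trans by blast
      then have "v \<unlhd> u" using v(5)[OF u(1)] u(3) that(2) by simp
      then show ?thesis using lex_increasing_le[OF inc v(1) u(1)] by blast
    qed
    have lt: "lex_less \<kappa> p q" if "x p < x q"
    proof -
      have "p \<noteq> q" using that by auto
      then show ?thesis
        using lex_total[OF pq(3,4)] incA p(1) q(1) that unfolding lex_increasing_def by fastforce
    qed
    show ?thesis unfolding p(4) q(4) u(4) v(4) using less lt eqp le1 le2 by (metis le_antisym less_imp_le_nat order_refl)
  qed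
  have st: "z < stage B x c z" if "lex_increasing B x" "B \<subseteq> tree \<kappa>" "c \<in> B" "z < x c" for B c z
    using stage_node[OF that] by metis
  have cdS: "c \<in> S" "d \<in> S" using c d AS by auto
  note lts = st[OF inc S cdS(1) c(2)] st[OF inc S cdS(2) d(2)] st[OF incA A c] st[OF incA A d]
  show ?thesis
    unfolding entry_def square_pair_less[OF lts(1,2)] square_pair_less[OF lts(3,4)]
    using main[OF c d] main[OF d c] by (metis le_antisym less_imp_le_nat linorder_neqE_nat not_less_iff_gr_or_eq le_neq_implies_less)
qed

section \<open>Change of the surrounding set and isomorphisms\<close>

lemma entries_code: "entries (map (code A x) cs) = {entry A x c z | c z. c \<in> set cs \<and> z < x c}"
  unfolding entries_def code_def by fastforce

text \<open>By \<open>entry_order\<close>, equal entries over \<open>A\<close> correspond to equal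
  entries over \<open>S\<close>, so sending one to the other is a well-defined increasing
  map.\<close>

lemma code_pattern:
  assumes inc: "lex_increasing S x" and S: "S \<subseteq> tree \<kappa>" and mc: "meet_closed A" and AS: "A \<subseteq> S"
    and cs: "set cs \<subseteq> A"
  obtains \<theta> where "increasing id (entries (map (code A x) cs)) \<theta>"
    "map (code S x) cs = map (map \<theta>) (map (code A x) cs)"
proof -
  note ord = entry_order[OF inc S mc AS]
  have eq: "entry S x c z = entry S x d w" if "entry A x c z = entry A x d w"
    "c \<in> A" "z < x c" "d \<in> A" "w < x d" for c z d w
    using ord[OF that(2-5)] ord[OF that(4,5,2,3)] that(1) by simp
  define \<theta> where "\<theta> v = (THE k. \<exists>c z. c \<in> A \<and> z < x c \<and> v = entry A x c z \<and> k = entry S x c z)" for v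
  have \<theta>: "\<theta> (entry A x c z) = entry S x c z" if "c \<in> A" "z < x c" for c z
    unfolding \<theta>_def
  proof (rule the_equality)
    show "\<exists>c' z'. c' \<in> A \<and> z' < x c' \<and> entry A x c z = entry A x c' z' \<and>
      entry S x c z = entry S x c' z'" using that by blast
    fix k assume "\<exists>c' z'. c' \<in> A \<and> z' < x c' \<and> entry A x c z = entry A x c' z' \<and> k = entry S x c' z'"
    then show "k = entry S x c z" using eq that by metis
  qed
  show thesis
  proof (rule that[of \<theta>])
    show "increasing id (entries (map (code A x) cs)) \<theta>"
      unfolding increasing_def entries_code
    proof (intro ballI impI)
      fix v v' assume "v \<in> {entry A x c z | c z. c \<in> set cs \<and> z < x c}"
        "v' \<in> {entry A x c z | c z. c \<in> set cs \<and> z < x c}" and lt: "id v < id v'"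
      then obtain c z d w where *: "v = entry A x c z" "c \<in> A" "z < x c" "v' = entry A x d w" "d \<in> A" "w < x d"
        using cs by blast
      show "\<theta> v < \<theta> v'" using \<theta>[OF *(2,3)] \<theta>[OF *(5,6)] ord[OF *(2,3,5,6)] lt *(1,4) by simp
    qed
    have "code S x c = map \<theta> (code A x c)" if "c \<in> set cs" for c
      unfolding code_def using \<theta>[of c] that cs by auto
    then show "map (code S x) cs = map (map \<theta>) (map (code A x) cs)" by simp
  qed
qed

text \<open>A code uses the set only through its initial segment relation and the lengths of words;
  \<open>\<tau>\<close> preserves the former and the latter are composed with it.\<close>

lemma code_transport:
  assumes le: "\<And>c d. c \<in> A \<Longrightarrow> d \<in> A \<Longrightarrow> \<tau> c \<unlhd> \<tau> d \<longleftrightarrow> c \<unlhd> d" and c: "c \<in> A"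
  shows "code (\<tau> ` A) x (\<tau> c) = code A (x \<circ> \<tau>) c"
proof -
  have "stage (\<tau> ` A) x (\<tau> c) z = stage A (x \<circ> \<tau>) c z" for z
    unfolding stage_def using le c by (intro arg_cong[where f = Least] ext) auto
  then show ?thesis unfolding code_def entry_def by simp
qed

lemma meets_finite_closed:
  assumes "finite S0" "S0 \<subseteq> tree \<kappa>"
  obtains S where "finite S" "S0 \<subseteq> S" "meet_closed S"
proof (rule that)
  let ?S = "(\<lambda>(a, b). meet \<kappa> a b) ` (S0 \<times> S0)"
  show "finite ?S" using assms(1) by simp
  show "S0 \<subseteq> ?S"
  proof
    fix s assume "s \<in> S0"
    then have "s \<in> tree \<kappa>" using assms(2) by blast
    then have "s = meet \<kappa> s s" using meet_absorb[of s s] by simp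
    then show "s \<in> ?S" using \<open>s \<in> S0\<close> by (intro image_eqI[of _ _ "(s, s)"]) simp_all
  qed
  have "?S \<subseteq> tree \<kappa>" using meet_tree assms(2) by auto
  then show "meet_closed ?S"
    unfolding meet_closed_def by (intro conjI ballI meets_closed[OF assms(2)])
qed

text \<open>\<open>A\<close> consists of the values of all terms at \<open>cs\<close>, and
  \<open>\<tau>\<close> sends the value of a term at \<open>cs\<close> to its value at
  \<open>cs'\<close>. Equality of the quantifier-free types makes this well defined and an
  isomorphism.\<close>

lemma same_qf_type_iso:
  assumes same: "same_qf_type tree_lang (tree_struct \<kappa>) cs cs'"
    and S: "meet_closed S" "set cs \<subseteq> S" "set cs' \<subseteq> S"
  obtains A \<tau> where "meet_closed A" "A \<subseteq> S" "meet_closed (\<tau> ` A)" "\<tau> ` A \<subseteq> S" "set cs \<subseteq> A" "cs' = map \<tau> cs"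
    "\<And>c d. c \<in> A \<Longrightarrow> d \<in> A \<Longrightarrow> \<tau> c \<unlhd> \<tau> d \<longleftrightarrow> c \<unlhd> d"
    "\<And>c d. c \<in> A \<Longrightarrow> d \<in> A \<Longrightarrow> lex_less \<kappa> (\<tau> c) (\<tau> d) \<longleftrightarrow> lex_less \<kappa> c d"
proof -
  let ?v = "val (tree_struct \<kappa>) (\<lambda>v. cs ! v)" and ?v' = "val (tree_struct \<kappa>) (\<lambda>v. cs' ! v)"
  define G where "G = {t. wf_tm tree_lang t \<and> fv_tm t \<subseteq> {..<length cs}}"
  have l: "length cs' = length cs" using same unfolding same_qf_type_def by simp
  have qf: "sat_at (tree_struct \<kappa>) cs \<phi> \<longleftrightarrow> sat_at (tree_struct \<kappa>) cs' \<phi>"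
    if "wf_fm tree_lang \<phi>" "fv \<phi> \<subseteq> {..<length cs}" "qfree \<phi>" for \<phi>
    using same that unfolding same_qf_type_def fms_def by simp
  have inS: "val (tree_struct \<kappa>) (\<lambda>v. zs ! v) t \<in> S"
    if "t \<in> G" "set zs \<subseteq> S" "length zs = length cs" for t zs
    using that(1) unfolding G_def mem_Collect_eq
  proof (induction t)
    case (Var v)
    then show ?case using that(2,3) by (auto simp: subset_iff)
  next
    case (Fn f ts)
    then obtain t u where ts: "ts = [t, u]" using length_2_cases by fastforce
    then have "val (tree_struct \<kappa>) (\<lambda>v. zs ! v) t \<in> S" "val (tree_struct \<kappa>) (\<lambda>v. zs ! v) u \<in> S"
      using Fn by auto
    then show ?case using S(1) ts unfolding meet_closed_def by simp
  qed
  have eq: "?v t = ?v u \<longleftrightarrow> ?v' t = ?v' u" if "t \<in> G" "u \<in> G" for t u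
    using qf[of "Eq t u"] that unfolding G_def by simp
  have rel: "?v t \<unlhd> ?v u \<longleftrightarrow> ?v' t \<unlhd> ?v' u" "lex_less \<kappa> (?v t) (?v u) \<longleftrightarrow> lex_less \<kappa> (?v' t) (?v' u)"
    if "t \<in> G" "u \<in> G" for t u
    using qf[of "Rel InitSegR [t, u]"] qf[of "Rel LexR [t, u]"] that unfolding G_def by simp_all
  have G_meet: "Fn MeetF [t, u] \<in> G" if "t \<in> G" "u \<in> G" for t u using that unfolding G_def by simp
  have closed: "meet_closed (val (tree_struct \<kappa>) (\<lambda>v. zs ! v) ` G)"
    if "set zs \<subseteq> S" "length zs = length cs" for zs
    unfolding meet_closed_def
  proof (intro conjI ballI)
    show "val (tree_struct \<kappa>) (\<lambda>v. zs ! v) ` G \<subseteq> tree \<kappa>"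
      using inS[OF _ that] S(1) unfolding meet_closed_def by blast
    fix s t assume "s \<in> val (tree_struct \<kappa>) (\<lambda>v. zs ! v) ` G" "t \<in> val (tree_struct \<kappa>) (\<lambda>v. zs ! v) ` G"
    then obtain p q where "p \<in> G" "q \<in> G" "s = val (tree_struct \<kappa>) (\<lambda>v. zs ! v) p"
      "t = val (tree_struct \<kappa>) (\<lambda>v. zs ! v) q" by blast
    then show "meet \<kappa> s t \<in> val (tree_struct \<kappa>) (\<lambda>v. zs ! v) ` G"
      by (intro image_eqI[OF _ G_meet[of p q]]) simp_all
  qed
  define \<tau> where "\<tau> c = ?v' (SOME t. t \<in> G \<and> ?v t = c)" for c
  have \<tau>: "\<tau> (?v t) = ?v' t" if "t \<in> G" for t
  proof -
    have "(SOME u. u \<in> G \<and> ?v u = ?v t) \<in> G \<and> ?v (SOME u. u \<in> G \<and> ?v u = ?v t) = ?v t"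
      by (rule someI[of _ t]) (use that in simp)
    then show ?thesis unfolding \<tau>_def using eq that by blast
  qed
  have im: "\<tau> ` ?v ` G = ?v' ` G" unfolding image_image using \<tau> by simp
  have var: "Var v \<in> G" if "v < length cs" for v using that unfolding G_def by simp
  show thesis
  proof (rule that[of "?v ` G" \<tau>])
    show "meet_closed (?v ` G)" using closed S(2) by blast
    show "meet_closed (\<tau> ` ?v ` G)" unfolding im using closed S(3) l by blast
    show "?v ` G \<subseteq> S" using inS S(2) by blast
    show "\<tau> ` ?v ` G \<subseteq> S" unfolding im using inS S(3) l by blast
    show "set cs \<subseteq> ?v ` G"
    proof
      fix c assume "c \<in> set cs"
      then obtain v where "v < length cs" "cs ! v = c" by (metis in_set_conv_nth)
      then show "c \<in> ?v ` G" by (intro image_eqI[OF _ var]) auto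
    qed
    show "cs' = map \<tau> cs"
      by (rule nth_equalityI) (use l \<tau>[OF var] in auto)
    fix c d assume "c \<in> ?v ` G" "d \<in> ?v ` G"
    then obtain t u where "t \<in> G" "u \<in> G" "c = ?v t" "d = ?v u" by blast
    then show "\<tau> c \<unlhd> \<tau> d \<longleftrightarrow> c \<unlhd> d" "lex_less \<kappa> (\<tau> c) (\<tau> d) \<longleftrightarrow> lex_less \<kappa> c d"
      using rel \<tau> by simp_all
  qed
qed

text \<open>By \<open>limit_colouring\<close> the colour depends only on the pattern of the entries,
  so by \<open>code_pattern\<close> it can be computed from the code over the meet-closed set
  \<open>A\<close> generated by the tuple. For a tuple of the same type, the code over the image of
  \<open>A\<close> under the isomorphism \<open>\<tau>\<close> is the code over \<open>A\<close> for
  the lengths \<open>x \<circ> \<tau>\<close>. Homogeneity in the lengths then concludes.\<close>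

theorem tree_Ramsey:
  fixes col :: "nat list list \<Rightarrow> 'c"
  assumes S: "finite S" "meet_closed S"
    and \<Lambda>': "finite \<Lambda>" "\<forall>cs \<in> \<Lambda>. set cs \<subseteq> S"
    and col: "finite C" "\<And>ws. col ws \<in> C"
  shows "\<exists>F. (\<forall>s \<in> S. \<forall>t \<in> S. (s \<lhd> t \<longrightarrow> node_of (F s) \<lhd> node_of (F t)) \<and>
      meet natLeq (node_of (F s)) (node_of (F t)) = node_of (F (meet \<kappa> s t)) \<and>
      (lex_less \<kappa> s t \<longrightarrow> lex_less natLeq (node_of (F s)) (node_of (F t)))) \<and>
    (\<forall>cs \<in> \<Lambda>. \<forall>cs' \<in> \<Lambda>. same_qf_type tree_lang (tree_struct \<kappa>) cs cs' \<longrightarrow>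
      col (map F cs) = col (map F cs'))"
proof -
  have \<Lambda>: "finite \<Lambda>" "\<And>cs. cs \<in> \<Lambda> \<Longrightarrow> set cs \<subseteq> S" using \<Lambda>' by auto
  have St: "S \<subseteq> tree \<kappa>" using S(2) unfolding meet_closed_def by blast
  obtain lim where lim: "\<And>ws. lim ws \<in> C"
    "\<And>ws \<theta>. increasing id (entries ws) \<theta> \<Longrightarrow> lim (map (map \<theta>) ws) = lim ws"
    "\<And>W. finite W \<Longrightarrow> \<exists>y. strict_mono y \<and> (\<forall>ws \<in> W. col (map (map y) ws) = lim ws)"
    by (rule limit_colouring[of C col, OF col]) (rule that)
  define \<rho> where "\<rho> s = card {u \<in> S. lex_less \<kappa> u s}" for s
  have \<rho>_less: "\<rho> s < \<rho> t" if "s \<in> S" "t \<in> S" "lex_less \<kappa> s t" for s t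
    unfolding \<rho>_def
  proof (rule psubset_card_mono)
    have "{u \<in> S. lex_less \<kappa> u s} \<subseteq> {u \<in> S. lex_less \<kappa> u t}"
      using lex_trans[of _ s t] that St by blast
    moreover have "s \<in> {u \<in> S. lex_less \<kappa> u t} - {u \<in> S. lex_less \<kappa> u s}" using that lex_irrefl by blast
    ultimately show "{u \<in> S. lex_less \<kappa> u s} \<subset> {u \<in> S. lex_less \<kappa> u t}" by blast
  qed (use S(1) in simp)
  have \<rho>_iff: "\<rho> s < \<rho> t \<longleftrightarrow> lex_less \<kappa> s t" if "s \<in> S" "t \<in> S" for s t
  proof
    assume lt: "\<rho> s < \<rho> t"
    then have "s \<noteq> t" by auto
    then show "lex_less \<kappa> s t" using lex_total[of s t] \<rho>_less[OF that(2,1)] that St lt by fastforce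
  qed (rule \<rho>_less[OF that])
  have \<rho>_inj: "inj_on \<rho> A" if "A \<subseteq> S" for A
    using that lex_total \<rho>_less St unfolding inj_on_def by (metis less_irrefl subsetD)
  have inc_iff: "increasing \<rho> A x \<longleftrightarrow> lex_increasing A x" if "A \<subseteq> S" for A x
    using that \<rho>_iff unfolding increasing_def lex_increasing_def by (meson subsetD)
  define Q where "Q = {(A, cs). A \<subseteq> S \<and> cs \<in> \<Lambda> \<and> set cs \<subseteq> A}"
  have "Q \<subseteq> Pow S \<times> \<Lambda>" unfolding Q_def by blast
  then have "finite Q" using S(1) \<Lambda>(1) by (meson finite_Pow_iff finite_SigmaI finite_subset)
  \<comment> \<open>For fixed \<open>A\<close> and \<open>cs\<close> this colours the length
    functions on \<open>A\<close>.\<close>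
  define col2 where "col2 = (\<lambda>(A, cs) x. lim (map (code A x) cs))"
  have "\<exists>H \<subseteq> UNIV. infinite H \<and> (\<forall>q \<in> Q. homogeneous \<rho> (fst q) H (col2 q))"
  proof (rule Ramsey_increasing_finite[of Q UNIV C col2 fst "\<lambda>_. \<rho>"])
    show "finite (fst q)" if "q \<in> Q" for q
      using that S(1) finite_subset unfolding Q_def by auto
    show "inj_on \<rho> (fst q)" if "q \<in> Q" for q
      using that \<rho>_inj unfolding Q_def by auto
    show "col2 q x \<in> C" for q x unfolding col2_def by (simp add: lim(1) split: prod.split)
    show "col2 q x = col2 q y" if q: "q \<in> Q" and xy: "\<And>d. d \<in> fst q \<Longrightarrow> x d = y d" for q x y
    proof -
      obtain A cs where qe: "q = (A, cs)" by (cases q)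
      have e: "x d = y d" if "d \<in> A" for d using xy that qe by simp
      have "stage A x s = stage A y s" for s
        unfolding stage_def using e by (intro ext arg_cong[where f = Least]) auto
      then have "code A x c = code A y c" if "c \<in> A" for c
        unfolding code_def entry_def using e[OF that] by simp
      then have "map (code A x) cs = map (code A y) cs" using q unfolding qe Q_def by auto
      then show ?thesis unfolding col2_def qe prod.case by (simp only:)
    qed
  qed (use \<open>finite Q\<close> col(1) in simp_all)
  then obtain H where H: "infinite H" "\<And>q. q \<in> Q \<Longrightarrow> homogeneous \<rho> (fst q) H (col2 q)" by blast
  \<comment> \<open>The lengths are taken from the homogeneous set along the lexicographic ranks
    \<open>\<rho>\<close>.\<close>
  define x where "x s = enumerate H (\<rho> s)" for s
  have xH: "x s \<in> H" for s unfolding x_def using H(1) by (rule enumerate_in_set)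
  have x: "lex_increasing S x"
    unfolding lex_increasing_def x_def using \<rho>_less enumerate_mono H(1) by blast
  define W where "W = (\<lambda>cs. map (code S x) cs) ` \<Lambda>"
  have "finite W" unfolding W_def using \<Lambda>(1) by simp
  \<comment> \<open>The actual entries are chosen only after the lengths, when the finitely many
    words to be relabelled are known.\<close>
  from lim(3)[OF this] obtain y where y: "strict_mono y" "\<And>ws. ws \<in> W \<Longrightarrow> col (map (map y) ws) = lim ws"
    by blast
  define F where "F s = map y (code S x s)" for s
  have colF: "col (map F cs) = lim (map (code S x) cs)" if "cs \<in> \<Lambda>" for cs
  proof -
    have "map F cs = map (map y) (map (code S x) cs)" unfolding F_def by simp
    moreover have "col (map (map y) (map (code S x) cs)) = lim (map (code S x) cs)"
      by (rule y(2)) (use that in \<open>simp add: W_def\<close>)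
    ultimately show ?thesis by (simp only:)
  qed
  have small: "lim (map (code S x) cs) = lim (map (code A x) cs)"
    if "meet_closed A" "A \<subseteq> S" "set cs \<subseteq> A" for A cs
  proof -
    obtain \<theta> where "increasing id (entries (map (code A x) cs)) \<theta>"
      "map (code S x) cs = map (map \<theta>) (map (code A x) cs)"
      by (rule code_pattern[OF x St \<open>meet_closed A\<close> \<open>A \<subseteq> S\<close> \<open>set cs \<subseteq> A\<close>])
    then show ?thesis using lim(2) by metis
  qed
  have hom: "col (map F cs) = col (map F cs')"
    if cs: "cs \<in> \<Lambda>" "cs' \<in> \<Lambda>" and same: "same_qf_type tree_lang (tree_struct \<kappa>) cs cs'" for cs cs'
  proof -
    obtain A \<tau> where A: "meet_closed A" "A \<subseteq> S" "meet_closed (\<tau> ` A)" "\<tau> ` A \<subseteq> S" "set cs \<subseteq> A"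
      "cs' = map \<tau> cs" "\<And>c d. c \<in> A \<Longrightarrow> d \<in> A \<Longrightarrow> \<tau> c \<unlhd> \<tau> d \<longleftrightarrow> c \<unlhd> d"
      "\<And>c d. c \<in> A \<Longrightarrow> d \<in> A \<Longrightarrow> lex_less \<kappa> (\<tau> c) (\<tau> d) \<longleftrightarrow> lex_less \<kappa> c d"
      by (rule same_qf_type_iso[OF same S(2) \<Lambda>(2)[OF cs(1)] \<Lambda>(2)[OF cs(2)]]) (rule that)
    have "(A, cs) \<in> Q" using A cs unfolding Q_def by blast
    then have h: "homogeneous \<rho> A H (col2 (A, cs))" using H(2) by fastforce
    have i: "lex_increasing A x" "lex_increasing A (x \<circ> \<tau>)"
      using x A(2,4,8) unfolding lex_increasing_def by (auto simp: subset_iff)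
    \<comment> \<open>Both \<open>x\<close> and \<open>x \<circ> \<tau>\<close> are increasing on
      \<open>A\<close> with values in \<open>H\<close>; this is where homogeneity in the lengths is
      applied.\<close>
    have "col2 (A, cs) x = col2 (A, cs) (x \<circ> \<tau>)"
    proof -
      have "x ` A \<subseteq> H" "(x \<circ> \<tau>) ` A \<subseteq> H" using xH by auto
      then show ?thesis using h i unfolding homogeneous_def inc_iff[OF A(2)] by blast
    qed
    then have "lim (map (code A x) cs) = lim (map (code A (x \<circ> \<tau>)) cs)" unfolding col2_def by simp
    moreover have "map (code A (x \<circ> \<tau>)) cs = map (code (\<tau> ` A) x) cs'"
      unfolding A(6) using code_transport[of A \<tau>, OF A(7)] A(5) by auto
    moreover have "set cs' \<subseteq> \<tau> ` A" using A(5,6) by auto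
    ultimately show ?thesis
      using colF cs small[OF A(1,2,5)] small[OF A(3,4)] by metis
  qed
  show ?thesis
  proof (intro exI[of _ F] conjI ballI impI)
    fix s t assume st: "s \<in> S" "t \<in> S"
    note emb = code_embedding[OF x S(2) y(1) st, folded F_def]
    show "node_of (F s) \<lhd> node_of (F t)" if "s \<lhd> t" by (rule emb(1)[OF that])
    show "meet natLeq (node_of (F s)) (node_of (F t)) = node_of (F (meet \<kappa> s t))" by (rule emb(2))
    show "lex_less natLeq (node_of (F s)) (node_of (F t))" if "lex_less \<kappa> s t" by (rule emb(3)[OF that])
  qed (rule hom)
qed

end

section \<open>Strongly indiscernible trees from CTP\<close>

context infinite_cardinal
begin

text \<open>A node of length \<alpha> is a subset of \<alpha> \<times> \<omega>, so there are at
  most 2^|X| nodes for each of at most 2^|X| lengths.\<close>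

lemma card_of_tree:
  assumes X: "infinite X" "|Field \<kappa>| \<le>o |Pow X|" "\<And>\<alpha>. \<alpha> \<in> Field \<kappa> \<Longrightarrow> |underS \<kappa> \<alpha>| \<le>o |X|"
  shows "|tree \<kappa>| \<le>o |Pow X|"
proof -
  have "|{\<eta> :: 'k node. dom \<eta> = underS \<kappa> \<alpha>}| \<le>o |Pow X|" if \<alpha>: "\<alpha> \<in> Field \<kappa>" for \<alpha>
  proof -
    let ?g = "\<lambda>\<eta> :: 'k node. {(z, k). \<eta> z = Some k}"
    have "inj ?g"
    proof (rule injI)
      fix \<eta> \<nu> :: "'k node" assume eq: "?g \<eta> = ?g \<nu>"
      show "\<eta> = \<nu>"
      proof
        fix z
        have "(z, k) \<in> ?g \<eta> \<longleftrightarrow> (z, k) \<in> ?g \<nu>" for k by (simp only: eq)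
        then have "\<eta> z = Some k \<longleftrightarrow> \<nu> z = Some k" for k by simp
        then show "\<eta> z = \<nu> z" by (metis not_Some_eq)
      qed
    qed
    then have "inj_on ?g {\<eta>. dom \<eta> = underS \<kappa> \<alpha>}" by (rule inj_on_subset) blast
    moreover have "?g ` {\<eta>. dom \<eta> = underS \<kappa> \<alpha>} \<subseteq> Pow (underS \<kappa> \<alpha> \<times> UNIV)" by auto
    ultimately have "|{\<eta> :: 'k node. dom \<eta> = underS \<kappa> \<alpha>}| \<le>o |Pow (underS \<kappa> \<alpha> \<times> (UNIV :: nat set))|"
      unfolding card_of_ordLeq[symmetric] by blast
    also have "|underS \<kappa> \<alpha> \<times> (UNIV :: nat set)| \<le>o |X|"
      using X(1) X(3)[OF \<alpha>]
      by (intro card_of_Times_ordLeq_infinite_Field card_of_Card_order)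
        (simp_all add: Field_card_of infinite_iff_card_of_nat)
    then have "|Pow (underS \<kappa> \<alpha> \<times> (UNIV :: nat set))| \<le>o |Pow X|" by (rule card_of_Pow_ordLeq)
    finally show ?thesis .
  qed
  then have "|\<Union>\<alpha> \<in> Field \<kappa>. {\<eta> :: 'k node. dom \<eta> = underS \<kappa> \<alpha>}| \<le>o |Pow X|"
    using X(1) by (intro card_of_UNION_ordLeq_infinite[OF _ X(2)] ballI) simp_all
  moreover have "tree \<kappa> = (\<Union>\<alpha> \<in> Field \<kappa>. {\<eta> :: 'k node. dom \<eta> = underS \<kappa> \<alpha>})"
    unfolding tree_def by blast
  ultimately show ?thesis by simp
qed

text \<open>Preservation alone forces reflection: \<open>F\<close> is injective because the
  lexicographic order is total, and initial segments are read off from meets. Hence teeth stay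
  incomparable.\<close>

lemma comb_seq_image:
  assumes S: "meet_closed S"
    and F: "\<And>s t. s \<in> S \<Longrightarrow> t \<in> S \<Longrightarrow> s \<lhd> t \<Longrightarrow> F s \<lhd> F t"
      "\<And>s t. s \<in> S \<Longrightarrow> t \<in> S \<Longrightarrow> meet natLeq (F s) (F t) = F (meet \<kappa> s t)"
      "\<And>s t. s \<in> S \<Longrightarrow> t \<in> S \<Longrightarrow> lex_less \<kappa> s t \<Longrightarrow> lex_less natLeq (F s) (F t)"
      "\<And>s. F s \<in> tree natLeq"
    and comb: "comb_seq N e m" and eS: "\<And>t. t < N \<Longrightarrow> e t \<in> S"
  shows "nat.comb_seq N (\<lambda>t. F (e t)) (\<lambda>t. F (m t))"
proof -
  have St: "S \<subseteq> tree \<kappa>" using S unfolding meet_closed_def by blast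
  have inj: "s = t" if "s \<in> S" "t \<in> S" "F s = F t" for s t
  proof (rule ccontr)
    assume "s \<noteq> t"
    then have "lex_less natLeq (F s) (F t) \<or> lex_less natLeq (F t) (F s)"
      using lex_total[of s t] F(3) that(1,2) St by blast
    then show False using that(3) nat.lex_irrefl by simp
  qed
  have le: "s \<unlhd> t" if "s \<in> S" "t \<in> S" "F s \<unlhd> F t" for s t
  proof -
    have "F (meet \<kappa> s t) = F s"
      using that(3) F(2)[OF that(1,2)] nat.meet_absorb[OF F(4) F(4)] by simp
    moreover have "meet \<kappa> s t \<in> S" using S that unfolding meet_closed_def by blast
    ultimately have "meet \<kappa> s t = s" using inj that(1) by blast
    then show ?thesis using initseg_iff_meet[of s t] that St by blast
  qed
  have e: "meet \<kappa> (e s) (e t) = m s" "lex_less \<kappa> (e t) (e s)" "e s \<bottom> e t" if "s < t" "t < N" for s t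
    using comb that unfolding comb_seq_def by auto
  have mS: "m t \<in> S" if "Suc t < N" for t
    using e(1)[of t "Suc t"] eS[of t] eS[of "Suc t"] that S unfolding meet_closed_def by fastforce
  show ?thesis
    unfolding nat.comb_seq_def
  proof (intro conjI allI impI)
    fix t assume t: "t < N"
    show "F (e t) \<in> tree natLeq" by (rule F(4))
    fix s assume s: "s < t"
    have E: "e s \<in> S" "e t \<in> S" using eS s t by auto
    show "F (e s) \<bottom> F (e t)" using e(3)[OF s t] le E unfolding incomparable_def by blast
    show "meet natLeq (F (e s)) (F (e t)) = F (m s)" using F(2)[OF E] e(1)[OF s t] by simp
    show "lex_less natLeq (F (e t)) (F (e s))" by (rule F(3)[OF E(2,1) e(2)[OF s t]])
  next
    fix t s assume t: "Suc t < N" "s < t"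
    then have "m s \<lhd> m t" using comb unfolding comb_seq_def by blast
    then show "F (m s) \<lhd> F (m t)" using F(1) mS t by simp
  qed
qed

text \<open>The entries of the tree and a common solution at its teeth are the unknowns of one
  application of saturation. A finite part of the conditions mentions finitely many nodes, which
  \<open>tree_Ramsey\<close> places into the given tree of finite sequences.\<close>

theorem ex_strongly_indiscernible:
  fixes L :: "('f, 'r) lang" and M :: "('f, 'r, 'a) struct" and \<mu> :: "'m rel" and a :: "nat node \<Rightarrow> 'a list"
  assumes sat: "saturated L M \<mu>" and X: "infinite X" "|X| <o \<mu>" "|tree \<kappa>| \<le>o |X|"
    and \<phi>: "\<phi> \<in> fms L (m + n)" and len': "\<forall>\<eta> \<in> tree natLeq. length (a \<eta>) = n"
    and comb: "\<forall>X. descending_comb X \<longrightarrow> consistent M m {(\<phi>, a \<eta>) | \<eta>. \<eta> \<in> X}"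
    and branch: "\<forall>\<eta>. k_inconsistent M m k (\<lambda>i::nat. (\<phi>, a (branch_restrict \<eta> i)))"
  shows "\<exists>A xs. strongly_indiscernible L M \<kappa> A \<and> (\<forall>\<eta>. length (A \<eta>) = n) \<and> length xs = m \<and>
    (\<forall>i \<in> Field \<kappa>. sat_at M (xs @ A (tooth i)) \<phi>) \<and>
    (\<forall>c. length c = k \<and> set c \<subseteq> tree \<kappa> \<and> sorted_wrt (\<lhd>) c \<longrightarrow>
      \<not> (\<exists>ys. length ys = m \<and> (\<forall>\<eta> \<in> set c. sat_at M (ys @ A \<eta>) \<phi>)))"
proof -
  have len: "\<And>\<eta>. \<eta> \<in> tree natLeq \<Longrightarrow> length (a \<eta>) = n" using len' by blast
  define yv :: "'k node \<Rightarrow> (nat + 'k node \<times> nat) list" where "yv \<eta> = map (\<lambda>l. Inr (\<eta>, l)) [0..<n]" for \<eta>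
  define xv :: "(nat + 'k node \<times> nat) list" where "xv = map Inl [0..<m]"
  define V :: "(nat + 'k node \<times> nat) set" where "V = Inl ` {..<m} \<union> Inr ` (tree \<kappa> \<times> {..<n})"
  have lyv: "length (yv \<eta>) = n" for \<eta> unfolding yv_def by simp
  have lyvs: "length (concat (map yv c)) = length c * n" for c by (induction c) (simp_all add: lyv)
  have yvV: "set (yv \<eta>) \<subseteq> V" if "\<eta> \<in> tree \<kappa>" for \<eta> using that unfolding yv_def V_def by auto
  have yvsV: "set (concat (map yv c)) \<subseteq> V" if "set c \<subseteq> tree \<kappa>" for c using that yvV by auto
  have xvV: "set xv \<subseteq> V" "length xv = m" unfolding xv_def V_def by auto
  have V: "|V| <o \<mu>"
  proof -
    have fin: "|Y| \<le>o |X|" if "finite Y" for Y :: "nat set" by (rule finite_ordLeq_infinite[OF that X(1)])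
    have iX: "infinite (Field |X| )" using X(1) by (simp add: Field_card_of)
    have 1: "|Inl ` {..<m} :: (nat + 'k node \<times> nat) set| \<le>o |X|"
      by (rule finite_ordLeq_infinite[OF _ X(1)]) simp
    have "|tree \<kappa> \<times> {..<n}| \<le>o |X|"
      by (rule card_of_Times_ordLeq_infinite_Field[OF iX X(3) fin card_of_Card_order]) simp
    then have 2: "|Inr ` (tree \<kappa> \<times> {..<n}) :: (nat + 'k node \<times> nat) set| \<le>o |X|"
      using card_of_image ordLeq_transitive by blast
    show ?thesis
      unfolding V_def using card_of_Un_ordLeq_infinite_Field[OF iX 1 2 card_of_Card_order] X(2) ordLeq_ordLess_trans
      by blast
  qed
  define Pa :: "'k node list \<times> 'k node list \<times> ('f, 'r) fm \<Rightarrow> (nat + 'k node \<times> nat \<Rightarrow> 'a) \<Rightarrow> bool"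
    where "Pa = (\<lambda>(c, c', \<psi>) e. sat_at M (map e (concat (map yv c))) \<psi> \<longleftrightarrow>
      sat_at M (map e (concat (map yv c'))) \<psi>)"
  define Ka where "Ka = {(c, c', \<psi>). set c \<subseteq> tree \<kappa> \<and> set c' \<subseteq> tree \<kappa> \<and>
    same_qf_type tree_lang (tree_struct \<kappa>) c c' \<and> \<psi> \<in> fms L (length c * n)}"
  define Pb :: "'k \<Rightarrow> (nat + 'k node \<times> nat \<Rightarrow> 'a) \<Rightarrow> bool"
    where "Pb i e \<longleftrightarrow> sat_at M (map e (xv @ yv (tooth i))) \<phi>" for i e
  define Sol :: "'k node list \<Rightarrow> (nat + 'k node \<times> nat \<Rightarrow> 'a) \<Rightarrow> bool"
    where "Sol c e \<longleftrightarrow> (\<forall>\<eta> \<in> set c. sat_at M (map e (xv @ yv \<eta>)) \<phi>)" for c e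
  \<comment> \<open>Inconsistency along a chain concerns all candidates for a solution, not the one
    named by \<open>xv\<close>, so the solution variables are projected away.\<close>
  define Pc :: "'k node list \<Rightarrow> (nat + 'k node \<times> nat \<Rightarrow> 'a) \<Rightarrow> bool"
    where "Pc c e \<longleftrightarrow> \<not> (\<exists>e'. (\<forall>v \<in> range Inr. e' v = e v) \<and> Sol c e')" for c e
  define Kc where "Kc = {c. length c = k \<and> set c \<subseteq> tree \<kappa> \<and> sorted_wrt (\<lhd>) c}"
  have defa: "definable L M V (Pa q)" if q: "q \<in> Ka" for q
  proof -
    obtain c c' \<psi> where qe: "q = (c, c', \<psi>)" by (cases q) auto
    have l: "length c = length c'" using q unfolding qe Ka_def same_qf_type_def by auto
    show ?thesis
      unfolding qe Pa_def prod.case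
    proof (intro definable_iff definable_sat_at)
      show "\<psi> \<in> fms L (length (concat (map yv c)))" "\<psi> \<in> fms L (length (concat (map yv c')))"
        unfolding lyvs using q l unfolding qe Ka_def by auto
      show "set (concat (map yv c)) \<subseteq> V" "set (concat (map yv c')) \<subseteq> V"
        using q yvsV unfolding qe Ka_def by blast+
    qed
  qed
  have def\<phi>: "definable L M V (\<lambda>e. sat_at M (map e (xv @ yv \<eta>)) \<phi>)" if "\<eta> \<in> tree \<kappa>" for \<eta>
    by (rule definable_sat_at) (use \<phi> lyv xvV yvV[OF that] in auto)
  have defb: "definable L M V (Pb i)" if "i \<in> Field \<kappa>" for i
    unfolding Pb_def by (rule def\<phi>[OF tooth_tree[OF that]])
  have defc: "definable L M V (Pc c)" if "c \<in> Kc" for c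
    unfolding Pc_def
  proof (rule definable_neg, rule definable_mono[OF definable_project])
    show "definable L M V (Sol c)"
      unfolding Sol_def using that def\<phi> unfolding Kc_def by (intro definable_ball) auto
  qed blast
  obtain e where e: "\<And>R. R \<in> Pa ` Ka \<union> (Pb ` Field \<kappa> \<union> Pc ` Kc) \<Longrightarrow> R e"
  proof (rule saturated_realizes[OF sat V])
    fix R assume "R \<in> Pa ` Ka \<union> (Pb ` Field \<kappa> \<union> Pc ` Kc)"
    then show "definable L M V R" using defa defb defc by blast
  next
    fix Q assume Q: "finite Q" "Q \<subseteq> Pa ` Ka \<union> (Pb ` Field \<kappa> \<union> Pc ` Kc)"
    have fi: "finite (Q \<inter> Z)" "Q \<inter> Z \<subseteq> Z" for Z using Q(1) by auto
    from finite_subset_image[OF fi[of "Pa ` Ka"]] obtain Ba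
      where Ba: "Ba \<subseteq> Ka" "finite Ba" "Q \<inter> Pa ` Ka = Pa ` Ba" by (elim exE conjE)
    from finite_subset_image[OF fi[of "Pb ` Field \<kappa>"]] obtain Bb
      where Bb: "Bb \<subseteq> Field \<kappa>" "finite Bb" "Q \<inter> Pb ` Field \<kappa> = Pb ` Bb" by (elim exE conjE)
    from finite_subset_image[OF fi[of "Pc ` Kc"]] obtain Bc
      where Bc: "Bc \<subseteq> Kc" "finite Bc" "Q \<inter> Pc ` Kc = Pc ` Bc" by (elim exE conjE)
    define \<Lambda> where "\<Lambda> = fst ` Ba \<union> (fst \<circ> snd) ` Ba"
    define \<Psi> where "\<Psi> = (snd \<circ> snd) ` Ba"
    define S0 where "S0 = (\<Union>c \<in> \<Lambda>. set c) \<union> tooth ` Bb \<union> (\<Union>c \<in> Bc. set c)"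
    have fS0: "finite S0" unfolding S0_def \<Lambda>_def using Ba(2) Bb(2) Bc(2) by simp
    have \<Lambda>t: "set c \<subseteq> tree \<kappa>" if "c \<in> \<Lambda>" for c
      using that Ba(1) unfolding \<Lambda>_def Ka_def by auto
    have S0t: "S0 \<subseteq> tree \<kappa>"
      using \<Lambda>t tooth_tree Bb(1) Bc(1) unfolding S0_def Kc_def by blast
    obtain S where S: "finite S" "S0 \<subseteq> S" "meet_closed S"
      by (rule meets_finite_closed[OF fS0 S0t]) (rule that)
    \<comment> \<open>The colour of a tuple of words is its type restricted to the finitely many
      formulas in question.\<close>
    define col where "col ws = {\<psi> \<in> \<Psi>. sat_at M (concat (map (\<lambda>w. a (node_of w)) ws)) \<psi>}" for ws
    have \<Lambda>: "finite \<Lambda>" "\<forall>c \<in> \<Lambda>. set c \<subseteq> S" using Ba(2) S(2) unfolding \<Lambda>_def S0_def by auto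
    have C: "finite (Pow \<Psi>)" "\<And>ws. col ws \<in> Pow \<Psi>" using Ba(2) unfolding \<Psi>_def col_def by auto
    from tree_Ramsey[of S \<Lambda> "Pow \<Psi>" col, OF S(1,3) \<Lambda> C] obtain F
      where emb: "\<forall>s \<in> S. \<forall>t \<in> S. (s \<lhd> t \<longrightarrow> node_of (F s) \<lhd> node_of (F t)) \<and>
        meet natLeq (node_of (F s)) (node_of (F t)) = node_of (F (meet \<kappa> s t)) \<and>
        (lex_less \<kappa> s t \<longrightarrow> lex_less natLeq (node_of (F s)) (node_of (F t)))"
      and hom: "\<forall>c \<in> \<Lambda>. \<forall>c' \<in> \<Lambda>. same_qf_type tree_lang (tree_struct \<kappa>) c c' \<longrightarrow>
        col (map F c) = col (map F c')" by (elim exE conjE)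
    have F: "\<And>s t. s \<in> S \<Longrightarrow> t \<in> S \<Longrightarrow> s \<lhd> t \<Longrightarrow> node_of (F s) \<lhd> node_of (F t)"
      "\<And>s t. s \<in> S \<Longrightarrow> t \<in> S \<Longrightarrow> meet natLeq (node_of (F s)) (node_of (F t)) = node_of (F (meet \<kappa> s t))"
      "\<And>s t. s \<in> S \<Longrightarrow> t \<in> S \<Longrightarrow> lex_less \<kappa> s t \<Longrightarrow> lex_less natLeq (node_of (F s)) (node_of (F t))"
      using emb by auto
    obtain xs where xs: "length xs = m" "\<And>i. i \<in> Bb \<Longrightarrow> sat_at M (xs @ a (node_of (F (tooth i)))) \<phi>"
    proof -
      obtain \<beta> where \<beta>: "Bb = \<beta> ` {..<card Bb}" "\<And>s t. s < t \<Longrightarrow> t < card Bb \<Longrightarrow> \<beta> s \<in> underS \<kappa> (\<beta> t)"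
        by (rule ex_increasing_enumeration[OF Bb(2,1)]) (rule that)
      have \<beta>B: "\<beta> t \<in> Bb" if "t < card Bb" for t using \<beta>(1) that by auto
      have "comb_seq (card Bb) (\<lambda>t. tooth (\<beta> t)) (\<lambda>t. zeros \<kappa> (\<beta> t))"
        by (rule comb_seq_teeth[OF \<beta>(2)]) (use \<beta>B Bb(1) in auto)
      moreover have "tooth (\<beta> t) \<in> S" if "t < card Bb" for t
        using \<beta>B[OF that] S(2) unfolding S0_def by blast
      ultimately have "nat.comb_seq (card Bb) (\<lambda>t. node_of (F (tooth (\<beta> t)))) (\<lambda>t. node_of (F (zeros \<kappa> (\<beta> t))))"
        using comb_seq_image[of S "\<lambda>s. node_of (F s)", OF S(3) F(1-3) node_of_tree] by blast
      then have "descending_comb ((\<lambda>t. node_of (F (tooth (\<beta> t)))) ` {..<card Bb})"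
        by (rule descending_comb_of_seq)
      from comb[THEN spec, THEN mp, OF this] have "consistent M m {(\<phi>, a \<eta>) | \<eta>. \<eta> \<in> (\<lambda>t. node_of (F (tooth (\<beta> t)))) ` {..<card Bb}}" .
      moreover have "finite {(\<phi>, a \<eta>) | \<eta>. \<eta> \<in> (\<lambda>t. node_of (F (tooth (\<beta> t)))) ` {..<card Bb}}" by simp
      ultimately obtain xs where xs: "length xs = m"
        "realizes M xs {(\<phi>, a \<eta>) | \<eta>. \<eta> \<in> (\<lambda>t. node_of (F (tooth (\<beta> t)))) ` {..<card Bb}}"
        using finite_consistent_iff by blast
      have "sat_at M (xs @ a (node_of (F (tooth i)))) \<phi>" if "i \<in> Bb" for i
      proof -
        obtain t where "t < card Bb" "i = \<beta> t" using \<open>i \<in> Bb\<close> \<beta>(1) by auto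
        then show ?thesis using xs(2) unfolding realizes_def by auto
      qed
      then show thesis using that xs(1) by blast
    qed
    define e where "e = case_sum ((!) xs) (\<lambda>(\<eta>, l). a (node_of (F \<eta>)) ! l)"
    have eyv: "map e (yv \<eta>) = a (node_of (F \<eta>))" for \<eta>
      by (rule nth_equalityI) (simp_all add: yv_def e_def len node_of_tree)
    have exv: "map e xv = xs" by (rule nth_equalityI) (simp_all add: xv_def e_def xs(1))
    have eyvs: "map e (concat (map yv c)) = concat (map (\<lambda>w. a (node_of w)) (map F c))" for c
      by (induction c) (simp_all add: eyv)
    have ea: "Pa q e" if q: "q \<in> Ba" for q
    proof -
      obtain c c' \<psi> where qe: "q = (c, c', \<psi>)" by (cases q) auto
      have "c \<in> \<Lambda>" "c' \<in> \<Lambda>" "\<psi> \<in> \<Psi>" using q unfolding qe \<Lambda>_def \<Psi>_def by force+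
      moreover have "same_qf_type tree_lang (tree_struct \<kappa>) c c'" using q Ba(1) unfolding qe Ka_def by auto
      ultimately have "\<psi> \<in> col (map F c) \<longleftrightarrow> \<psi> \<in> col (map F c')" using hom by blast
      then show ?thesis using \<open>\<psi> \<in> \<Psi>\<close> unfolding qe Pa_def prod.case eyvs col_def by blast
    qed
    have eb: "Pb i e" if "i \<in> Bb" for i unfolding Pb_def map_append eyv exv by (rule xs(2)[OF that])
    have ec: "Pc c e" if c: "c \<in> Bc" for c
      unfolding Pc_def
    proof
      assume "\<exists>e'. (\<forall>v \<in> range Inr. e' v = e v) \<and> Sol c e'"
      then obtain e' where e': "\<forall>v \<in> range Inr. e' v = e v" "Sol c e'" by blast
      have ck: "length c = k" "sorted_wrt (\<lhd>) c" using c Bc(1) unfolding Kc_def by auto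
      have cS: "set c \<subseteq> S" using c S(2) unfolding S0_def by blast
      \<comment> \<open>The last node of the chain extends all others, so the chain lies on the
        branch through it, continued by zeros.\<close>
      define w where "w = F (last c)"
      define \<eta> where "\<eta> i = (if i < length w then w ! i else 0)" for i
      have Flt: "node_of (F (c ! s)) \<lhd> node_of (F (c ! t))" if "s < t" "t < k" for s t
        using F(1) sorted_wrt_nth_less[OF ck(2) that(1)] that ck(1) cS nth_mem by (simp add: subset_iff)
      have lenlt: "length (F (c ! s)) < length (F (c ! t))" if "s < t" "t < k" for s t
      proof -
        have le: "node_of (F (c ! s)) \<unlhd> node_of (F (c ! t))" "node_of (F (c ! s)) \<noteq> node_of (F (c ! t))"
          using Flt[OF that] unfolding strict_initseg_def by auto
        then have "length (F (c ! s)) \<le> length (F (c ! t))"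
          using map_le_implies_dom_le[OF le(1)] unfolding dom_node_of by simp
        moreover have "length (F (c ! s)) \<noteq> length (F (c ! t))"
        proof
          assume "length (F (c ! s)) = length (F (c ! t))"
          then have "node_of (F (c ! t)) \<unlhd> node_of (F (c ! s))"
            using le(1) unfolding map_le_def dom_node_of by auto
          then show False using le map_le_antisym by blast
        qed
        ultimately show ?thesis by simp
      qed
      have br: "node_of (F d) = branch_restrict \<eta> (length (F d))" if d: "d \<in> set c" for d
      proof -
        obtain t where t: "t < k" "d = c ! t" using d ck(1) by (metis in_set_conv_nth)
        then have "c \<noteq> []" using ck(1) by auto
        then have l: "last c = c ! (k - 1)" using ck(1) last_conv_nth by metis
        have "node_of (F d) \<unlhd> node_of w"
        proof (cases "t = k - 1")
          case True
          then show ?thesis unfolding w_def l t(2) by simp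
        next
          case False
          then show ?thesis using Flt[of t "k - 1"] t unfolding w_def l strict_initseg_def by simp
        qed
        then have le: "node_of (F d) i = node_of w i" if "i < length (F d)" for i
          using that unfolding map_le_def dom_node_of by blast
        show ?thesis
        proof
          fix i show "node_of (F d) i = branch_restrict \<eta> (length (F d)) i"
            using le[of i] unfolding branch_restrict_def node_of_def \<eta>_def by (auto split: if_splits)
        qed
      qed
      \<comment> \<open>The words grow strictly in length, so the nodes occupy \<open>k\<close>
        different levels of the branch, and it is levels that \<open>k_inconsistent\<close>
        counts.\<close>
      let ?J = "(\<lambda>t. length (F (c ! t))) ` {..<k}"
      have "inj_on (\<lambda>t. length (F (c ! t))) {..<k}"
        unfolding inj_on_def using lenlt by (metis lessThan_iff less_irrefl linorder_neqE_nat)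
      then have J: "finite ?J" "card ?J = k" by (simp_all add: card_image)
      have "\<not> consistent M m ((\<lambda>i. (\<phi>, a (branch_restrict \<eta> i))) ` ?J)"
        using branch[THEN spec, of \<eta>] J unfolding k_inconsistent_def by blast
      moreover have "realizes M (map e' xv) ((\<lambda>i. (\<phi>, a (branch_restrict \<eta> i))) ` ?J)"
        unfolding realizes_def
      proof
        fix x assume "x \<in> (\<lambda>i. (\<phi>, a (branch_restrict \<eta> i))) ` ?J"
        then obtain t where t: "t < k" "x = (\<phi>, a (branch_restrict \<eta> (length (F (c ! t)))))" by auto
        have d: "c ! t \<in> set c" using t(1) ck(1) by simp
        have "map e' (yv (c ! t)) = map e (yv (c ! t))" using e'(1) unfolding yv_def by simp
        then have "map e' (yv (c ! t)) = a (branch_restrict \<eta> (length (F (c ! t))))"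
          unfolding eyv br[OF d] .
        moreover have "sat_at M (map e' (xv @ yv (c ! t))) \<phi>" using e'(2) d unfolding Sol_def by blast
        ultimately show "case x of (\<phi>, cs) \<Rightarrow> sat_at M (map e' xv @ cs) \<phi>" unfolding t(2) by simp
      qed
      ultimately show False using finite_consistent_iff[of "(\<lambda>i. (\<phi>, a (branch_restrict \<eta> i))) ` ?J" M m] xvV(2)
        by (metis J(1) finite_imageI length_map)
    qed
    have eQ: "R e" if R: "R \<in> Q" for R
    proof -
      have "R \<in> Q \<inter> Pa ` Ka \<or> R \<in> Q \<inter> Pb ` Field \<kappa> \<or> R \<in> Q \<inter> Pc ` Kc" using Q(2) R by blast
      then have "R \<in> Pa ` Ba \<or> R \<in> Pb ` Bb \<or> R \<in> Pc ` Bc" unfolding Ba(3) Bb(3) Bc(3) .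
      then show ?thesis using ea eb ec by (elim disjE imageE) simp_all
    qed
    show "\<exists>e. (\<forall>v \<in> {}. e v = undefined v) \<and> (\<forall>R \<in> Q. R e)"
    proof (intro exI[of _ e] conjI ballI)
      fix R assume "R \<in> Q"
      then show "R e" by (rule eQ)
    qed simp
  qed (rule that)
  define A where "A \<eta> = map e (yv \<eta>)" for \<eta>
  have cA: "concat (map A c) = map e (concat (map yv c))" for c
    unfolding A_def by (induction c) simp_all
  have lA: "length (A \<eta>) = n" for \<eta> unfolding A_def using lyv by simp
  show ?thesis
  proof (intro exI[of _ A] exI[of _ "map e xv"] conjI ballI allI impI notI)
    show "strongly_indiscernible L M \<kappa> A"
      unfolding strongly_indiscernible_def
    proof (intro conjI exI[of _ n] ballI allI impI)
      show "length (A \<eta>) = n" for \<eta> by (rule lA)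
      fix c c' assume c: "set c \<subseteq> tree \<kappa> \<and> set c' \<subseteq> tree \<kappa> \<and>
        same_qf_type tree_lang (tree_struct \<kappa>) c c'"
      then have "length c = length c'" unfolding same_qf_type_def by blast
      moreover have "sat_at M (map e (concat (map yv c))) \<psi> \<longleftrightarrow> sat_at M (map e (concat (map yv c'))) \<psi>"
        if "\<psi> \<in> fms L (length c * n)" for \<psi>
      proof -
        have "(c, c', \<psi>) \<in> Ka" using c that unfolding Ka_def by blast
        then have "Pa (c, c', \<psi>) e" using e by blast
        then show ?thesis unfolding Pa_def prod.case .
      qed
      ultimately show "same_type L M (concat (map A c)) (concat (map A c'))"
        unfolding same_type_def cA length_map lyvs by simp
    qed
    show "length (A \<eta>) = n" for \<eta> by (rule lA)
    show "length (map e xv) = m" using xvV(2) by simp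
    show "sat_at M (map e xv @ A (tooth i)) \<phi>" if "i \<in> Field \<kappa>" for i
    proof -
      have "Pb i e" using e that by blast
      then show ?thesis unfolding Pb_def A_def map_append .
    qed
    fix c assume c: "length c = k \<and> set c \<subseteq> tree \<kappa> \<and> sorted_wrt (\<lhd>) c"
      and "\<exists>ys. length ys = m \<and> (\<forall>\<eta> \<in> set c. sat_at M (ys @ A \<eta>) \<phi>)"
    then obtain ys where ys: "length ys = m" "\<forall>\<eta> \<in> set c. sat_at M (ys @ A \<eta>) \<phi>"
      by (elim exE conjE)
    have "c \<in> Kc" using c unfolding Kc_def by blast
    then have Pc: "Pc c e" using e by blast
    define e' where "e' v = (case v of Inl l \<Rightarrow> ys ! l | Inr w \<Rightarrow> e (Inr w))" for v
    have 1: "map e' xv = ys" by (rule nth_equalityI) (simp_all add: xv_def e'_def ys(1))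
    have 2: "map e' (yv \<eta>) = A \<eta>" for \<eta> unfolding A_def yv_def e'_def by simp
    have "Sol c e'" unfolding Sol_def map_append 1 2 by (rule ys(2))
    moreover have "\<forall>v \<in> range Inr. e' v = e v" by (auto simp: e'_def)
    ultimately show False using Pc unfolding Pc_def by blast
  qed
qed

end

text \<open>\<kappa> is the successor cardinal of 2^|T|, copied to a subset of \<open>'k\<close>.
  The copy exists because the successor is at most 2^(2^|T|) and so below \<mu>, which lives on
  \<open>'k\<close>. Being a successor, it is regular, and its proper initial segments have at most
  2^|T| elements.\<close>

lemma ex_regular_cardinal:
  fixes T :: "'t set" and \<mu> :: "'k rel"
  assumes T: "infinite T" and \<mu>: "ctwo ^c (ctwo ^c |T| ) <o \<mu>"
  obtains \<kappa> :: "'k rel" where "Card_order \<kappa>" "infinite (Field \<kappa>)" "\<kappa> <o \<mu>" "|Pow T| <o \<kappa>"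
    "regularCard \<kappa>" "|Pow (Pow T)| <o \<mu>" "|Field \<kappa>| \<le>o |Pow (Pow T)|"
    "\<And>\<alpha>. \<alpha> \<in> Field \<kappa> \<Longrightarrow> |underS \<kappa> \<alpha>| \<le>o |Pow T|"
proof -
  let ?s = "cardSuc |Pow T|"
  obtain Y :: "('t \<Rightarrow> bool) set" where Y: "ctwo ^c |T| = |Y|" unfolding cexp_def ctwo_def Field_card_of by blast
  have "|Pow T| \<le>o |Y|"
    using ctwo_cexp_Pow[of T] unfolding Y using ordIso_symmetric ordIso_imp_ordLeq by blast
  then have "|Pow (Pow T)| \<le>o |Pow Y|" by (rule card_of_Pow_ordLeq)
  also have "|Pow Y| =o ctwo ^c |Y|" by (rule ordIso_symmetric[OF ctwo_cexp_Pow])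
  finally have PP: "|Pow (Pow T)| <o \<mu>" using \<mu> ordLeq_ordLess_trans unfolding Y by blast
  have s: "Card_order ?s" "|Pow T| <o ?s"
    by (rule cardSuc_Card_order, rule card_of_Card_order) (rule cardSuc_greater, rule card_of_Card_order)
  have sPP: "?s \<le>o |Pow (Pow T)|"
    by (rule cardSuc_least) (simp_all add: card_of_Card_order card_of_Pow)
  have F: "|Field ?s| =o ?s" by (rule card_of_Field_ordIso[OF s(1)])
  have "|Field ?s| <o \<mu>" using F sPP PP ordIso_ordLeq_trans ordLeq_ordLess_trans by blast
  then obtain B where B: "|Field ?s| =o |B :: 'k set|" "|B| <o \<mu>"
    using internalize_card_of_ordLess[of "Field ?s" \<mu>] by blast
  have Bs: "|B| =o ?s" using B(1) F ordIso_symmetric ordIso_transitive by blast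
  have B1: "|Pow T| <o |B|" using s(2) Bs ordIso_symmetric ordLess_ordIso_trans by blast
  have B2: "|B| \<le>o |Pow (Pow T)|" using Bs sPP ordIso_ordLeq_trans by blast
  show thesis
  proof (rule that[of "|B|"])
    show co: "Card_order |B|" by (rule card_of_Card_order)
    show "|B| <o \<mu>" by (rule B(2))
    show "|Pow T| <o |B|" by (rule B1)
    show "|Pow (Pow T)| <o \<mu>" by (rule PP)
    show "|Field |B| | \<le>o |Pow (Pow T)|" using B2 by (simp add: Field_card_of)
    have "infinite B"
      using B1 T card_of_ordLeq_infinite[OF ordLess_imp_ordLeq[OF B1]] by simp
    then show "infinite (Field |B| )" by (simp add: Field_card_of)
    have ci: "Cinfinite |Pow T|"
      using T card_of_Card_order by (intro conjI) (simp_all only: cinfinite_def Field_card_of finite_Pow_iff not_False_eq_True)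
    have "cinfinite ?s" using ci Cinfinite_cardSuc by blast
    then show "regularCard |B|"
      using regularCard_ordIso[OF ordIso_symmetric[OF Bs] _ regularCard_cardSuc[OF ci]] s(1) by blast
    show "|underS |B| \<alpha>| \<le>o |Pow T|" if "\<alpha> \<in> Field |B|" for \<alpha>
    proof -
      have "|underS |B| \<alpha>| <o ?s" using card_of_underS[OF co that] Bs ordLess_ordIso_trans by blast
      then show ?thesis by (simp only: cardSuc_ordLeq_ordLess[OF card_of_Card_order card_of_Card_order])
    qed
  qed
qed

theorem theoremA:
  fixes L :: "('f, 'r) lang" and T :: "('f, 'r) fm set"
    and M :: "('f, 'r, 'a) struct" and \<mu> :: "'k rel"
  assumes "complete_theory L T"
    and "models M T"
    and "Card_order \<mu>" and "ctwo ^c (ctwo ^c |T| ) <o \<mu>"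
    and "saturated L M \<mu>"
  shows "NCTP L M \<longleftrightarrow>
    (\<forall>(I :: 'k set) (b :: 'k \<Rightarrow> 'a) (\<kappa> :: 'k rel) (a :: 'k node \<Rightarrow> 'a list).
       Card_order \<kappa> \<and> \<kappa> <o \<mu> \<and>
       ctwo ^c ( |T| +c |I| +c natLeq) <o \<kappa> \<and> regularCard \<kappa> \<and>
       strongly_indiscernible L M \<kappa> a \<longrightarrow>
       (\<exists>b'. \<exists>i \<in> Field \<kappa>.
          same_type_over_inf L M (set (a (node_append \<kappa> (zeros \<kappa> i) (single_one \<kappa>)))) I b' b \<and>
          indiscernible_over L M (b' ` I) \<kappa>
            (\<lambda>j. a (node_append \<kappa> (node_append \<kappa> (zeros \<kappa> i) (single_one \<kappa>)) (zeros \<kappa> j)))))"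
proof (intro iffI allI impI, elim conjE)
  fix I :: "'k set" and b :: "'k \<Rightarrow> 'a" and \<kappa> :: "'k rel" and a :: "'k node \<Rightarrow> 'a list"
  assume nctp: "NCTP L M" and \<kappa>: "Card_order \<kappa>" "\<kappa> <o \<mu>" "ctwo ^c ( |T| +c |I| +c natLeq) <o \<kappa>"
    and si: "strongly_indiscernible L M \<kappa> a"
  let ?X = "T <+> I <+> (UNIV :: nat set)"
  have X: "|T| +c |I| +c natLeq = |?X|" unfolding csum_def Field_card_of Field_natLeq ..
  have "|Pow ?X| <o \<kappa>"
    using ordIso_ordLess_trans[OF ordIso_symmetric[OF ctwo_cexp_Pow]] \<kappa>(3) unfolding X by blast
  then have "|Pow ?X| \<le>o |Field \<kappa>|"
    using ordLess_imp_ordLeq ordLeq_ordIso_trans ordIso_symmetric card_of_Field_ordIso[OF \<kappa>(1)] by blast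
  then have "infinite (Field \<kappa>)" by (rule card_of_ordLeq_infinite) simp
  then interpret infinite_cardinal \<kappa> by unfold_locales (rule \<kappa>(1))
  show "\<exists>b'. \<exists>i \<in> Field \<kappa>.
      same_type_over_inf L M (set (a (tooth i))) I b' b \<and>
      indiscernible_over L M (b' ` I) \<kappa> (\<lambda>j. a (tooth_path i j))"
    by (rule indiscernible_realization[OF assms(1,5) nctp \<kappa>(2,3) si])
next
  assume realization: "\<forall>(I :: 'k set) (b :: 'k \<Rightarrow> 'a) (\<kappa> :: 'k rel) (a :: 'k node \<Rightarrow> 'a list).
     Card_order \<kappa> \<and> \<kappa> <o \<mu> \<and>
     ctwo ^c ( |T| +c |I| +c natLeq) <o \<kappa> \<and> regularCard \<kappa> \<and>
     strongly_indiscernible L M \<kappa> a \<longrightarrow>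
     (\<exists>b'. \<exists>i \<in> Field \<kappa>.
        same_type_over_inf L M (set (a (node_append \<kappa> (zeros \<kappa> i) (single_one \<kappa>)))) I b' b \<and>
        indiscernible_over L M (b' ` I) \<kappa>
          (\<lambda>j. a (node_append \<kappa> (node_append \<kappa> (zeros \<kappa> i) (single_one \<kappa>)) (zeros \<kappa> j))))"
  show "NCTP L M"
  proof
    assume "CTP L M"
    then obtain m n \<phi> a k where \<phi>: "\<phi> \<in> fms L (m + n)"
      and len: "\<forall>\<eta> \<in> tree natLeq. length (a \<eta>) = n"
      and comb: "\<forall>X. descending_comb X \<longrightarrow> consistent M m {(\<phi>, a \<eta>) | \<eta>. \<eta> \<in> X}"
      and branch: "\<forall>\<eta>. k_inconsistent M m k (\<lambda>i::nat. (\<phi>, a (branch_restrict \<eta> i)))"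
      unfolding CTP_def by (elim exE conjE)
    have T: "infinite T" by (rule infinite_complete_theory[OF assms(1)])
    obtain \<kappa> :: "'k rel" where \<kappa>: "Card_order \<kappa>" "infinite (Field \<kappa>)" "\<kappa> <o \<mu>" "|Pow T| <o \<kappa>"
      "regularCard \<kappa>" "|Pow (Pow T)| <o \<mu>" "|Field \<kappa>| \<le>o |Pow (Pow T)|"
      "\<And>\<alpha>. \<alpha> \<in> Field \<kappa> \<Longrightarrow> |underS \<kappa> \<alpha>| \<le>o |Pow T|"
      by (rule ex_regular_cardinal[OF T assms(4)]) (rule that)
    interpret infinite_cardinal \<kappa> by unfold_locales (rule \<kappa>)+
    have PT: "infinite (Pow T)" "infinite (Pow (Pow T))" using T by auto
    have tree: "|tree \<kappa>| \<le>o |Pow (Pow T)|" by (rule card_of_tree[OF PT(1) \<kappa>(7)]) (rule \<kappa>(8))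
    from ex_strongly_indiscernible[OF assms(5) PT(2) \<kappa>(6) tree \<phi> len comb branch]
    obtain A xs where A: "strongly_indiscernible L M \<kappa> A" "\<forall>\<eta>. length (A \<eta>) = n" "length xs = m"
      and teeth: "\<forall>i \<in> Field \<kappa>. sat_at M (xs @ A (tooth i)) \<phi>"
      and chains: "\<forall>c. length c = k \<and> set c \<subseteq> tree \<kappa> \<and> sorted_wrt (\<lhd>) c \<longrightarrow>
        \<not> (\<exists>ys. length ys = m \<and> (\<forall>\<eta> \<in> set c. sat_at M (ys @ A \<eta>) \<phi>))"
      by (elim exE conjE)
    have lA: "length (A \<eta>) = n" for \<eta> using A(2) by simp
    obtain g :: "nat \<Rightarrow> 'k" where g: "\<And>n. g n \<in> Field \<kappa>" "\<And>n k. n < k \<Longrightarrow> g n \<in> underS \<kappa> (g k)"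
      by (rule ex_omega_sequence) (rule that)
    have ginj: "inj g"
      using g(2) below_iff unfolding inj_def by (metis linorder_neqE_nat)
    \<comment> \<open>Parameters in (ii) are families over a subset of \<open>'k\<close>, so the
      \<open>m\<close> coordinates of \<open>xs\<close> are indexed by \<open>m\<close> elements of
      that type.\<close>
    define I where "I = g ` {..<m}"
    define b where "b v = xs ! (inv g v)" for v
    let ?is = "map g [0..<m]"
    have b: "map b ?is = xs"
      by (rule nth_equalityI) (simp_all add: A(3) b_def inv_f_f[OF ginj])
    have isI: "set ?is \<subseteq> I" unfolding I_def by auto
    have "ctwo ^c ( |T| +c |I| +c natLeq) <o \<kappa>"
    proof -
      let ?X = "T <+> I <+> (UNIV :: nat set)"
      have X: "|T| +c |I| +c natLeq = |?X|" unfolding csum_def Field_card_of Field_natLeq ..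
      have iT: "infinite (Field |T| )" using T by (simp add: Field_card_of)
      have "|I| \<le>o |T|" by (rule finite_ordLeq_infinite[OF _ T]) (simp add: I_def)
      moreover have "|UNIV :: nat set| \<le>o |T|" using T by (simp add: infinite_iff_card_of_nat)
      ultimately have "|?X| \<le>o |T|"
        using card_of_Plus_ordLeq_infinite_Field[OF iT] card_of_Card_order card_of_refl ordIso_imp_ordLeq by metis
      then have "|Pow ?X| \<le>o |Pow T|" by (rule card_of_Pow_ordLeq)
      then show ?thesis
        unfolding X using ctwo_cexp_Pow[of ?X] \<kappa>(4) ordIso_ordLeq_trans ordLeq_ordLess_trans by blast
    qed
    with \<kappa>(1,3,5) A(1) have "Card_order \<kappa> \<and> \<kappa> <o \<mu> \<and> ctwo ^c ( |T| +c |I| +c natLeq) <o \<kappa> \<and>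
      regularCard \<kappa> \<and> strongly_indiscernible L M \<kappa> A" by (intro conjI)
    from realization[THEN spec, THEN spec, THEN spec, THEN spec, THEN mp, OF this, of b]
    obtain b' i where i: "i \<in> Field \<kappa>" "same_type_over_inf L M (set (A (tooth i))) I b' b"
      "indiscernible_over L M (b' ` I) \<kappa> (\<lambda>j. A (tooth_path i j))"
      by (elim exE bexE conjE)
    define ys where "ys = map b' ?is"
    have ys: "length ys = m" "set ys \<subseteq> b' ` I" unfolding ys_def I_def by auto
    have "same_type L M (ys @ A (tooth i)) (xs @ A (tooth i))"
      using i(2) isI unfolding same_type_over_inf_def same_type_over_def ys_def b[symmetric] by blast
    moreover have "\<phi> \<in> fms L (length (ys @ A (tooth i)))" using \<phi> ys(1) lA by simp
    ultimately have tooth: "sat_at M (ys @ A (tooth i)) \<phi>" using teeth i(1) unfolding same_type_def by blast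
    \<comment> \<open>Indiscernibility places the parameters after the tuple, while the solution
      variables of \<phi> come first; \<chi> is \<phi> with the two blocks exchanged.\<close>
    let ?x = "map Inl [0..<m] :: (nat + nat) list" and ?y = "map Inr [0..<n] :: (nat + nat) list"
    have def: "definable L M (set (?y @ ?x)) (\<lambda>e. sat_at M (map e (?x @ ?y)) \<phi>)"
      by (rule definable_sat_at) (use \<phi> in auto)
    obtain \<chi> where \<chi>: "\<chi> \<in> fms L (length (?y @ ?x))"
      "\<And>e. sat_at M (map e (?x @ ?y)) \<phi> \<longleftrightarrow> sat_at M (map e (?y @ ?x)) \<chi>"
      using definable_imp_sat_at[OF def subset_refl] by metis
    have swap: "sat_at M (ys @ d) \<phi> \<longleftrightarrow> sat_at M (d @ ys) \<chi>" if "length d = n" for d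
    proof -
      have "map (case_sum ((!) ys) ((!) d)) ?x = ys" by (rule nth_equalityI) (simp_all add: ys(1))
      moreover have "map (case_sum ((!) ys) ((!) d)) ?y = d" by (rule nth_equalityI) (simp_all add: that)
      ultimately show ?thesis using \<chi>(2)[of "case_sum ((!) ys) ((!) d)"] unfolding map_append by simp
    qed
    obtain j0 where j0: "j0 \<in> Field \<kappa>" "\<And>x. x \<in> Field \<kappa> \<Longrightarrow> x \<notin> underS \<kappa> j0"
      using ex_minimal[OF subset_refl] i(1) by blast
    have u0: "underS \<kappa> j0 = {}" using j0(2) below_Field by blast
    \<comment> \<open>Indiscernibility for increasing tuples of length one carries \<phi> from the
      node at the least index, which is the tooth, to every node of the path.\<close>
    have path: "sat_at M (ys @ A (tooth_path i j)) \<phi>" if j: "j \<in> Field \<kappa>" for j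
    proof -
      have "same_type_over L M (b' ` I) (concat (map (\<lambda>j. A (tooth_path i j)) [j0]))
        (concat (map (\<lambda>j. A (tooth_path i j)) [j]))"
        using i(3) j0(1) j unfolding indiscernible_over_def
        by (elim allE[of _ "[j0]"] allE[of _ "[j]"]) simp
      then have "same_type L M (A (tooth i) @ ys) (A (tooth_path i j) @ ys)"
        using ys(2) tooth_path(3)[OF i(1) j0(1) u0] unfolding same_type_over_def by simp
      moreover have "\<chi> \<in> fms L (length (A (tooth i) @ ys))" using \<chi>(1) lA ys(1) by simp
      ultimately have "sat_at M (A (tooth i) @ ys) \<chi> \<longleftrightarrow> sat_at M (A (tooth_path i j) @ ys) \<chi>"
        unfolding same_type_def by blast
      then show ?thesis using tooth swap[OF lA] by blast
    qed
    \<comment> \<open>Any \<open>k\<close> nodes of the path form a chain on which \<open>ys\<close>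
      solves \<phi>, against the inconsistency built into the tree.\<close>
    let ?c = "map (\<lambda>t. tooth_path i (g t)) [0..<k]"
    have "length ?c = k \<and> set ?c \<subseteq> tree \<kappa> \<and> sorted_wrt (\<lhd>) ?c"
    proof (intro conjI)
      show "set ?c \<subseteq> tree \<kappa>" using tooth_path(1)[OF i(1)] g(1) by auto
      show "sorted_wrt (\<lhd>) ?c"
        unfolding sorted_wrt_iff_nth_less using tooth_path(2)[OF i(1) g(2)] by simp
    qed simp
    moreover have "\<forall>\<eta> \<in> set ?c. sat_at M (ys @ A \<eta>) \<phi>" using path[OF g(1)] by auto
    ultimately show False using chains ys(1) by blast
  qed
qed

end
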